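(* Let $K$ be a perfect field, let $m\geq 2$ be an integer not divisible by the characteristic of $K$, let $r\ge 2$, and let $F(x)=(x-\alpha_1)\cdots(x-\alpha_r)$ with $\alpha_1,\dots,\alpha_r\in K$ pairwise distinct. Let $C$ be the superelliptic curve $y^m=F(x)$ over $K$ (smooth projective model), let $J(C)$ be its Jacobian, and put $d=\gcd(m,r)$. Let $R_i$ be the point $(\alpha_i,0)$ of $C$ and let $\infty$ be the formal sum of the points at infinity of $C$. Let $\Delta$ be the set of classes in $J(C)$ of divisors of the form $$\sum_{i=1}^r a_iR_i-\frac1d\left(\sum_{i=1}^r a_i\right)\infty,$$ where $a_1,\dots,a_r$ are integers whose sum is divisible by $d$. Then $\Delta$ is a subgroup of $J(C)$ isomorphic to $(\mathbb Z/m\mathbb Z)^{r-2}\times\left(\mathbb Z/\tfrac{m}{d}\mathbb Z\right)$.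
   Context: The superelliptic curve $y^m=F(x)$ means the smooth projective model of the affine curve given by this equation. This affine curve is smooth, so it is identified with an open subset of the projective model; the points of the projective model outside this open subset are called the points at infinity. Over $\overline K$ there are exactly $d=\gcd(m,r)$ of them, and $\infty$ denotes their formal sum, a divisor of degree $d$ defined over $K$. Degree zero divisors are identified with their classes in the Jacobian. *)

theory Defs
  imports "HOL-Algebra.Algebra" "HOL-Algebra.Algebraic_Closure_Type"
    "HOL-Computational_Algebra.Computational_Algebra"
begin

text \<open>
  A field is perfect if every irreducible polynomial over it is separable, that is, has only
  simple roots in an algebraic closure.
\<close>

definition perfect_field :: "'a :: field itself \<Rightarrow> bool" where
  "perfect_field _ \<longleftrightarrow>
     (\<forall>p :: 'a poly. Factorial_Ring.irreducible p \<longrightarrow> rsquarefree (map_poly to_ac p))"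

text \<open>
  The smooth projective model of an affine curve over an algebraically closed field \<open>k\<close> is
  described through its function field \<open>L\<close>: its points are the normalized discrete valuations
  of \<open>L\<close> that are trivial on \<open>k\<close> (equivalently, the discrete valuation rings of \<open>L/k\<close>).

  The function field of \<open>y^m = F(x)\<close> is realized inside a fixed algebraic closure of the
  rational function field \<open>k(x)\<close> by choosing a root \<open>y\<close> of \<open>Y^m - F(x)\<close>. Whenever this
  polynomial is irreducible over \<open>k(x)\<close>, as it is if \<open>F\<close> has a simple root, evaluation at
  \<open>(x, y)\<close> identifies \<open>k[X,Y]/(Y^m - F(X))\<close> with \<open>k[x,y]\<close>, and the choice of \<open>y\<close> is immaterial
  up to an isomorphism over \<open>k(x)\<close>.
\<close>

type_synonym 'k ratfun_closure = "'k poly fract alg_closure"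

definition embed_poly :: "'k :: alg_closed_field poly \<Rightarrow> 'k ratfun_closure" where
  "embed_poly p = to_ac (Fraction_Field.Fract p 1)"

definition coord_y :: "nat \<Rightarrow> 'k :: alg_closed_field poly \<Rightarrow> 'k ratfun_closure" where
  "coord_y m F = (SOME y. y ^ m = embed_poly F)"

text \<open>
  A polynomial in two variables is an element of \<open>k[X][Y]\<close>: the outer variable is \<open>Y\<close>, and the
  coefficients are polynomials in \<open>X\<close>.
\<close>

definition regular_fun :: "nat \<Rightarrow> 'k :: alg_closed_field poly \<Rightarrow> 'k poly poly \<Rightarrow> 'k ratfun_closure" where
  "regular_fun m F u = poly (map_poly embed_poly u) (coord_y m F)"

definition eval_at :: "'k :: alg_closed_field poly poly \<Rightarrow> 'k \<times> 'k \<Rightarrow> 'k" where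
  "eval_at u P = poly (poly u [:snd P:]) (fst P)"

definition function_field :: "nat \<Rightarrow> 'k :: alg_closed_field poly \<Rightarrow> 'k ratfun_closure set" where
  "function_field m F =
     {regular_fun m F u / regular_fun m F v | u v. regular_fun m F v \<noteq> 0}"

definition affine_points :: "nat \<Rightarrow> 'k :: alg_closed_field poly \<Rightarrow> ('k \<times> 'k) set" where
  "affine_points m F = {(a, b). b ^ m = poly F a}"

definition local_ring :: "nat \<Rightarrow> 'k :: alg_closed_field poly \<Rightarrow> 'k \<times> 'k \<Rightarrow> 'k ratfun_closure set" where
  "local_ring m F P =
     {regular_fun m F u / regular_fun m F v | u v. eval_at v P \<noteq> 0}"

text \<open>
  The value of a valuation at \<open>0\<close> and outside \<open>L\<close> is set to \<open>0\<close>, so that a valuation is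
  determined by its restriction to the nonzero elements of \<open>L\<close>.
\<close>

definition discrete_valuation :: "'f :: field set \<Rightarrow> 'f set \<Rightarrow> ('f \<Rightarrow> int) \<Rightarrow> bool" where
  "discrete_valuation k L v \<longleftrightarrow>
     (\<forall>f. f \<notin> L - {0} \<longrightarrow> v f = 0) \<and>
     (\<forall>f\<in>L - {0}. \<forall>g\<in>L - {0}. v (f * g) = v f + v g) \<and>
     (\<forall>f\<in>L - {0}. \<forall>g\<in>L - {0}. f + g \<noteq> 0 \<longrightarrow> min (v f) (v g) \<le> v (f + g)) \<and>
     (\<forall>c\<in>k - {0}. v c = 0) \<and>
     v ` (L - {0}) = UNIV"

definition valuation_ring :: "'f :: field set \<Rightarrow> ('f \<Rightarrow> int) \<Rightarrow> 'f set" where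
  "valuation_ring L v = {f \<in> L. f = 0 \<or> 0 \<le> v f}"

type_synonym 'k place = "'k ratfun_closure \<Rightarrow> int"

definition curve_points :: "nat \<Rightarrow> 'k :: alg_closed_field poly \<Rightarrow> 'k place set" where
  "curve_points m F =
     {v. discrete_valuation (range (\<lambda>c. embed_poly [:c:])) (function_field m F) v}"

text \<open>
  A smooth point of the affine curve is identified with the point of the projective model
  whose valuation ring is the local ring of the affine curve at that point.
\<close>

definition point_at :: "nat \<Rightarrow> 'k :: alg_closed_field poly \<Rightarrow> 'k \<times> 'k \<Rightarrow> 'k place" where
  "point_at m F P = (THE v. v \<in> curve_points m F \<and>
     valuation_ring (function_field m F) v = local_ring m F P)"

definition points_at_infinity :: "nat \<Rightarrow> 'k :: alg_closed_field poly \<Rightarrow> 'k place set" where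
  "points_at_infinity m F = {v \<in> curve_points m F. \<forall>P\<in>affine_points m F.
     valuation_ring (function_field m F) v \<noteq> local_ring m F P}"

definition divisor_at_infinity :: "nat \<Rightarrow> 'k :: alg_closed_field poly \<Rightarrow> 'k place \<Rightarrow>\<^sub>0 int" where
  "divisor_at_infinity m F = (\<Sum>v\<in>points_at_infinity m F. frag_of v)"

definition divisor_degree :: "('p \<Rightarrow>\<^sub>0 int) \<Rightarrow> int" where
  "divisor_degree D = (\<Sum>P\<in>Poly_Mapping.keys D. Poly_Mapping.lookup D P)"

definition divisors_deg0 :: "nat \<Rightarrow> 'k :: alg_closed_field poly \<Rightarrow> ('k place \<Rightarrow>\<^sub>0 int) monoid" where
  "divisors_deg0 m F = (free_Abelian_group (curve_points m F))
     \<lparr>carrier := {D \<in> carrier (free_Abelian_group (curve_points m F)). divisor_degree D = 0}\<rparr>"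

definition principal_divisors :: "nat \<Rightarrow> 'k :: alg_closed_field poly \<Rightarrow> ('k place \<Rightarrow>\<^sub>0 int) set" where
  "principal_divisors m F = {D \<in> carrier (free_Abelian_group (curve_points m F)).
     \<exists>f\<in>function_field m F - {0}. \<forall>v\<in>curve_points m F. Poly_Mapping.lookup D v = v f}"

text \<open>
  The group of \<open>k\<close>-rational points of the Jacobian, for \<open>k\<close> algebraically closed: divisors of
  degree zero modulo principal divisors.
\<close>

definition jacobian :: "nat \<Rightarrow> 'k :: alg_closed_field poly \<Rightarrow> ('k place \<Rightarrow>\<^sub>0 int) set monoid" where
  "jacobian m F = divisors_deg0 m F Mod principal_divisors m F"

definition divisor_class ::
  "nat \<Rightarrow> 'k :: alg_closed_field poly \<Rightarrow> ('k place \<Rightarrow>\<^sub>0 int) \<Rightarrow> ('k place \<Rightarrow>\<^sub>0 int) set" where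
  "divisor_class m F D = principal_divisors m F #>\<^bsub>divisors_deg0 m F\<^esub> D"

definition Delta_divisor ::
  "nat \<Rightarrow> 'k :: alg_closed_field poly \<Rightarrow> nat \<Rightarrow> (nat \<Rightarrow> 'k) \<Rightarrow> (nat \<Rightarrow> int) \<Rightarrow> 'k place \<Rightarrow>\<^sub>0 int" where
  "Delta_divisor m F r \<alpha> a =
     (\<Sum>i=1..r. frag_cmul (a i) (frag_of (point_at m F (\<alpha> i, 0)))) -
     frag_cmul ((\<Sum>i=1..r. a i) div int (gcd m r)) (divisor_at_infinity m F)"

definition Delta_classes ::
  "nat \<Rightarrow> 'k :: alg_closed_field poly \<Rightarrow> nat \<Rightarrow> (nat \<Rightarrow> 'k) \<Rightarrow> ('k place \<Rightarrow>\<^sub>0 int) set set" where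
  "Delta_classes m F r \<alpha> =
     {divisor_class m F (Delta_divisor m F r \<alpha> a) | a. int (gcd m r) dvd (\<Sum>i=1..r. a i)}"

end

theory Submission
  imports Defs
begin

text \<open>
  Let \<open>k\<close> be the algebraic closure and \<open>N = (\<Sum> a\<^sub>i) / d\<close>. The divisor
  \<open>D\<^sub>a = \<Sum> a\<^sub>i R\<^sub>i - N \<infinity>\<close> is principal if and only if all \<open>a\<^sub>i\<close> are congruent modulo \<open>m\<close>.
  If \<open>a\<^sub>i = c + m b\<^sub>i\<close>, it is the divisor of \<open>y^c \<Prod> (x - \<alpha>\<^sub>i)^b\<^sub>i\<close>. Conversely, let \<open>f\<close> have divisor
  \<open>D\<^sub>a\<close> and write \<open>f = \<Sum> g\<^sub>j(x) y^j\<close> with \<open>j < m\<close>. The divisor is invariant under \<open>y \<mapsto> \<zeta> y\<close> for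
  \<open>\<zeta>^m = 1\<close>, so every component \<open>g\<^sub>j y^j\<close>, an average of conjugates of \<open>f\<close>, has a divisor bounded
  below by \<open>D\<^sub>a\<close>. For \<open>g\<^sub>j \<noteq> 0\<close> this says \<open>m ord_\<alpha>\<^sub>i(g\<^sub>j) + j \<ge> a\<^sub>i\<close>, \<open>ord_c(g\<^sub>j) \<ge> 0\<close> for the other \<open>c\<close>
  in \<open>k\<close>, and \<open>m deg(g\<^sub>j) + r j \<le> \<Sum> a\<^sub>i\<close>; as the degree is the sum of the orders, all the
  inequalities at the \<open>\<alpha>\<^sub>i\<close> are equalities, and \<open>a\<^sub>i\<close> is congruent to \<open>j\<close>.

  The places are constructed by embedding the function field into Laurent series, and they are
  classified by comparing a valuation with the local ring at its center; the points at infinity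
  become smooth affine points in suitable monomial coordinates.
\<close>

section \<open>Ring homomorphisms and evaluation\<close>

locale comm_ring_1_hom =
  fixes h :: "'a :: comm_ring_1 \<Rightarrow> 'b :: comm_ring_1"
  assumes hom_add: "h (a + b) = h a + h b"
    and hom_mult: "h (a * b) = h a * h b"
    and hom_one: "h 1 = 1"
begin

lemma hom_zero: "h 0 = 0"
  using hom_add[of 0 0] by simp

lemma hom_uminus: "h (- a) = - h a"
  using hom_add[of a "- a"] by (simp add: hom_zero eq_neg_iff_add_eq_0 add.commute)

lemma hom_diff: "h (a - b) = h a - h b"
  using hom_add[of a "- b"] by (simp add: hom_uminus)

lemma hom_power: "h (a ^ n) = h a ^ n"
  by (induction n) (auto simp: hom_one hom_mult)

lemma hom_sum: "h (sum f A) = (\<Sum>a\<in>A. h (f a))"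
  by (induction A rule: infinite_finite_induct) (auto simp: hom_zero hom_add)

lemma hom_prod: "h (prod f A) = (\<Prod>a\<in>A. h (f a))"
  by (induction A rule: infinite_finite_induct) (auto simp: hom_one hom_mult)

end

definition ev :: "('a :: comm_ring_1 \<Rightarrow> 'b :: comm_ring_1) \<Rightarrow> 'b \<Rightarrow> 'a poly \<Rightarrow> 'b" where
  "ev h z q = poly (map_poly h q) z"

context comm_ring_1_hom
begin

lemma ev_pCons: "ev h z (pCons a q) = h a + z * ev h z q"
  by (cases "q = 0 \<and> a = 0") (auto simp: ev_def map_poly_pCons hom_zero)

lemma ev_const: "ev h z [:a:] = h a"
  by (simp add: ev_pCons) (simp add: ev_def)

lemma ev_X: "ev h z [:0, 1:] = z"
  using ev_pCons[of z 0 "[:1:]"] ev_const[of z 1] by (simp add: hom_zero hom_one)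

lemma ev_add: "ev h z (p + q) = ev h z p + ev h z q"
proof (induction p arbitrary: q)
  case (pCons a p)
  then show ?case
    by (cases q) (simp add: ev_pCons hom_add algebra_simps)
qed (simp add: ev_def)

lemma ev_smult: "ev h z (Polynomial.smult a q) = h a * ev h z q"
proof (induction q)
  case (pCons b q)
  then show ?case by (simp add: ev_pCons hom_mult algebra_simps)
qed (simp add: ev_def)

lemma ev_mult: "ev h z (p * q) = ev h z p * ev h z q"
proof (induction p)
  case (pCons a p)
  have "ev h z (pCons 0 (p * q)) = z * ev h z (p * q)"
    by (simp only: ev_pCons hom_zero add_0)
  then show ?case
    using pCons by (simp add: ev_pCons ev_add ev_smult algebra_simps)
qed (simp add: ev_def)

lemma comm_ring_1_hom_ev: "comm_ring_1_hom (ev h z)"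
  by unfold_locales (auto simp: ev_add ev_mult one_pCons ev_const hom_one simp del: one_poly_eq_simps)

lemma ev_eq_sum: "ev h z q = (\<Sum>i\<le>degree q. h (coeff q i) * z ^ i)"
proof -
  have "degree (map_poly h q) \<le> degree q"
    by (intro degree_le) (auto simp: coeff_map_poly hom_zero coeff_eq_0)
  then have "ev h z q = (\<Sum>i\<le>degree q. coeff (map_poly h q) i * z ^ i)"
    unfolding ev_def poly_altdef
    by (intro sum.mono_neutral_left) (auto simp: coeff_eq_0)
  then show ?thesis
    by (simp add: coeff_map_poly hom_zero)
qed

end

lemma ev_monom:
  assumes "comm_ring_1_hom h"
  shows "ev h z (Polynomial.monom a n) = h a * z ^ n"
  using assms by (simp add: ev_def map_poly_monom comm_ring_1_hom.hom_zero poly_monom)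

locale field_hom = comm_ring_1_hom h for h :: "'a :: field \<Rightarrow> 'b :: field"
begin

lemma hom_eq_0_iff: "h a = 0 \<longleftrightarrow> a = 0"
proof
  assume "h a = 0"
  show "a = 0"
  proof (rule ccontr)
    assume "a \<noteq> 0"
    then have "h a * h (inverse a) = 1"
      by (simp add: hom_one flip: hom_mult)
    with \<open>h a = 0\<close> show False by simp
  qed
qed (simp add: hom_zero)

lemma hom_eq_iff: "h a = h b \<longleftrightarrow> a = b"
  using hom_eq_0_iff[of "a - b"] by (simp add: hom_diff)

lemma hom_inverse: "h (inverse a) = inverse (h a)"
proof (cases "a = 0")
  case False
  then have "h a * h (inverse a) = 1"
    by (simp add: hom_one flip: hom_mult)
  then show ?thesis
    by (simp add: inverse_unique)
qed (simp add: hom_zero)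

end

interpretation to_ac: field_hom to_ac
  by unfold_locales auto

definition fract_ext :: "('a :: idom \<Rightarrow> 'b :: field) \<Rightarrow> 'a fract \<Rightarrow> 'b" where
  "fract_ext h f = (SOME z. \<exists>p q. q \<noteq> 0 \<and> f = Fraction_Field.Fract p q \<and> z = h p / h q)"

lemma fract_ext_Fract:
  assumes "comm_ring_1_hom h" and inj: "\<And>p. p \<noteq> 0 \<Longrightarrow> h p \<noteq> 0" and "q \<noteq> 0"
  shows "fract_ext h (Fraction_Field.Fract p q) = h p / h q"
  unfolding fract_ext_def
proof (rule some_equality)
  interpret comm_ring_1_hom h by fact
  fix z
  assume "\<exists>p' q'. q' \<noteq> 0 \<and> Fraction_Field.Fract p q = Fraction_Field.Fract p' q' \<and> z = h p' / h q'"
  then obtain p' q' where *: "q' \<noteq> 0" "Fraction_Field.Fract p q = Fraction_Field.Fract p' q'" "z = h p' / h q'"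
    by blast
  then have "p * q' = p' * q"
    using \<open>q \<noteq> 0\<close> by (simp add: eq_fract)
  then have "h p * h q' = h p' * h q"
    by (metis hom_mult)
  then show "z = h p / h q"
    using *(1,3) inj[of q] inj[of q'] \<open>q \<noteq> 0\<close> by (simp add: frac_eq_eq)
qed (use assms in blast)

lemma field_hom_fract_ext:
  assumes "comm_ring_1_hom h" and inj: "\<And>p. p \<noteq> 0 \<Longrightarrow> h p \<noteq> 0"
  shows "field_hom (fract_ext h)"
proof -
  interpret comm_ring_1_hom h by fact
  note F = fract_ext_Fract[OF assms(1) inj]
  show ?thesis
  proof unfold_locales
    fix f g :: "'a fract"
    obtain a b where f: "f = Fraction_Field.Fract a b" "b \<noteq> 0" by (cases f)
    obtain p q where g: "g = Fraction_Field.Fract p q" "q \<noteq> 0" by (cases g)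
    have "h b \<noteq> 0" "h q \<noteq> 0" using inj f g by auto
    then show "fract_ext h (f + g) = fract_ext h f + fract_ext h g"
      using f g by (simp add: F hom_add hom_mult field_simps)
    show "fract_ext h (f * g) = fract_ext h f * fract_ext h g"
      using f g by (simp add: F hom_mult)
  next
    show "fract_ext h 1 = 1"
      by (simp add: One_fract_def F hom_one)
  qed
qed

lemma poly_bezout:
  fixes p q :: "'a :: field poly"
  shows "\<exists>a b. a * p + b * q dvd p \<and> a * p + b * q dvd q"
proof (cases "p = 0 \<and> q = 0")
  case False
  define I where "I = {a * p + b * q | a b. a * p + b * q \<noteq> 0}"
  have "1 * p + 0 * q \<noteq> 0 \<or> 0 * p + 1 * q \<noteq> 0" using False by auto
  then have "\<exists>f. f \<in> I" unfolding I_def by blast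
  then obtain g where g: "g \<in> I" and min: "\<And>f. f \<in> I \<Longrightarrow> degree g \<le> degree f"
    using ex_has_least_nat[of "\<lambda>f. f \<in> I" _ degree] by blast
  obtain a b where ab: "g = a * p + b * q" "g \<noteq> 0" using g by (auto simp: I_def)
  have dvd: "g dvd u * p + v * q" for u v
  proof (rule ccontr)
    let ?f = "u * p + v * q"
    assume "\<not> g dvd ?f"
    then have nz: "?f mod g \<noteq> 0" by (simp add: dvd_eq_mod_eq_0)
    have "?f mod g = ?f - (?f div g) * g" by (simp add: minus_div_mult_eq_mod)
    also have "\<dots> = (u - (?f div g) * a) * p + (v - (?f div g) * b) * q"
      by (subst (2) ab(1)) (simp only: algebra_simps)
    finally have "?f mod g \<in> I" using nz unfolding I_def by (metis (mono_tags, lifting) mem_Collect_eq)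
    from min[OF this] show False
      using degree_mod_less'[OF ab(2) nz] by simp
  qed
  show ?thesis
    using dvd[of 1 0] dvd[of 0 1] ab(1) by (intro exI[of _ a] exI[of _ b]) simp
qed auto

section \<open>Roots of Laurent series\<close>

lemma power_add_first_order:
  fixes a b :: "'a :: comm_ring_1"
  shows "\<exists>q. (a + b) ^ n = a ^ n + of_nat n * a ^ (n - 1) * b + b ^ 2 * q"
proof (induction n)
  case (Suc n)
  then obtain q where q: "(a + b) ^ n = a ^ n + of_nat n * a ^ (n - 1) * b + b ^ 2 * q" by blast
  have eq: "of_nat n * a ^ (n - 1) * a = of_nat n * a ^ n"
    by (cases n) (auto simp: mult_ac)
  have "(a + b) ^ Suc n = (a + b) * (a ^ n + of_nat n * a ^ (n - 1) * b + b ^ 2 * q)"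
    by (simp add: q)
  also have "\<dots> = a ^ Suc n + a ^ n * b + (of_nat n * a ^ (n - 1) * a) * b
      + b ^ 2 * (of_nat n * a ^ (n - 1) + (a + b) * q)"
    by (simp add: algebra_simps power2_eq_square)
  also have "\<dots> = a ^ Suc n + of_nat (Suc n) * a ^ (Suc n - 1) * b
      + b ^ 2 * (of_nat n * a ^ (n - 1) + (a + b) * q)"
    by (simp only: eq) (simp add: algebra_simps)
  finally show ?case by blast
qed (auto intro: exI[of _ 0])

lemma fps_power_nth_cong:
  fixes f g :: "'a :: comm_ring_1 fps"
  assumes "\<And>i. i \<le> N \<Longrightarrow> fps_nth f i = fps_nth g i" "j \<le> N"
  shows "fps_nth (f ^ n) j = fps_nth (g ^ n) j"
  using assms(2)
proof (induction n arbitrary: j)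
  case (Suc n)
  then show ?case
    using assms(1) by (auto simp: fps_mult_nth intro!: sum.cong arg_cong2[of _ _ _ _ "(*)"])
qed simp

text \<open>Hensel lifting, one coefficient at a time.\<close>

lemma fps_root_exists:
  fixes G :: "'a :: field fps"
  assumes "\<rho> ^ n = fps_nth G 0" "\<rho> \<noteq> 0" "of_nat n \<noteq> (0 :: 'a)"
  shows "\<exists>f. f ^ n = G"
proof -
  define step where "step = (\<lambda>k f. f + fps_const (fps_nth (G - f ^ n) (Suc k) / (of_nat n * \<rho> ^ (n - 1))) * fps_X ^ Suc k)"
  define s where "s = rec_nat (fps_const \<rho>) step"
  have s0: "s 0 = fps_const \<rho>" and sS: "s (Suc k) = step k (s k)" for k
    by (simp_all add: s_def)
  have low: "fps_nth (s (Suc k)) i = fps_nth (s k) i" if "i \<le> k" for i k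
    using that by (cases i) (auto simp: sS step_def)
  have s_stable: "fps_nth (s k) i = fps_nth (s i) i" if "i \<le> k" for i k
    using that by (induction k rule: dec_induct) (auto simp: low)
  have s_0: "fps_nth (s k) 0 = \<rho>" for k
    using s_stable[of 0 k] by (simp add: s0)
  have inv: "fps_nth (s k ^ n) i = fps_nth G i" if "i \<le> k" for i k
    using that
  proof (induction k arbitrary: i)
    case 0
    then show ?case by (simp add: s0 assms(1) fps_const_power)
  next
    case (Suc k)
    show ?case
    proof (cases "i \<le> k")
      case True
      have "fps_nth (s (Suc k) ^ n) i = fps_nth (s k ^ n) i"
        by (rule fps_power_nth_cong[of k]) (auto simp: low True)
      then show ?thesis using Suc.IH[OF True] by simp
    next
      case False
      then have i: "i = Suc k" using Suc.prems by simp
      define c where "c = fps_nth (G - s k ^ n) (Suc k) / (of_nat n * \<rho> ^ (n - 1))"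
      define b where "b = fps_const c * fps_X ^ Suc k"
      obtain q where q: "(s k + b) ^ n = s k ^ n + of_nat n * s k ^ (n - 1) * b + b ^ 2 * q"
        using power_add_first_order by blast
      have bq: "b ^ 2 * q = fps_X ^ (2 * Suc k) * (fps_const (c ^ 2) * q)"
        by (simp add: b_def power_mult_distrib mult_ac fps_const_power flip: power_mult power_add)
      have 1: "fps_nth (b ^ 2 * q) (Suc k) = 0"
        unfolding bq fps_X_power_mult_nth by simp
      have nb: "of_nat n * s k ^ (n - 1) * b = fps_X ^ Suc k * (fps_const (c * of_nat n) * s k ^ (n - 1))"
        by (simp add: b_def mult_ac fps_of_nat[symmetric] flip: fps_const_mult)
      have 2: "fps_nth (of_nat n * s k ^ (n - 1) * b) (Suc k) = c * of_nat n * \<rho> ^ (n - 1)"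
        unfolding nb fps_X_power_mult_nth by (simp add: fps_power_zeroth s_0)
      have "s (Suc k) = s k + b" by (simp add: sS step_def b_def c_def)
      then have "fps_nth (s (Suc k) ^ n) (Suc k) = fps_nth (s k ^ n) (Suc k) + c * of_nat n * \<rho> ^ (n - 1)"
        using q 1 2 by simp
      also have "c * of_nat n * \<rho> ^ (n - 1) = fps_nth (G - s k ^ n) (Suc k)"
        using assms by (simp add: c_def)
      finally show ?thesis by (simp add: i)
    qed
  qed
  define f where "f = Abs_fps (\<lambda>i. fps_nth (s i) i)"
  have "f ^ n = G"
  proof (rule fps_ext)
    fix i
    have "fps_nth f j = fps_nth (s i) j" if "j \<le> i" for j
      using s_stable[OF that] by (simp add: f_def)
    then have "fps_nth (f ^ n) i = fps_nth (s i ^ n) i"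
      by (intro fps_power_nth_cong[of i]) auto
    then show "fps_nth (f ^ n) i = fps_nth G i" by (simp add: inv)
  qed
  then show ?thesis by blast
qed

lemma fls_root_exists:
  fixes W :: "'a :: alg_closed_field fls"
  assumes "W \<noteq> 0" "int n dvd fls_subdegree W" "of_nat n \<noteq> (0 :: 'a)"
  shows "\<exists>Y. Y ^ n = W"
proof -
  have n: "n > 0" using assms(3) by (cases n) auto
  obtain s where s: "fls_subdegree W = int n * s" using assms(2) by blast
  define B where "B = W * fls_X powi (- (int n * s))"
  have B: "B \<noteq> 0" "fls_subdegree B = 0"
    using assms(1) by (auto simp: B_def s simp del: fls_X_power_int)
  define G where "G = fls_regpart B"
  have G: "fps_to_fls G = B" using B by (simp add: G_def)
  have "fps_nth G 0 \<noteq> 0"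
    using B nth_fls_subdegree_nonzero[of B] by (simp add: G_def)
  moreover obtain \<rho> where \<rho>: "\<rho> ^ n = fps_nth G 0" using nth_root_exists[OF n] by blast
  ultimately have "\<rho> \<noteq> 0" using n by (auto simp: zero_power)
  then obtain f where f: "f ^ n = G"
    using fps_root_exists[OF \<rho> _ assms(3)] by blast
  have "(fps_to_fls f * fls_X powi s) ^ n = B * fls_X powi (int n * s)"
    by (simp add: power_mult_distrib f G power_int_mult mult.commute flip: fps_to_fls_power power_int_power')
  also have "\<dots> = W"
    by (simp add: B_def power_int_minus)
  finally show ?thesis by blast
qed

section \<open>Discrete valuations\<close>

locale subfield_set =
  fixes L :: "'f :: field set"
  assumes L_one: "1 \<in> L"
    and L_add: "a \<in> L \<Longrightarrow> b \<in> L \<Longrightarrow> a + b \<in> L"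
    and L_mult: "a \<in> L \<Longrightarrow> b \<in> L \<Longrightarrow> a * b \<in> L"
    and L_uminus: "a \<in> L \<Longrightarrow> - a \<in> L"
    and L_inverse: "a \<in> L \<Longrightarrow> inverse a \<in> L"
begin

lemma L_zero: "0 \<in> L"
  using L_add[OF L_one L_uminus[OF L_one]] by simp

lemma L_diff: "a \<in> L \<Longrightarrow> b \<in> L \<Longrightarrow> a - b \<in> L"
  using L_add[of a "- b"] L_uminus[of b] by simp

lemma L_divide: "a \<in> L \<Longrightarrow> b \<in> L \<Longrightarrow> a / b \<in> L"
  by (simp add: divide_inverse L_mult L_inverse)

lemma L_power: "a \<in> L \<Longrightarrow> a ^ n \<in> L"
  by (induction n) (auto simp: L_one L_mult)

lemma L_power_int: "a \<in> L \<Longrightarrow> a powi n \<in> L"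
  by (auto simp: power_int_def L_power L_inverse)

lemma L_sum: "(\<And>i. i \<in> A \<Longrightarrow> f i \<in> L) \<Longrightarrow> sum f A \<in> L"
  by (induction A rule: infinite_finite_induct) (auto simp: L_zero L_add)

lemma L_prod: "(\<And>i. i \<in> A \<Longrightarrow> f i \<in> L) \<Longrightarrow> prod f A \<in> L"
  by (induction A rule: infinite_finite_induct) (auto simp: L_one L_mult)

lemmas L_closed = L_zero L_one L_add L_mult L_uminus L_inverse L_diff L_divide L_power L_power_int

end

locale dval = subfield_set L for L :: "'f :: field set" +
  fixes k :: "'f set" and v :: "'f \<Rightarrow> int"
  assumes discrete_valuation: "discrete_valuation k L v"
begin

lemma v_outside: "f \<notin> L - {0} \<Longrightarrow> v f = 0"
  using discrete_valuation unfolding discrete_valuation_def by blast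

lemma v_zero: "v 0 = 0"
  by (rule v_outside) simp

lemma v_mult: "f \<in> L \<Longrightarrow> g \<in> L \<Longrightarrow> f \<noteq> 0 \<Longrightarrow> g \<noteq> 0 \<Longrightarrow> v (f * g) = v f + v g"
  using discrete_valuation unfolding discrete_valuation_def by blast

lemma v_add: "f \<in> L \<Longrightarrow> g \<in> L \<Longrightarrow> f \<noteq> 0 \<Longrightarrow> g \<noteq> 0 \<Longrightarrow> f + g \<noteq> 0 \<Longrightarrow> min (v f) (v g) \<le> v (f + g)"
  using discrete_valuation unfolding discrete_valuation_def by blast

lemma v_const: "c \<in> k \<Longrightarrow> v c = 0"
  using discrete_valuation v_zero unfolding discrete_valuation_def by (cases "c = 0") auto

lemma v_surj: "\<exists>f\<in>L - {0}. v f = n"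
proof -
  have "v ` (L - {0}) = UNIV"
    using discrete_valuation unfolding discrete_valuation_def by blast
  then have "n \<in> v ` (L - {0})" by simp
  then show ?thesis by blast
qed

lemma v_one: "v 1 = 0"
  using v_mult[of 1 1] L_one by simp

lemma v_uminus: "v (- f) = v f"
proof (cases "f \<in> L - {0}")
  case True
  have "v (- 1) = 0"
    using v_mult[of "- 1" "- 1"] v_one L_one L_uminus by simp
  then show ?thesis
    using v_mult[of "- 1" f] True L_one L_uminus by simp
next
  case False
  then have "- f \<notin> L - {0}" using L_uminus[of "- f"] by auto
  with False show ?thesis by (metis v_outside)
qed

lemma v_inverse: "f \<in> L \<Longrightarrow> v (inverse f) = - v f"
  using v_mult[of f "inverse f"] by (cases "f = 0") (auto simp: v_one v_zero L_inverse)

lemma v_divide: "f \<in> L \<Longrightarrow> g \<in> L \<Longrightarrow> f \<noteq> 0 \<Longrightarrow> g \<noteq> 0 \<Longrightarrow> v (f / g) = v f - v g"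
  by (simp add: divide_inverse v_mult v_inverse L_inverse)

lemma v_power: "f \<in> L \<Longrightarrow> v (f ^ n) = int n * v f"
proof (cases "f = 0")
  case True
  then show ?thesis by (cases n) (auto simp: v_zero v_one)
next
  case False
  assume "f \<in> L"
  then show ?thesis
    by (induction n) (auto simp: v_one v_mult False L_power algebra_simps)
qed

lemma v_power_int: "f \<in> L \<Longrightarrow> v (f powi n) = n * v f"
  by (auto simp: power_int_def v_power v_inverse L_inverse)

lemma v_prod:
  assumes "\<And>i. i \<in> A \<Longrightarrow> f i \<in> L - {0}"
  shows "v (prod f A) = (\<Sum>i\<in>A. v (f i))"
  using assms
proof (induction A rule: infinite_finite_induct)
  case (insert a A)
  then have "prod f A \<in> L" "prod f A \<noteq> 0" by (auto intro!: L_prod)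
  with insert show ?case by (simp add: v_mult)
qed (auto simp: v_one)

lemma v_add_less:
  assumes "f \<in> L" "g \<in> L" "f \<noteq> 0" "g = 0 \<or> v f < v g"
  shows "f + g \<noteq> 0 \<and> v (f + g) = v f"
proof (cases "g = 0")
  case False
  have nz: "f + g \<noteq> 0"
    using assms False v_uminus[of g] by (auto simp: add_eq_0_iff2)
  moreover have "v f \<le> v (f + g)" using v_add[of f g] nz assms False by auto
  moreover have "min (v (f + g)) (v (- g)) \<le> v (f + g + - g)"
    using v_add[of "f + g" "- g"] nz assms False by (simp add: L_closed)
  ultimately show ?thesis using v_uminus[of g] assms False by auto
qed (use assms in auto)

definition vge :: "int \<Rightarrow> 'f \<Rightarrow> bool" where
  "vge n f \<longleftrightarrow> f \<in> L \<and> (f = 0 \<or> n \<le> v f)"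

lemma vge_zero: "vge n 0"
  by (simp add: vge_def L_zero)

lemma vge_add:
  assumes "vge n f" "vge n g"
  shows "vge n (f + g)"
proof (cases "f = 0 \<or> g = 0 \<or> f + g = 0")
  case False
  then have "min (v f) (v g) \<le> v (f + g)"
    using assms by (intro v_add) (auto simp: vge_def)
  then show ?thesis using assms False by (auto simp: vge_def L_add)
qed (use assms in \<open>auto simp: vge_def L_zero\<close>)

lemma vge_mult: "vge n f \<Longrightarrow> vge l g \<Longrightarrow> vge (n + l) (f * g)"
  using v_mult[of f g] unfolding vge_def by (auto simp: L_mult)

lemma vge_mult0: "vge 0 f \<Longrightarrow> vge 0 g \<Longrightarrow> vge 0 (f * g)"
  using vge_mult[of 0 f 0 g] by simp

lemma vge_power: "vge 0 f \<Longrightarrow> vge 0 (f ^ n)"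
proof (induction n)
  case 0
  then show ?case by (simp add: vge_def L_one v_one)
next
  case (Suc n)
  then show ?case using vge_mult0 by simp
qed

lemma vge_sum: "(\<And>i. i \<in> A \<Longrightarrow> vge n (f i)) \<Longrightarrow> vge n (sum f A)"
  by (induction A rule: infinite_finite_induct) (auto simp: vge_zero vge_add)

lemma vge_mono: "vge n f \<Longrightarrow> l \<le> n \<Longrightarrow> vge l f"
  by (auto simp: vge_def)

lemma vge_0_iff: "vge 0 f \<longleftrightarrow> f \<in> valuation_ring L v"
  by (auto simp: vge_def valuation_ring_def)

text \<open>
  A ring \<open>R\<close> dominated by \<open>v\<close> whose nonunits are all divisible by one \<open>p\<close> with \<open>v p > 0\<close> is the
  whole valuation ring: dividing by \<open>p\<close> lowers \<open>v\<close>, so every nonzero element is a power of \<open>p\<close>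
  times a unit.
\<close>

lemma dominated_ring_eq:
  assumes sub: "\<And>h. h \<in> R \<Longrightarrow> vge 0 h"
    and R: "1 \<in> R" "\<And>f g. f \<in> R \<Longrightarrow> g \<in> R \<Longrightarrow> f * g \<in> R"
    and frac: "\<And>f. f \<in> L \<Longrightarrow> \<exists>a\<in>R. \<exists>b\<in>R. b \<noteq> 0 \<and> f = a / b"
    and p: "p \<in> R" "p \<noteq> 0" "v p > 0"
    and div: "\<And>h. h \<in> R \<Longrightarrow> h \<noteq> 0 \<Longrightarrow> inverse h \<in> R \<or> h / p \<in> R"
  shows "v p = 1 \<and> valuation_ring L v = R"
proof -
  have sub': "h \<in> L" "h \<noteq> 0 \<Longrightarrow> 0 \<le> v h" if "h \<in> R" for h
    using sub[OF that] by (auto simp: vge_def)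
  have Rpow: "f ^ n \<in> R" if "f \<in> R" for f n
    using that by (induction n) (auto simp: R)
  have dec: "\<exists>n e. h = p ^ n * e \<and> e \<in> R \<and> inverse e \<in> R" if "h \<in> R" "h \<noteq> 0" for h
    using that
  proof (induction "nat (v h)" arbitrary: h rule: less_induct)
    case less
    show ?case
    proof (cases "inverse h \<in> R")
      case True
      then show ?thesis using less.prems by (intro exI[of _ 0] exI[of _ h]) auto
    next
      case False
      then have hp: "h / p \<in> R" "h / p \<noteq> 0" using div less.prems p by auto
      have "v (h / p) = v h - v p" using sub' less.prems p by (intro v_divide) auto
      then have "nat (v (h / p)) < nat (v h)" using p sub'(2)[OF hp] by simp
      then obtain n e where "h / p = p ^ n * e" "e \<in> R" "inverse e \<in> R"
        using less.hyps hp by blast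
      then show ?thesis
        using p by (intro exI[of _ "Suc n"] exI[of _ e]) (simp add: field_simps)
    qed
  qed
  have dec': "\<exists>n e. f = p powi n * e \<and> e \<in> R \<and> inverse e \<in> R \<and> v f = n * v p"
    if f: "f \<in> L" "f \<noteq> 0" for f
  proof -
    obtain a b where ab: "a \<in> R" "b \<in> R" "b \<noteq> 0" "f = a / b" using frac f by blast
    then have "a \<noteq> 0" using f by auto
    obtain i e where i: "a = p ^ i * e" "e \<in> R" "inverse e \<in> R" using dec[of a] ab \<open>a \<noteq> 0\<close> by blast
    obtain j e' where j: "b = p ^ j * e'" "e' \<in> R" "inverse e' \<in> R" using dec[of b] ab by blast
    have nz: "e \<noteq> 0" "e' \<noteq> 0" using i j ab \<open>a \<noteq> 0\<close> by auto
    define u where "u = e * inverse e'"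
    have u: "u \<in> R" "inverse u \<in> R" "u \<noteq> 0"
      using i j nz R(2) by (auto simp: u_def inverse_mult_distrib mult.commute)
    have fu: "f = p powi (int i - int j) * u"
      using ab i j nz p by (simp add: u_def power_int_diff divide_inverse inverse_mult_distrib mult_ac)
    moreover have "v u = 0"
      using sub'(2)[OF u(1)] sub'(2)[OF u(2)] u v_inverse[of u] sub'(1)[OF u(1)] by auto
    ultimately have "v f = (int i - int j) * v p"
      using u p sub'(1) by (simp add: v_mult v_power_int L_power_int)
    then show ?thesis using fu u by blast
  qed
  obtain f where f: "f \<in> L" "f \<noteq> 0" "v f = 1" using v_surj by blast
  then obtain n where "1 = n * v p" using dec' by metis
  then have "v p dvd 1" by (metis dvd_triv_right)
  then have vp: "v p = 1" using p(3) by simp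
  have "f \<in> R" if "f \<in> valuation_ring L v" for f
  proof (cases "f = 0")
    case True
    obtain a b where "a \<in> R" "b \<in> R" "b \<noteq> 0" "0 = a / b" using frac[OF L_zero] by blast
    then show ?thesis using True by auto
  next
    case False
    have "f \<in> L" using that by (simp add: valuation_ring_def)
    then obtain n e where n: "f = p powi n * e" "e \<in> R" "v f = n * v p"
      using dec' False by blast
    then have "n \<ge> 0" using that False vp by (auto simp: valuation_ring_def)
    then show ?thesis using n R p Rpow by (auto simp: power_int_def)
  qed
  then show ?thesis using vp sub by (auto simp: vge_0_iff)
qed

end

lemma discrete_valuation_eqI:
  assumes "subfield_set L" "discrete_valuation k L v" "discrete_valuation k L w"
    and "valuation_ring L v = valuation_ring L w"
  shows "v = w"
proof
  interpret v: dval L k v using assms by (simp add: dval_def dval_axioms_def)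
  interpret w: dval L k w using assms by (simp add: dval_def dval_axioms_def)
  have ge: "0 \<le> v f \<longleftrightarrow> 0 \<le> w f" if "f \<in> L" "f \<noteq> 0" for f
    using assms(4) that unfolding valuation_ring_def by blast
  obtain t where t: "t \<in> L" "t \<noteq> 0" "v t = 1" using v.v_surj by blast
  fix f
  show "v f = w f"
  proof (cases "f \<in> L - {0}")
    case True
    have eq: "w g = v g * w t" if g: "g \<in> L" "g \<noteq> 0" for g
    proof -
      define u where "u = g * t powi (- v g)"
      have u: "u \<in> L" "u \<noteq> 0" using g t by (auto simp: u_def v.L_closed)
      have "v u = 0" using g t by (simp add: u_def v.v_mult v.v_power_int v.L_closed)
      then have "0 \<le> w u" "0 \<le> w (inverse u)"
        using ge[of u] ge[of "inverse u"] u by (auto simp: v.v_inverse v.L_closed)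
      then have "w u = 0" using u by (simp add: w.v_inverse)
      then show ?thesis using g t by (simp add: u_def w.v_mult w.v_power_int v.L_closed)
    qed
    obtain g where g: "g \<in> L" "g \<noteq> 0" "w g = 1" using w.v_surj by blast
    have "1 = v g * w t" using eq[of g] g by simp
    moreover have "0 \<le> w t" using ge[of t] t by simp
    moreover have "w t dvd 1" using \<open>1 = v g * w t\<close> by (metis dvd_triv_right)
    ultimately have "w t = 1" by simp
    then show ?thesis using eq[of f] True by simp
  next
    case False
    then show ?thesis by (metis v.v_outside w.v_outside)
  qed
qed

section \<open>The function field\<close>

locale superelliptic =
  fixes m r :: nat and \<alpha> :: "nat \<Rightarrow> 'k :: alg_closed_field" and F :: "'k poly"
  assumes m_ge_2: "m \<ge> 2" and m_nonzero: "of_nat m \<noteq> (0 :: 'k)" and r_ge_2: "r \<ge> 2"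
    and inj_\<alpha>: "inj_on \<alpha> {1..r}" and F_eq: "F = (\<Prod>i=1..r. [:- \<alpha> i, 1:])"

lemma comm_ring_1_hom_embed_poly: "comm_ring_1_hom embed_poly"
  by unfold_locales (auto simp: embed_poly_def One_fract_def simp flip: to_ac_add to_ac_mult to_ac_1)

interpretation embed: comm_ring_1_hom embed_poly
  by (rule comm_ring_1_hom_embed_poly)

lemma embed_poly_eq_0_iff: "embed_poly p = 0 \<longleftrightarrow> p = 0"
  by (simp add: embed_poly_def to_ac.hom_eq_0_iff Zero_fract_def eq_fract)

lemma to_ac_Fract: "q \<noteq> 0 \<Longrightarrow> to_ac (Fraction_Field.Fract p q) = embed_poly p / embed_poly q"
proof -
  assume "q \<noteq> 0"
  then have "Fraction_Field.Fract p q = Fraction_Field.Fract p 1 / Fraction_Field.Fract q 1"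
    by simp
  then show ?thesis unfolding embed_poly_def by (metis to_ac_divide)
qed

abbreviation coord_x :: "'k :: alg_closed_field ratfun_closure" where
  "coord_x \<equiv> embed_poly [:0, 1:]"

abbreviation scalar :: "'k :: alg_closed_field \<Rightarrow> 'k ratfun_closure" where
  "scalar a \<equiv> embed_poly [:a:]"

interpretation scalar: field_hom "scalar :: 'k :: alg_closed_field \<Rightarrow> _"
  by unfold_locales (auto simp: embed.hom_one mult.commute simp flip: embed.hom_add embed.hom_mult one_pCons)

lemma embed_poly_eq_ev: "embed_poly p = ev scalar coord_x p"
proof (induction p)
  case (pCons a p)
  have "embed_poly (pCons a p) = embed_poly ([:a:] + [:0, 1:] * p)" by simp
  also have "\<dots> = scalar a + coord_x * embed_poly p" by (simp only: embed.hom_add embed.hom_mult)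
  finally show ?case using pCons by (simp add: scalar.ev_pCons)
qed (simp add: ev_def embed.hom_zero)

lemma x_minus_scalar: "coord_x - scalar a = embed_poly [:- a, 1:]"
  by (simp flip: embed.hom_diff)

lemma order_power_eq: "p \<noteq> 0 \<Longrightarrow> order a (p ^ n) = n * order a (p :: 'a :: idom poly)"
  by (induction n) (auto simp: order_mult)

context superelliptic
begin

abbreviation y where "y \<equiv> coord_y m F"
abbreviation L where "L \<equiv> function_field m F"
abbreviation places where "places \<equiv> curve_points m F"

definition F0 :: "'k poly fract" where "F0 = Fraction_Field.Fract F 1"
definition P0 :: "'k poly fract poly" where "P0 = Polynomial.monom 1 m - [:F0:]"

lemma m_pos: "m > 0" using m_ge_2 by simp

lemma y_power: "y ^ m = embed_poly F"
  unfolding coord_y_def by (rule someI_ex) (rule nth_root_exists[OF m_pos])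

lemma F_nonzero: "F \<noteq> 0"
  by (simp add: F_eq)

lemma y_nonzero: "y \<noteq> 0"
  using y_power F_nonzero m_pos by (auto simp: embed_poly_eq_0_iff zero_power)

lemma poly_F: "poly F a = (\<Prod>i=1..r. a - \<alpha> i)"
  by (simp add: F_eq poly_prod)

lemma poly_F_eq_0_iff: "poly F a = 0 \<longleftrightarrow> a \<in> \<alpha> ` {1..r}"
  by (auto simp: poly_F)

lemma F_split:
  assumes "i \<in> {1..r}"
  obtains G where "F = [:- \<alpha> i, 1:] * G" "poly G (\<alpha> i) \<noteq> 0"
proof
  let ?G = "\<Prod>j\<in>{1..r} - {i}. [:- \<alpha> j, 1:]"
  show "F = [:- \<alpha> i, 1:] * ?G" unfolding F_eq by (rule prod.remove) (use assms in auto)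
  show "poly ?G (\<alpha> i) \<noteq> 0"
    using inj_onD[OF inj_\<alpha>, of i] assms by (fastforce simp: poly_prod)
qed

lemma order_F: "i \<in> {1..r} \<Longrightarrow> order (\<alpha> i) F = 1"
proof -
  assume "i \<in> {1..r}"
  then obtain G where G: "F = [:- \<alpha> i, 1:] * G" "poly G (\<alpha> i) \<noteq> 0" by (rule F_split)
  then have "order (\<alpha> i) G = 0" "G \<noteq> 0" by (auto simp: order_root)
  moreover have "order (\<alpha> i) [:- \<alpha> i, 1:] = 1" using order_power_n_n[of "\<alpha> i" 1] by simp
  moreover have "[:- \<alpha> i, 1:] * G \<noteq> 0" using F_nonzero G(1) by metis
  ultimately show ?thesis unfolding G(1) using order_mult by (metis add_0_right)
qed

lemma dvd_of_power_eq:
  assumes "g ^ m = ((- 1) ^ m * F0) ^ j"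
  shows "m dvd j"
proof -
  obtain p q where g: "g = Fraction_Field.Fract p q" "q \<noteq> 0" by (cases g)
  have pow: "Fraction_Field.Fract a b ^ n = Fraction_Field.Fract (a ^ n) (b ^ n)" for a b :: "'k poly" and n
    by (induction n) (auto simp: One_fract_def)
  have neg: "(- 1) ^ n = Fraction_Field.Fract ((- 1) ^ n) (1 :: 'k poly)" for n
    by (induction n) (auto simp: One_fract_def)
  have "Fraction_Field.Fract (p ^ m) (q ^ m) = Fraction_Field.Fract (((- 1) ^ m * F) ^ j) 1"
    using assms by (simp add: g F0_def pow neg)
  then have eq: "p ^ m = (((- 1) ^ m) ^ j * F ^ j) * q ^ m"
    using g by (simp add: eq_fract power_mult_distrib)
  have "((- 1) ^ m) ^ j \<in> {1, - 1 :: 'k poly}"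
    by (cases "even m"; cases "even j") auto
  then have *: "order (\<alpha> 1) (((- 1) ^ m) ^ j * F ^ j) = j" "((- 1) ^ m) ^ j * F ^ j \<noteq> 0"
    using order_F[of 1] r_ge_2 F_nonzero by (auto simp: order_power_eq order_uminus)
  then have "p \<noteq> 0" using eq g m_pos by (auto simp: zero_power)
  then have "m * order (\<alpha> 1) p = order (\<alpha> 1) (p ^ m)" by (simp add: order_power_eq)
  also have "\<dots> = j + m * order (\<alpha> 1) q"
    unfolding eq using * g by (subst order_mult) (auto simp: order_power_eq)
  finally have "j = m * (order (\<alpha> 1) p - order (\<alpha> 1) q)" by (simp add: diff_mult_distrib2)
  then show ?thesis by simp
qed

lemma degree_P0: "degree P0 = m"
  using degree_add_eq_left[of "- [:F0:]" "Polynomial.monom 1 m"] m_pos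
  by (simp add: P0_def degree_monom_eq del: minus_pCons)

lemma P0_nonzero: "P0 \<noteq> 0"
  using degree_P0 m_pos by auto

lemma ev_P0:
  assumes "comm_ring_1_hom h"
  shows "ev h z P0 = z ^ m - h F0"
proof -
  interpret comm_ring_1_hom h by fact
  interpret e: comm_ring_1_hom "ev h z" by (rule comm_ring_1_hom_ev)
  show ?thesis
    by (simp add: P0_def e.hom_diff ev_const ev_monom[OF assms] hom_one)
qed

lemma ev_P0_y: "ev to_ac y P0 = 0"
  using y_power by (simp add: ev_P0[OF to_ac.comm_ring_1_hom_axioms] F0_def embed_poly_def)

text \<open>
  The constant coefficient of a monic factor of degree \<open>j\<close> is up to sign a product of \<open>j\<close> roots,
  so its \<open>m\<close>-th power is \<open>F^j\<close> up to sign; the order at \<open>\<alpha> 1\<close> then shows that \<open>m\<close> divides \<open>j\<close>.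
\<close>

lemma P0_dvd_factor:
  assumes g: "g dvd P0" "degree g > 0"
  shows "P0 dvd g"
proof -
  let ?G = "map_poly to_ac g"
  have lc: "lead_coeff g \<noteq> 0" and "g \<noteq> 0" using g by auto
  have dG: "degree ?G = degree g" "lead_coeff ?G = to_ac (lead_coeff g)"
    using lc by (auto simp: degree_map_poly coeff_map_poly to_ac.hom_eq_0_iff)
  then have "?G \<noteq> 0" using g by auto
  then obtain A where A: "size A = degree ?G" "?G = Polynomial.smult (lead_coeff ?G) (\<Prod>z\<in>#A. [:- z, 1:])"
    using alg_closed_imp_factorization by blast
  have polyG: "poly ?G z = to_ac (lead_coeff g) * (\<Prod>w\<in>#A. z - w)" for z
    by (subst A(2)) (simp add: dG coeff_map_poly poly_prod_mset)
  have root: "z ^ m = embed_poly F" if "z \<in># A" for z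
  proof -
    have "0 \<in># image_mset (\<lambda>w. z - w) A" using that by force
    then have "(\<Prod>w\<in>#A. z - w) = 0" by simp
    then have "ev to_ac z g = 0" by (simp only: ev_def polyG mult_zero_right)
    then have "ev to_ac z P0 = 0" using g(1) by (auto simp: to_ac.ev_mult elim!: dvdE)
    then show ?thesis
      by (simp add: ev_P0[OF to_ac.comm_ring_1_hom_axioms] F0_def embed_poly_def)
  qed
  have "(\<Prod>w\<in>#B. 0 - w) ^ m = ((- 1) ^ m * embed_poly F) ^ size B" if "B \<subseteq># A" for B
    using that
  proof (induction B)
    case (add b B)
    then have "b \<in># A" "B \<subseteq># A"
      using mset_subset_eq_insertD[OF add.prems] by (auto simp: subset_mset.less_imp_le)
    have "(- b) ^ m = (- 1) ^ m * b ^ m" using power_mult_distrib[of "- 1" b m] by simp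
    then show ?case
      using add.IH[OF \<open>B \<subseteq># A\<close>] root[OF \<open>b \<in># A\<close>]
      by (simp add: power_mult_distrib mult_ac del: mult_minus_left mult_minus_right)
  qed simp
  from this[of A] have "(to_ac (coeff g 0 / lead_coeff g)) ^ m = ((- 1) ^ m * embed_poly F) ^ degree g"
    using polyG[of 0] lc A(1) dG by (simp add: poly_0_coeff_0 coeff_map_poly to_ac.hom_eq_0_iff)
  also have "\<dots> = to_ac (((- 1) ^ m * F0) ^ degree g)"
    by (simp add: F0_def embed_poly_def)
  finally have "(coeff g 0 / lead_coeff g) ^ m = ((- 1) ^ m * F0) ^ degree g"
    by (simp only: to_ac.hom_eq_iff flip: to_ac_power)
  then have "m dvd degree g" by (rule dvd_of_power_eq)
  moreover have "degree g \<le> m"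
    using dvd_imp_degree_le[OF g(1) P0_nonzero] degree_P0 by simp
  ultimately have "degree g = m" using g(2) by (auto dest: dvd_imp_le)
  obtain h where h: "P0 = g * h" using g(1) by blast
  then have "h \<noteq> 0" using P0_nonzero by auto
  then have "degree h = 0"
    using degree_mult_eq[OF \<open>g \<noteq> 0\<close> \<open>h \<noteq> 0\<close>] degree_P0 h \<open>degree g = m\<close> by simp
  then obtain c where "h = [:c:]" by (auto elim: degree_eq_zeroE)
  then have "g = Polynomial.smult (inverse c) P0" using h \<open>h \<noteq> 0\<close> by simp
  then show ?thesis by (metis dvd_refl dvd_smult)
qed

lemma ev_y_bezout:
  "(P0 dvd q \<and> ev to_ac y q = 0) \<or> (\<exists>a. ev to_ac y q * ev to_ac y a = 1)"
proof -
  obtain a b where ab: "a * q + b * P0 dvd q" "a * q + b * P0 dvd P0"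
    using poly_bezout by blast
  let ?g = "a * q + b * P0"
  show ?thesis
  proof (cases "degree ?g > 0")
    case True
    then have "P0 dvd ?g" by (rule P0_dvd_factor[OF ab(2)])
    then have "P0 dvd q" using ab(1) by (rule dvd_trans)
    then show ?thesis using ev_P0_y by (auto simp: to_ac.ev_mult elim!: dvdE)
  next
    case False
    then obtain c where c: "?g = [:c:]" by (auto elim: degree_eq_zeroE)
    then have "c \<noteq> 0" using ab(2) P0_nonzero by auto
    have "to_ac c = ev to_ac y ?g" by (simp only: c to_ac.ev_const)
    also have "\<dots> = ev to_ac y a * ev to_ac y q"
      by (simp add: to_ac.ev_add to_ac.ev_mult ev_P0_y)
    finally have ca: "ev to_ac y a * ev to_ac y q = to_ac c" ..
    have "ev to_ac y q * ev to_ac y (Polynomial.smult (inverse c) a) = to_ac (inverse c) * (ev to_ac y a * ev to_ac y q)"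
      by (simp add: to_ac.ev_smult)
    also have "\<dots> = to_ac (inverse c * c)" by (simp only: ca to_ac_mult)
    also have "\<dots> = 1" unfolding left_inverse[OF \<open>c \<noteq> 0\<close>] by simp
    finally have "ev to_ac y q * ev to_ac y (Polynomial.smult (inverse c) a) = 1" .
    then show ?thesis by blast
  qed
qed

lemma P0_dvd: "ev to_ac y q = 0 \<Longrightarrow> P0 dvd q"
  using ev_y_bezout[of q] by auto

lemma regular_fun_eq_ev: "regular_fun m F u = ev embed_poly y u"
  by (simp add: regular_fun_def ev_def)

lemma comm_ring_1_hom_regular_fun: "comm_ring_1_hom (regular_fun m F)"
  using embed.comm_ring_1_hom_ev[of y] by (simp add: comm_ring_1_hom_def regular_fun_eq_ev)

sublocale rf: comm_ring_1_hom "regular_fun m F"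
  by (rule comm_ring_1_hom_regular_fun)

lemma regular_fun_eq_to_ac: "regular_fun m F u = ev to_ac y (map_poly (\<lambda>p. Fraction_Field.Fract p 1) u)"
  by (simp add: regular_fun_def ev_def map_poly_map_poly embed_poly_def[abs_def] o_def Zero_fract_def)

lemma L_I: "regular_fun m F v \<noteq> 0 \<Longrightarrow> regular_fun m F u / regular_fun m F v \<in> L"
  by (auto simp: function_field_def)

lemma subfield_L: "subfield_set L"
proof
  show "1 \<in> L" using L_I[of 1 1] by (simp add: rf.hom_one)
  fix a b assume "a \<in> L"
  then obtain u v where a: "a = regular_fun m F u / regular_fun m F v" "regular_fun m F v \<noteq> 0"
    by (auto simp: function_field_def)
  show "- a \<in> L" using L_I[of v "- u"] a by (simp add: rf.hom_uminus)
  show "inverse a \<in> L"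
    using L_I[of u v] L_I[of v 0] a by (cases "regular_fun m F u = 0") (auto simp: rf.hom_zero)
  assume "b \<in> L"
  then obtain u' v' where b: "b = regular_fun m F u' / regular_fun m F v'" "regular_fun m F v' \<noteq> 0"
    by (auto simp: function_field_def)
  show "a + b \<in> L" using L_I[of "v * v'" "u * v' + u' * v"] a b
    by (simp add: rf.hom_mult rf.hom_add add_frac_eq)
  show "a * b \<in> L" using L_I[of "v * v'" "u * u'"] a b by (simp add: rf.hom_mult)
qed

sublocale L: subfield_set L
  by (rule subfield_L)

lemma regular_fun_in_L: "regular_fun m F u \<in> L"
  using L_I[of 1 u] by (simp add: rf.hom_one)

lemma embed_in_L: "embed_poly p \<in> L"
  using regular_fun_in_L[of "[:p:]"] by (simp add: regular_fun_eq_ev embed.ev_const)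

lemma y_in_L: "y \<in> L"
  using regular_fun_in_L[of "[:0, 1:]"] by (simp add: regular_fun_eq_ev embed.ev_X)

lemma to_ac_in_L: "to_ac f \<in> L"
  by (cases f) (auto simp: to_ac_Fract L.L_divide embed_in_L)

lemma ev_to_ac_in_L: "ev to_ac y q \<in> L"
  by (simp add: to_ac.ev_eq_sum L.L_closed L.L_sum to_ac_in_L y_in_L)

lemma L_eq: "L = range (ev to_ac y)"
proof
  show "range (ev to_ac y) \<subseteq> L" using ev_to_ac_in_L by auto
  show "L \<subseteq> range (ev to_ac y)"
  proof
    fix f assume "f \<in> L"
    then obtain u v where f: "f = ev to_ac y u / ev to_ac y v" "ev to_ac y v \<noteq> 0"
      by (auto simp: function_field_def regular_fun_eq_to_ac)
    then obtain a where "ev to_ac y v * ev to_ac y a = 1" using ev_y_bezout[of v] by auto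
    then have "inverse (ev to_ac y v) = ev to_ac y a" by (rule inverse_unique)
    then have "f = ev to_ac y (u * a)" using f by (simp add: to_ac.ev_mult divide_inverse)
    then show "f \<in> range (ev to_ac y)" by blast
  qed
qed

lemma L_representation:
  assumes "f \<in> L"
  obtains g where "f = (\<Sum>j<m. to_ac (g j) * y ^ j)"
proof -
  obtain q where q: "f = ev to_ac y q" using assms by (auto simp: L_eq)
  let ?q = "q mod P0"
  have "f = ev to_ac y (q div P0 * P0 + ?q)" by (simp only: q div_mult_mod_eq)
  then have "f = ev to_ac y ?q" by (simp only: to_ac.ev_add to_ac.ev_mult ev_P0_y) simp
  moreover have "?q = 0 \<or> degree ?q < m"
    using degree_mod_less[OF P0_nonzero, of q] degree_P0 by simp
  then have "degree ?q < m" using m_pos by auto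
  then have "(\<Sum>i\<le>degree ?q. to_ac (coeff ?q i) * y ^ i) = (\<Sum>i<m. to_ac (coeff ?q i) * y ^ i)"
    by (intro sum.mono_neutral_left) (auto simp: coeff_eq_0)
  ultimately show ?thesis using that by (simp add: to_ac.ev_eq_sum)
qed

lemma extend_hom:
  fixes \<psi> :: "'k poly fract \<Rightarrow> 'e :: field"
  assumes "field_hom \<psi>" and z: "z ^ m = \<psi> F0"
  obtains \<phi> where "\<And>q. \<phi> (ev to_ac y q) = ev \<psi> z q"
    "\<And>f g. f \<in> L \<Longrightarrow> g \<in> L \<Longrightarrow> \<phi> (f + g) = \<phi> f + \<phi> g"
    "\<And>f g. f \<in> L \<Longrightarrow> g \<in> L \<Longrightarrow> \<phi> (f * g) = \<phi> f * \<phi> g"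
    "\<phi> 1 = 1" "\<And>p. \<phi> (embed_poly p) = \<psi> (Fraction_Field.Fract p 1)" "\<phi> y = z"
    "\<And>f. f \<in> L \<Longrightarrow> f \<noteq> 0 \<Longrightarrow> \<phi> f \<noteq> 0"
proof -
  interpret field_hom \<psi> by fact
  define \<phi> where "\<phi> f = ev \<psi> z (SOME q. f = ev to_ac y q)" for f
  have \<phi>: "\<phi> (ev to_ac y q) = ev \<psi> z q" for q
  proof -
    define q' where "q' = (SOME q'. ev to_ac y q = ev to_ac y q')"
    have "ev to_ac y q = ev to_ac y q'" unfolding q'_def by (rule someI) simp
    then have "ev to_ac y (q - q') = 0"
      by (simp add: comm_ring_1_hom.hom_diff[OF to_ac.comm_ring_1_hom_ev])
    then obtain s where "q - q' = P0 * s" using P0_dvd by blast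
    then have "ev \<psi> z (q - q') = 0"
      using z by (simp add: ev_mult ev_P0[OF comm_ring_1_hom_axioms])
    then have "ev \<psi> z q = ev \<psi> z q'"
      by (simp add: comm_ring_1_hom.hom_diff[OF comm_ring_1_hom_ev])
    then show ?thesis by (simp add: \<phi>_def q'_def)
  qed
  have add: "\<phi> (f + g) = \<phi> f + \<phi> g" and mult: "\<phi> (f * g) = \<phi> f * \<phi> g" if "f \<in> L" "g \<in> L" for f g
    using that by (auto simp: L_eq \<phi> ev_add ev_mult simp flip: to_ac.ev_add to_ac.ev_mult)
  have emb: "\<phi> (embed_poly p) = \<psi> (Fraction_Field.Fract p 1)" for p
    using \<phi>[of "[:Fraction_Field.Fract p 1:]"] by (simp add: to_ac.ev_const ev_const embed_poly_def)
  have one: "\<phi> 1 = 1" using emb[of 1] by (simp add: embed.hom_one hom_one flip: One_fract_def)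
  have yz: "\<phi> y = z"
    using \<phi>[of "[:0, 1:]"] by (simp add: to_ac.ev_X ev_X)
  have nz: "\<phi> f \<noteq> 0" if "f \<in> L" "f \<noteq> 0" for f
  proof
    assume "\<phi> f = 0"
    then have "\<phi> (f * inverse f) = 0" using that by (simp add: mult L.L_inverse del: right_inverse)
    then show False using that one by simp
  qed
  show ?thesis by (rule that[of \<phi>]) (fact \<phi> add mult one emb yz nz)+
qed

lemma places_dval: "v \<in> places \<longleftrightarrow> dval L (range scalar) v"
  by (simp add: curve_points_def dval_def dval_axioms_def subfield_L)

lemma place_from_laurent:
  fixes \<xi> \<eta> :: "'k fls"
  assumes \<xi>: "\<And>a. \<xi> \<noteq> fls_const a" and \<eta>: "\<eta> ^ m = ev fls_const \<xi> F"
    and coprime: "i * fls_subdegree (\<xi> - fls_const a) + j * fls_subdegree \<eta> = 1"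
  obtains v where "v \<in> places" "\<And>b. v (coord_x - scalar b) = fls_subdegree (\<xi> - fls_const b)"
    "v y = fls_subdegree \<eta>"
proof -
  interpret c: field_hom "fls_const :: 'k \<Rightarrow> 'k fls"
    by unfold_locales (auto simp: fls_plus_const)
  interpret e: comm_ring_1_hom "ev fls_const \<xi>" by (rule c.comm_ring_1_hom_ev)
  have nz: "ev fls_const \<xi> p \<noteq> 0" if p: "p \<noteq> 0" for p
  proof -
    obtain A where A: "p = Polynomial.smult (lead_coeff p) (\<Prod>z\<in>#A. [:- z, 1:])"
      using alg_closed_imp_factorization[OF p] by blast
    have "ev fls_const \<xi> (\<Prod>z\<in>#A. [:- z, 1:]) \<noteq> 0"
      using \<xi> by (induction A)
        (auto simp: c.ev_mult c.ev_pCons e.hom_one c.hom_uminus e.hom_zero simp del: mult_pCons_left mult_pCons_right)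
    then show ?thesis using p by (subst A) (simp add: c.ev_smult)
  qed
  define \<psi> where "\<psi> = fract_ext (ev fls_const \<xi>)"
  have \<psi>: "\<psi> (Fraction_Field.Fract p 1) = ev fls_const \<xi> p" for p
    unfolding \<psi>_def by (subst fract_ext_Fract) (use nz in \<open>auto simp: e.hom_one e.comm_ring_1_hom_axioms\<close>)
  have "field_hom \<psi>" unfolding \<psi>_def by (rule field_hom_fract_ext) (use nz e.comm_ring_1_hom_axioms in auto)
  then obtain \<phi> where \<phi>: "\<And>f g. f \<in> L \<Longrightarrow> g \<in> L \<Longrightarrow> \<phi> (f + g) = \<phi> f + \<phi> g"
    "\<And>f g. f \<in> L \<Longrightarrow> g \<in> L \<Longrightarrow> \<phi> (f * g) = \<phi> f * \<phi> g"
    "\<phi> 1 = 1" "\<And>p. \<phi> (embed_poly p) = \<psi> (Fraction_Field.Fract p 1)" "\<phi> y = \<eta>"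
    "\<And>f. f \<in> L \<Longrightarrow> f \<noteq> 0 \<Longrightarrow> \<phi> f \<noteq> 0"
    by (rule extend_hom[of \<psi> \<eta>]) (use \<eta> in \<open>auto simp: F0_def \<psi>\<close>)
  define v where "v f = (if f \<in> L - {0} then fls_subdegree (\<phi> f) else 0)" for f
  have \<phi>x: "\<phi> (coord_x - scalar b) = \<xi> - fls_const b" for b
    by (simp add: x_minus_scalar \<phi> \<psi> c.ev_pCons c.hom_uminus) (simp add: ev_def)
  have \<phi>c: "\<phi> (scalar b) = fls_const b" for b
    by (simp add: \<phi> \<psi> c.ev_const)
  have xb: "coord_x - scalar b \<in> L - {0}" for b
    by (simp add: x_minus_scalar embed_in_L embed_poly_eq_0_iff)
  have pow: "\<phi> (f ^ n) = \<phi> f ^ n" if "f \<in> L" for f n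
    using that by (induction n) (auto simp: \<phi> L.L_power)
  have inv: "\<phi> (inverse f) = inverse (\<phi> f)" if "f \<in> L" "f \<noteq> 0" for f
    using \<phi>(2)[of f "inverse f"] that \<phi>(3) by (auto simp: L.L_inverse intro: inverse_unique[symmetric])
  have powi: "fls_subdegree (\<phi> (f powi n)) = n * fls_subdegree (\<phi> f)" if "f \<in> L" "f \<noteq> 0" for f n
  proof -
    have "\<phi> (f powi n) = \<phi> f powi n"
      using that by (auto simp: power_int_def pow inv L.L_inverse)
    then show ?thesis by simp
  qed
  have "dval L (range scalar) v"
  proof (unfold_locales, unfold discrete_valuation_def, intro conjI ballI allI impI)
    fix f assume "f \<notin> L - {0}" then show "v f = 0" by (simp only: v_def if_False)
  next
    fix f g assume *: "f \<in> L - {0}" "g \<in> L - {0}"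
    then show "v (f * g) = v f + v g" by (simp add: v_def L.L_mult \<phi>)
    assume "f + g \<noteq> 0"
    then have "\<phi> f + \<phi> g \<noteq> 0" using \<phi>(6)[of "f + g"] \<phi>(1)[of f g] * by (auto simp: L.L_add)
    then show "min (v f) (v g) \<le> v (f + g)"
      using * \<open>f + g \<noteq> 0\<close> fls_plus_subdegree[of "\<phi> f" "\<phi> g"] by (simp add: v_def L.L_add \<phi>)
  next
    fix f assume "f \<in> range scalar - {0 :: 'k ratfun_closure}"
    then show "v f = 0" by (auto simp: v_def \<phi>c)
  next
    have "n \<in> v ` (L - {0})" for n
    proof -
      let ?t = "(coord_x - scalar a) powi (n * i) * y powi (n * j)"
      have t: "?t \<in> L" "?t \<noteq> 0" using xb y_in_L y_nonzero by (auto simp: L.L_closed)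
      have "v ?t = n * (i * fls_subdegree (\<xi> - fls_const a) + j * fls_subdegree \<eta>)"
        using t xb[of a] y_in_L y_nonzero \<phi>(6)
        by (simp add: v_def \<phi> L.L_closed powi \<phi>x algebra_simps)
      then show ?thesis using t coprime by (intro image_eqI[of _ _ ?t]) auto
    qed
    then show "v ` (L - {0}) = UNIV" by blast
  qed
  then have "v \<in> places" by (simp add: places_dval)
  moreover have "v y = fls_subdegree \<eta>" using y_in_L y_nonzero by (simp add: v_def \<phi>)
  moreover have "\<And>b. v (coord_x - scalar b) = fls_subdegree (\<xi> - fls_const b)"
    using xb by (simp add: v_def \<phi>x)
  ultimately show ?thesis using that by blast
qed

end

section \<open>Roots of unity and conjugate places\<close>

lemma card_roots_of_unity:
  fixes n :: nat
  assumes n: "of_nat n \<noteq> (0 :: 'a :: alg_closed_field)"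
  shows "finite {z :: 'a. z ^ n = 1}" "card {z :: 'a. z ^ n = 1} = n"
proof -
  have "n > 0" using n by (cases n) auto
  define p where "p = Polynomial.monom (1 :: 'a) n - [:1:]"
  have poly_p: "poly p z = z ^ n - 1" for z by (simp add: p_def poly_monom)
  have deg: "degree p = n"
    using degree_add_eq_left[of "- [:1 :: 'a:]" "Polynomial.monom 1 n"] \<open>n > 0\<close>
    by (simp add: p_def degree_monom_eq del: minus_pCons)
  then have "p \<noteq> 0" using \<open>n > 0\<close> by auto
  have "lead_coeff p = 1" using deg \<open>n > 0\<close> by (simp add: p_def coeff_pCons split: nat.splits)
  then obtain A where A: "size A = n" "p = (\<Prod>z\<in>#A. [:- z, 1:])"
    using alg_closed_imp_factorization[OF \<open>p \<noteq> 0\<close>] deg by auto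
  have "poly p z = (\<Prod>w\<in>#A. z - w)" for z by (simp add: A(2) poly_prod_mset)
  then have "z \<in># A \<longleftrightarrow> z ^ n - 1 = 0" for z
    unfolding poly_p[symmetric] by (auto simp: prod_mset_zero_iff image_iff)
  then have roots: "set_mset A = {z. z ^ n = 1}" by auto
  have "count A z \<le> 1" for z
  proof (rule ccontr)
    assume c: "\<not> count A z \<le> 1"
    then have "{#z, z#} \<subseteq># A" by (simp add: subseteq_mset_def)
    then obtain B where "A = {#z, z#} + B" by (metis subset_mset.le_iff_add)
    then have p: "p = [:- z, 1:] * ([:- z, 1:] * (\<Prod>z\<in>#B. [:- z, 1:]))"
      using A(2) by (simp add: mult.assoc del: mult_pCons_left mult_pCons_right)
    have "poly (pderiv p) z = 0"
      unfolding p pderiv_mult by (simp del: mult_pCons_left mult_pCons_right)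
    moreover have "poly (pderiv p) z = of_nat n * z ^ (n - 1)"
      by (simp add: p_def pderiv_diff pderiv_monom poly_monom pderiv_pCons)
    moreover have "z \<noteq> 0"
    proof
      assume "z = 0"
      moreover have "z \<in># A" using c by (metis count_greater_zero_iff not_le less_le_trans zero_less_one less_imp_le)
      ultimately show False using roots \<open>n > 0\<close> by (auto simp: zero_power)
    qed
    ultimately show False using n by simp
  qed
  then have "A = mset_set (set_mset A)"
    by (intro multiset_eqI) (metis count_mset_set(1,3) finite_set_mset count_eq_zero_iff count_greater_zero_iff le_antisym less_eq_Suc_le One_nat_def)
  then show "finite {z :: 'a. z ^ n = 1}" "card {z :: 'a. z ^ n = 1} = n"
    using A(1) roots by (metis finite_set_mset, metis size_mset_set)
qed

lemma sum_roots_of_unity: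
  fixes n k :: nat
  assumes n: "of_nat n \<noteq> (0 :: 'a :: alg_closed_field)"
  shows "(\<Sum>z\<in>{z :: 'a. z ^ n = 1}. z ^ k) = (if n dvd k then of_nat n else 0)"
proof (cases "n dvd k")
  case True
  then have "z ^ k = 1" if "z ^ n = 1" for z :: 'a using that by (auto simp: power_mult)
  then have "(\<Sum>z\<in>{z :: 'a. z ^ n = 1}. z ^ k) = (\<Sum>z\<in>{z :: 'a. z ^ n = 1}. 1)"
    by (intro sum.cong) auto
  then show ?thesis using True card_roots_of_unity(2)[OF n] by simp
next
  case False
  let ?U = "{z :: 'a. z ^ n = 1}"
  have "n > 0" using n by (cases n) auto
  define l where "l = k mod n"
  have l: "0 < l" "l < n" using False \<open>n > 0\<close> by (auto simp: l_def dvd_eq_mod_eq_0)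
  define q where "q = Polynomial.monom (1 :: 'a) l - 1"
  have deg: "degree q = l"
    using degree_add_eq_left[of "- [:1 :: 'a:]" "Polynomial.monom 1 l"] l
    by (simp add: q_def degree_monom_eq one_pCons del: minus_pCons)
  then have "q \<noteq> 0" using l by auto
  then have "card {z. poly q z = 0} \<le> l" using card_poly_roots_bound[of q] deg by simp
  then have "\<not> ?U \<subseteq> {z. poly q z = 0}"
    using l card_roots_of_unity(2)[OF n] poly_roots_finite[OF \<open>q \<noteq> 0\<close>]
    by (metis card_mono not_le le_trans)
  then obtain w where "w \<in> ?U" "poly q w \<noteq> 0" by blast
  then have w: "w ^ n = 1" "w ^ l \<noteq> 1" by (auto simp: q_def poly_monom)
  have "w ^ k = w ^ (n * (k div n) + l)" by (simp add: l_def)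
  then have wk: "w ^ k \<noteq> 1" using w by (simp only: power_add power_mult) simp
  have "w \<noteq> 0" using w \<open>n > 0\<close> by (auto simp: zero_power)
  have "bij_betw (\<lambda>z. w * z) ?U ?U"
    by (rule bij_betwI[where g = "\<lambda>z. inverse w * z"])
       (use w \<open>w \<noteq> 0\<close> in \<open>auto simp: power_mult_distrib power_inverse\<close>)
  then have "(\<Sum>z\<in>?U. (w * z) ^ k) = (\<Sum>z\<in>?U. z ^ k)"
    by (rule sum.reindex_bij_betw)
  then have "w ^ k * (\<Sum>z\<in>?U. z ^ k) = (\<Sum>z\<in>?U. z ^ k)"
    by (simp add: power_mult_distrib sum_distrib_left)
  then have "(w ^ k - 1) * (\<Sum>z\<in>?U. z ^ k) = 0" by (simp add: algebra_simps)
  then show ?thesis using wk False by simp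
qed

context superelliptic
begin

definition conj_aut :: "'k \<Rightarrow> 'k ratfun_closure \<Rightarrow> 'k ratfun_closure" where
  "conj_aut \<zeta> = (SOME \<phi>. (\<forall>f\<in>L. \<phi> f \<in> L) \<and> (\<forall>f\<in>L. \<forall>g\<in>L. \<phi> (f + g) = \<phi> f + \<phi> g) \<and>
     (\<forall>f\<in>L. \<forall>g\<in>L. \<phi> (f * g) = \<phi> f * \<phi> g) \<and> \<phi> 1 = 1 \<and> (\<forall>g. \<phi> (to_ac g) = to_ac g) \<and>
     \<phi> y = scalar \<zeta> * y \<and> (\<forall>f\<in>L. f \<noteq> 0 \<longrightarrow> \<phi> f \<noteq> 0))"

lemma conj_aut:
  assumes "\<zeta> ^ m = 1"
  shows conj_aut_in_L: "f \<in> L \<Longrightarrow> conj_aut \<zeta> f \<in> L"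
    and conj_aut_add: "f \<in> L \<Longrightarrow> g \<in> L \<Longrightarrow> conj_aut \<zeta> (f + g) = conj_aut \<zeta> f + conj_aut \<zeta> g"
    and conj_aut_mult: "f \<in> L \<Longrightarrow> g \<in> L \<Longrightarrow> conj_aut \<zeta> (f * g) = conj_aut \<zeta> f * conj_aut \<zeta> g"
    and conj_aut_one: "conj_aut \<zeta> 1 = 1"
    and conj_aut_to_ac: "conj_aut \<zeta> (to_ac h) = to_ac h"
    and conj_aut_y: "conj_aut \<zeta> y = scalar \<zeta> * y"
    and conj_aut_nonzero: "f \<in> L \<Longrightarrow> f \<noteq> 0 \<Longrightarrow> conj_aut \<zeta> f \<noteq> 0"
proof -
  have z: "(scalar \<zeta> * y) ^ m = to_ac F0"
    using assms y_power
    by (simp add: power_mult_distrib F0_def embed_poly_def[of F] scalar.hom_one flip: scalar.hom_power)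
  obtain \<phi> where \<phi>: "\<And>q. \<phi> (ev to_ac y q) = ev to_ac (scalar \<zeta> * y) q"
    "\<And>f g. f \<in> L \<Longrightarrow> g \<in> L \<Longrightarrow> \<phi> (f + g) = \<phi> f + \<phi> g"
    "\<And>f g. f \<in> L \<Longrightarrow> g \<in> L \<Longrightarrow> \<phi> (f * g) = \<phi> f * \<phi> g"
    "\<phi> 1 = 1" "\<phi> y = scalar \<zeta> * y" "\<And>f. f \<in> L \<Longrightarrow> f \<noteq> 0 \<Longrightarrow> \<phi> f \<noteq> 0"
    using extend_hom[OF to_ac.field_hom_axioms z] by metis
  have "scalar \<zeta> * y \<in> L" by (simp add: L.L_mult embed_in_L y_in_L)
  then have "ev to_ac (scalar \<zeta> * y) q \<in> L" for q
    unfolding to_ac.ev_eq_sum by (intro L.L_sum L.L_mult L.L_power to_ac_in_L embed_in_L y_in_L)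
  then have "\<phi> f \<in> L" if "f \<in> L" for f
    using that \<phi>(1) unfolding L_eq by (metis rangeE)
  moreover have "\<phi> (to_ac g) = to_ac g" for g
    using \<phi>(1)[of "[:g:]"] by (simp add: to_ac.ev_const)
  ultimately have "\<exists>\<phi>. (\<forall>f\<in>L. \<phi> f \<in> L) \<and> (\<forall>f\<in>L. \<forall>g\<in>L. \<phi> (f + g) = \<phi> f + \<phi> g) \<and>
     (\<forall>f\<in>L. \<forall>g\<in>L. \<phi> (f * g) = \<phi> f * \<phi> g) \<and> \<phi> 1 = 1 \<and> (\<forall>g. \<phi> (to_ac g) = to_ac g) \<and>
     \<phi> y = scalar \<zeta> * y \<and> (\<forall>f\<in>L. f \<noteq> 0 \<longrightarrow> \<phi> f \<noteq> 0)"
    using \<phi> by (intro exI[of _ \<phi>]) auto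
  from someI_ex[OF this, folded conj_aut_def]
  show "f \<in> L \<Longrightarrow> conj_aut \<zeta> f \<in> L" "f \<in> L \<Longrightarrow> g \<in> L \<Longrightarrow> conj_aut \<zeta> (f + g) = conj_aut \<zeta> f + conj_aut \<zeta> g"
    "f \<in> L \<Longrightarrow> g \<in> L \<Longrightarrow> conj_aut \<zeta> (f * g) = conj_aut \<zeta> f * conj_aut \<zeta> g" "conj_aut \<zeta> 1 = 1"
    "conj_aut \<zeta> (to_ac h) = to_ac h" "conj_aut \<zeta> y = scalar \<zeta> * y"
    "f \<in> L \<Longrightarrow> f \<noteq> 0 \<Longrightarrow> conj_aut \<zeta> f \<noteq> 0"
    by blast+
qed

lemma conj_aut_embed: "\<zeta> ^ m = 1 \<Longrightarrow> conj_aut \<zeta> (embed_poly p) = embed_poly p"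
  by (simp add: embed_poly_def conj_aut_to_ac)

lemma conj_aut_power: "\<zeta> ^ m = 1 \<Longrightarrow> f \<in> L \<Longrightarrow> conj_aut \<zeta> (f ^ n) = conj_aut \<zeta> f ^ n"
  by (induction n) (auto simp: conj_aut_one conj_aut_mult L.L_power)

lemma conj_aut_sum:
  assumes "\<zeta> ^ m = 1" "\<And>i. i \<in> A \<Longrightarrow> f i \<in> L"
  shows "conj_aut \<zeta> (sum f A) = (\<Sum>i\<in>A. conj_aut \<zeta> (f i))"
  using assms(2)
proof (induction A rule: infinite_finite_induct)
  case (insert i A)
  then show ?case by (simp add: conj_aut_add[OF assms(1)] L.L_sum)
qed (use conj_aut_to_ac[OF assms(1), of 0] in auto)

lemma conj_aut_representation:
  assumes "\<zeta> ^ m = 1"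
  shows "conj_aut \<zeta> (\<Sum>j<m. to_ac (g j) * y ^ j) = (\<Sum>j<m. scalar (\<zeta> ^ j) * (to_ac (g j) * y ^ j))"
  using assms
  by (simp add: conj_aut_sum L.L_mult L.L_power to_ac_in_L y_in_L conj_aut_mult conj_aut_to_ac
      conj_aut_power conj_aut_y power_mult_distrib mult_ac scalar.hom_power)

lemma conj_aut_surj:
  assumes "\<zeta> ^ m = 1" "f \<in> L"
  shows "\<exists>f'\<in>L. conj_aut \<zeta> f' = f"
proof -
  obtain g where g: "f = (\<Sum>j<m. to_ac (g j) * y ^ j)" using L_representation[OF assms(2)] .
  have "\<zeta> \<noteq> 0" using assms(1) m_pos by (auto simp: zero_power)
  let ?g = "\<lambda>j. Fraction_Field.Fract [:inverse (\<zeta> ^ j):] 1 * g j"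
  have *: "to_ac (?g j) = scalar (inverse (\<zeta> ^ j)) * to_ac (g j)" for j
    by (simp add: embed_poly_def)
  have "conj_aut \<zeta> (\<Sum>j<m. to_ac (?g j) * y ^ j) = f"
    unfolding conj_aut_representation[OF assms(1), of ?g]
    unfolding g *
    using \<open>\<zeta> \<noteq> 0\<close> by (intro sum.cong) (auto simp: scalar.hom_inverse scalar.hom_eq_0_iff)
  moreover have "(\<Sum>j<m. to_ac (?g j) * y ^ j) \<in> L"
    by (intro L.L_sum L.L_mult L.L_power to_ac_in_L y_in_L)
  ultimately show ?thesis by blast
qed

definition conj_place :: "'k \<Rightarrow> 'k place \<Rightarrow> 'k place" where
  "conj_place \<zeta> v f = (if f \<in> L then v (conj_aut \<zeta> f) else 0)"

lemma conj_place:
  assumes \<zeta>: "\<zeta> ^ m = 1" and v: "v \<in> places"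
  shows "conj_place \<zeta> v \<in> places"
proof -
  interpret dval L "range scalar" v using v by (simp add: places_dval)
  note simps = conj_aut_in_L[OF \<zeta>] conj_aut_add[OF \<zeta>] conj_aut_mult[OF \<zeta>] conj_aut_nonzero[OF \<zeta>]
  have "dval L (range scalar) (conj_place \<zeta> v)"
  proof (unfold_locales, unfold discrete_valuation_def, intro conjI ballI allI impI)
    fix f assume "f \<notin> L - {0}"
    then show "conj_place \<zeta> v f = 0"
      using conj_aut_to_ac[OF \<zeta>, of 0] by (auto simp: conj_place_def v_zero)
  next
    fix f g assume *: "f \<in> L - {0}" "g \<in> L - {0}"
    then show "conj_place \<zeta> v (f * g) = conj_place \<zeta> v f + conj_place \<zeta> v g"
      by (simp add: conj_place_def L.L_mult simps v_mult)
    assume "f + g \<noteq> 0"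
    then show "min (conj_place \<zeta> v f) (conj_place \<zeta> v g) \<le> conj_place \<zeta> v (f + g)"
      using v_add[of "conj_aut \<zeta> f" "conj_aut \<zeta> g"] * simps(4)[of "f + g"]
      by (simp add: conj_place_def L.L_add simps)
  next
    fix f assume "f \<in> range scalar - {0 :: 'k ratfun_closure}"
    then show "conj_place \<zeta> v f = 0"
      by (auto simp: conj_place_def conj_aut_embed[OF \<zeta>] v_const)
  next
    have "n \<in> conj_place \<zeta> v ` (L - {0})" for n
    proof -
      obtain f where f: "f \<in> L" "f \<noteq> 0" "v f = n" using v_surj by blast
      obtain f' where "f' \<in> L" "conj_aut \<zeta> f' = f" using conj_aut_surj[OF \<zeta> f(1)] by blast
      moreover from this have "f' \<noteq> 0" using f conj_aut_to_ac[OF \<zeta>, of 0] by auto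
      ultimately show ?thesis using f by (intro image_eqI[of _ _ f']) (auto simp: conj_place_def)
    qed
    then show "conj_place \<zeta> v ` (L - {0}) = UNIV" by blast
  qed
  then show ?thesis by (simp add: places_dval)
qed

lemma conj_place_embed: "\<zeta> ^ m = 1 \<Longrightarrow> conj_place \<zeta> v (embed_poly p) = v (embed_poly p)"
  by (simp add: conj_place_def embed_in_L conj_aut_embed)

text \<open>
  Averaging over the conjugates of \<open>f\<close> isolates each component \<open>g\<^sub>i y\<^sup>i\<close>, which therefore
  satisfies any lower bound that all conjugates satisfy.
\<close>

lemma component_bound:
  assumes v: "v \<in> places" and f: "f = (\<Sum>j<m. to_ac (g j) * y ^ j)" "f \<noteq> 0"
    and bound: "\<And>\<zeta>. \<zeta> ^ m = 1 \<Longrightarrow> n \<le> conj_place \<zeta> v f" and "i < m" "g i \<noteq> 0"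
  shows "n \<le> v (to_ac (g i) * y ^ i)"
proof -
  interpret dval L "range scalar" v using v by (simp add: places_dval)
  let ?U = "{\<zeta> :: 'k. \<zeta> ^ m = 1}"
  let ?h = "\<lambda>j. to_ac (g j) * y ^ j"
  have hL: "?h j \<in> L" for j by (simp add: L.L_closed to_ac_in_L y_in_L)
  then have fL: "f \<in> L" unfolding f by (intro L.L_sum) auto
  have "(\<Sum>\<zeta>\<in>?U. scalar (\<zeta> ^ (m - i)) * conj_aut \<zeta> f)
      = (\<Sum>\<zeta>\<in>?U. \<Sum>j<m. scalar (\<zeta> ^ (m - i + j)) * ?h j)"
    by (intro sum.cong refl)
       (simp add: f conj_aut_representation sum_distrib_left power_add scalar.hom_mult mult_ac)
  also have "\<dots> = (\<Sum>j<m. \<Sum>\<zeta>\<in>?U. scalar (\<zeta> ^ (m - i + j)) * ?h j)"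
    by (rule sum.swap)
  also have "\<dots> = (\<Sum>j<m. scalar (\<Sum>\<zeta>\<in>?U. \<zeta> ^ (m - i + j)) * ?h j)"
    by (simp add: scalar.hom_sum sum_distrib_right)
  also have "\<dots> = (\<Sum>j<m. if j = i then scalar (of_nat m) * ?h i else 0)"
  proof (intro sum.cong refl)
    fix j assume "j \<in> {..<m}"
    have "m dvd m - i + j \<longleftrightarrow> j = i"
    proof
      assume dvd: "m dvd m - i + j"
      show "j = i"
      proof (rule ccontr)
        assume "j \<noteq> i"
        have "0 < m - i + j" "m - i + j < m + m" "m - i + j \<noteq> m"
          using \<open>j \<in> _\<close> \<open>i < m\<close> \<open>j \<noteq> i\<close> by auto
        moreover obtain k where k: "m - i + j = m * k" using dvd by blast
        ultimately have "k \<noteq> 0" "k \<noteq> 1" by (auto simp: k)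
        then have "m * 2 \<le> m * k" by (intro mult_le_mono2) simp
        then show False using k \<open>m - i + j < m + m\<close> by linarith
      qed
    qed (use \<open>i < m\<close> in auto)
    then show "scalar (\<Sum>\<zeta>\<in>?U. \<zeta> ^ (m - i + j)) * ?h j = (if j = i then scalar (of_nat m) * ?h i else 0)"
      using sum_roots_of_unity[OF m_nonzero, of "m - i + j"] by (simp add: embed.hom_zero)
  qed
  also have "\<dots> = scalar (of_nat m) * ?h i" using \<open>i < m\<close> by simp
  finally have eq: "scalar (of_nat m) * ?h i = (\<Sum>\<zeta>\<in>?U. scalar (\<zeta> ^ (m - i)) * conj_aut \<zeta> f)" ..
  have "vge n (scalar (of_nat m) * ?h i)"
    unfolding eq
  proof (rule vge_sum)
    fix \<zeta> :: 'k assume "\<zeta> \<in> ?U"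
    then have "vge n (conj_aut \<zeta> f)"
      using bound[of \<zeta>] fL by (simp add: vge_def conj_aut_in_L conj_place_def)
    moreover have "vge 0 (scalar (\<zeta> ^ (m - i)))" by (simp add: vge_def embed_in_L v_const)
    ultimately show "vge n (scalar (\<zeta> ^ (m - i)) * conj_aut \<zeta> f)"
      using vge_mult[of 0 _ n] by simp
  qed
  moreover have "scalar (of_nat m) \<noteq> (0 :: 'k ratfun_closure)"
    using m_nonzero by (simp only: scalar.hom_eq_0_iff not_False_eq_True)
  moreover have "?h i \<noteq> 0" using \<open>g i \<noteq> 0\<close> y_nonzero by (simp add: to_ac.hom_eq_0_iff)
  ultimately show ?thesis
    using v_mult[of "scalar (of_nat m)" "?h i"] hL embed_in_L v_const
    by (auto simp: vge_def)
qed

end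

section \<open>Local rings at smooth points\<close>

definition ev2 :: "'k :: alg_closed_field ratfun_closure \<Rightarrow> 'k ratfun_closure \<Rightarrow> 'k poly poly \<Rightarrow> 'k ratfun_closure" where
  "ev2 \<xi> \<eta> u = ev (ev scalar \<xi>) \<eta> u"

definition coord_ring_at ::
  "'k :: alg_closed_field ratfun_closure \<Rightarrow> 'k ratfun_closure \<Rightarrow> 'k \<times> 'k \<Rightarrow> 'k ratfun_closure set" where
  "coord_ring_at \<xi> \<eta> P = {ev2 \<xi> \<eta> u / ev2 \<xi> \<eta> w | u w. eval_at w P \<noteq> 0}"

interpretation ev1: comm_ring_1_hom "ev scalar \<xi>" for \<xi> :: "'k :: alg_closed_field ratfun_closure"
  by (rule scalar.comm_ring_1_hom_ev)

interpretation ev2: comm_ring_1_hom "ev2 \<xi> \<eta>" for \<xi> :: "'k :: alg_closed_field ratfun_closure" and \<eta>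
  using ev1.comm_ring_1_hom_ev[of \<xi> \<eta>] by (simp add: ev2_def[abs_def])

interpretation eval_at: comm_ring_1_hom "\<lambda>u. eval_at u P" for P :: "'k :: alg_closed_field \<times> 'k"
  by unfold_locales (auto simp: eval_at_def)

lemma ev2_pCons: "ev2 \<xi> \<eta> (pCons p u) = ev scalar \<xi> p + \<eta> * ev2 \<xi> \<eta> u"
  by (simp add: ev2_def ev1.ev_pCons)

lemma ev2_scalar: "ev2 \<xi> \<eta> [:[:c:]:] = scalar c"
  by (simp add: ev2_def ev1.ev_const scalar.ev_const)

lemma ev2_fst: "ev2 \<xi> \<eta> [:[:0, 1:]:] = \<xi>"
  by (simp add: ev2_def ev1.ev_const scalar.ev_X)

lemma ev2_snd: "ev2 \<xi> \<eta> [:0, 1:] = \<eta>"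
  by (simp add: ev2_def ev1.ev_X)

lemma eval_at_scalar: "eval_at [:[:c:]:] P = c"
  and eval_at_snd: "eval_at [:0, 1:] P = snd P"
  by (simp_all add: eval_at_def)

lemma eval_at_zero_decompose:
  assumes "eval_at u (a, b) = 0"
  obtains q p where "ev2 \<xi> \<eta> u = (\<eta> - scalar b) * ev2 \<xi> \<eta> q + (\<xi> - scalar a) * ev2 \<xi> \<eta> [:p:]"
proof -
  define s where "s = poly u [:b:]"
  have "[:- [:b:], 1:] dvd u - [:s:]"
    using poly_eq_0_iff_dvd[of "u - [:s:]" "[:b:]"] by (simp add: s_def)
  then obtain q where q: "u - [:s:] = [:- [:b:], 1:] * q" by blast
  have "poly s a = 0" using assms by (simp add: eval_at_def s_def)
  then obtain p where p: "s = [:- a, 1:] * p" by (auto simp: poly_eq_0_iff_dvd)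
  have "ev2 \<xi> \<eta> u = ev2 \<xi> \<eta> ([:- [:b:], 1:] * q + [:s:])" by (simp only: q[symmetric]) simp
  also have "\<dots> = ev2 \<xi> \<eta> [:- [:b:], 1:] * ev2 \<xi> \<eta> q + ev2 \<xi> \<eta> [:s:]"
    by (simp only: ev2.hom_add ev2.hom_mult)
  also have "ev2 \<xi> \<eta> [:- [:b:], 1:] = \<eta> - scalar b"
    by (simp add: ev2_pCons ev1.hom_one scalar.ev_const scalar.hom_uminus ev2.hom_zero)
  also have "ev2 \<xi> \<eta> [:s:] = (\<xi> - scalar a) * ev2 \<xi> \<eta> [:p:]"
    by (simp add: p ev2_def ev1.ev_const scalar.ev_mult scalar.ev_pCons scalar.hom_uminus ev1.hom_one ev1.hom_zero
        scalar.hom_one del: mult_pCons_left mult_pCons_right)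
  finally show ?thesis by (rule that)
qed

locale centered_place = dval L "range scalar" v
  for L and v :: "'k :: alg_closed_field place" +
  fixes \<xi> \<eta> and a b :: 'k
  assumes scalar_in_L: "\<And>c. scalar c \<in> L" and in_L: "\<xi> \<in> L" "\<eta> \<in> L"
    and center: "vge 1 (\<xi> - scalar a)" "vge 1 (\<eta> - scalar b)"
begin

abbreviation "R \<equiv> coord_ring_at \<xi> \<eta> (a, b)"

lemma ev2_in_L: "ev2 \<xi> \<eta> u \<in> L"
proof -
  have "ev scalar \<xi> p \<in> L" for p
    unfolding scalar.ev_eq_sum by (intro L_sum L_mult L_power scalar_in_L in_L)
  then show ?thesis
    unfolding ev2_def ev1.ev_eq_sum by (intro L_sum L_mult L_power in_L)
qed

lemma vge_scalar: "vge 0 (scalar c)"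
  by (simp add: vge_def scalar_in_L v_const)

lemma vge_coords: "vge 0 \<xi>" "vge 0 \<eta>"
  using vge_add[OF vge_mono[OF center(1)] vge_scalar[of a]] vge_add[OF vge_mono[OF center(2)] vge_scalar[of b]]
  by auto

lemma vge_ev1: "vge 0 (ev scalar \<xi> p)"
proof (induction p)
  case (pCons c p)
  then show ?case
    by (auto simp: scalar.ev_pCons intro!: vge_add vge_scalar vge_mult0 vge_coords)
qed (simp add: ev1.hom_zero vge_zero)

lemma vge_ev2: "vge 0 (ev2 \<xi> \<eta> u)"
proof (induction u)
  case (pCons c p)
  then show ?case
    by (auto simp: ev2_pCons intro!: vge_add vge_ev1 vge_mult0 vge_coords)
qed (simp add: ev2.hom_zero vge_zero)

lemma vge_ev2_eval_at_0:
  assumes "eval_at u (a, b) = 0"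
  shows "vge 1 (ev2 \<xi> \<eta> u)"
proof -
  obtain q p where "ev2 \<xi> \<eta> u = (\<eta> - scalar b) * ev2 \<xi> \<eta> q + (\<xi> - scalar a) * ev2 \<xi> \<eta> [:p:]"
    using eval_at_zero_decompose[OF assms] .
  then show ?thesis
    using vge_add[OF vge_mult[OF center(2) vge_ev2[of q]] vge_mult[OF center(1) vge_ev2[of "[:p:]"]]] by simp
qed

lemma ev2_unit:
  assumes "eval_at w (a, b) \<noteq> 0"
  shows "ev2 \<xi> \<eta> w \<noteq> 0" "v (ev2 \<xi> \<eta> w) = 0"
proof -
  let ?c = "eval_at w (a, b)"
  have "eval_at ([:[:?c:]:] - w) (a, b) = 0" by (simp only: eval_at.hom_diff eval_at_scalar) simp
  then have "vge 1 (ev2 \<xi> \<eta> ([:[:?c:]:] - w))" by (rule vge_ev2_eval_at_0)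
  then have diff: "vge 1 (scalar ?c - ev2 \<xi> \<eta> w)" by (simp only: ev2.hom_diff ev2_scalar)
  have c: "scalar ?c \<noteq> (0 :: 'k ratfun_closure)" "v (scalar ?c) = 0"
    using assms by (auto simp: v_const scalar.hom_eq_0_iff)
  have "vge 1 (- (scalar ?c - ev2 \<xi> \<eta> w))"
    using diff v_uminus unfolding vge_def by (auto simp: L_uminus simp del: minus_diff_eq)
  then have "scalar ?c + - (scalar ?c - ev2 \<xi> \<eta> w) \<noteq> 0 \<and> v (scalar ?c + - (scalar ?c - ev2 \<xi> \<eta> w)) = v (scalar ?c)"
    by (intro v_add_less) (use c scalar_in_L in \<open>auto simp: vge_def\<close>)
  then show "ev2 \<xi> \<eta> w \<noteq> 0" "v (ev2 \<xi> \<eta> w) = 0" using c by auto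
qed

lemma R_I: "eval_at w (a, b) \<noteq> 0 \<Longrightarrow> ev2 \<xi> \<eta> u / ev2 \<xi> \<eta> w \<in> R"
  by (auto simp: coord_ring_at_def)

lemma R_E:
  assumes "h \<in> R"
  obtains u w where "h = ev2 \<xi> \<eta> u / ev2 \<xi> \<eta> w" "eval_at w (a, b) \<noteq> 0" "ev2 \<xi> \<eta> w \<noteq> 0" "v (ev2 \<xi> \<eta> w) = 0"
  using assms ev2_unit unfolding coord_ring_at_def by blast

lemma ev2_in_R: "ev2 \<xi> \<eta> u \<in> R"
  using R_I[of 1 u] by (simp add: ev2.hom_one eval_at.hom_one)

lemma R_one: "1 \<in> R"
  using ev2_in_R[of 1] by (simp add: ev2.hom_one)

lemma R_scalar: "scalar c \<in> R"
  using ev2_in_R[of "[:[:c:]:]"] by (simp add: ev2_scalar)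

lemma R_coords: "\<xi> \<in> R" "\<eta> \<in> R"
  using ev2_in_R[of "[:[:0, 1:]:]"] ev2_in_R[of "[:0, 1:]"] by (simp_all only: ev2_fst ev2_snd)

lemma R_add: "h \<in> R \<Longrightarrow> h' \<in> R \<Longrightarrow> h + h' \<in> R"
proof -
  assume "h \<in> R" "h' \<in> R"
  then obtain u w u' w' where h: "h = ev2 \<xi> \<eta> u / ev2 \<xi> \<eta> w" "eval_at w (a, b) \<noteq> 0" "ev2 \<xi> \<eta> w \<noteq> 0"
    "h' = ev2 \<xi> \<eta> u' / ev2 \<xi> \<eta> w'" "eval_at w' (a, b) \<noteq> 0" "ev2 \<xi> \<eta> w' \<noteq> 0"
    by (elim R_E) blast
  then show ?thesis
    using R_I[of "w * w'" "u * w' + u' * w"]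
    by (simp add: ev2.hom_add ev2.hom_mult eval_at.hom_mult add_frac_eq)
qed

lemma R_mult: "h \<in> R \<Longrightarrow> h' \<in> R \<Longrightarrow> h * h' \<in> R"
proof -
  assume "h \<in> R" "h' \<in> R"
  then obtain u w u' w' where h: "h = ev2 \<xi> \<eta> u / ev2 \<xi> \<eta> w" "eval_at w (a, b) \<noteq> 0"
    "h' = ev2 \<xi> \<eta> u' / ev2 \<xi> \<eta> w'" "eval_at w' (a, b) \<noteq> 0"
    by (elim R_E) blast
  then show ?thesis
    using R_I[of "w * w'" "u * u'"] by (simp add: ev2.hom_mult eval_at.hom_mult)
qed

lemma R_power: "h \<in> R \<Longrightarrow> h ^ n \<in> R"
  by (induction n) (auto simp: R_one R_mult)

lemma R_sum: "(\<And>i. i \<in> A \<Longrightarrow> f i \<in> R) \<Longrightarrow> sum f A \<in> R"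
  using R_scalar[of 0]
  by (induction A rule: infinite_finite_induct) (auto simp: R_add scalar.hom_zero embed.hom_zero)

lemma R_ev: "h \<in> R \<Longrightarrow> ev scalar h p \<in> R"
  unfolding scalar.ev_eq_sum by (intro R_sum R_mult R_power R_scalar)

lemma R_vge: "h \<in> R \<Longrightarrow> vge 0 h"
proof -
  assume "h \<in> R"
  then obtain u w where h: "h = ev2 \<xi> \<eta> u / ev2 \<xi> \<eta> w" "ev2 \<xi> \<eta> w \<noteq> 0" "v (ev2 \<xi> \<eta> w) = 0"
    by (elim R_E) blast
  then show ?thesis
    using vge_ev2[of u] ev2_in_L by (auto simp: vge_def L_divide v_divide)
qed

lemma R_nonunit:
  assumes "h \<in> R"
  obtains "h \<noteq> 0" "v h = 0" "inverse h \<in> R"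
  | h1 h2 where "h1 \<in> R" "h2 \<in> R" "h = (\<xi> - scalar a) * h1 + (\<eta> - scalar b) * h2"
proof -
  obtain u w where h: "h = ev2 \<xi> \<eta> u / ev2 \<xi> \<eta> w" "eval_at w (a, b) \<noteq> 0" "ev2 \<xi> \<eta> w \<noteq> 0" "v (ev2 \<xi> \<eta> w) = 0"
    using R_E[OF assms] .
  show ?thesis
  proof (cases "eval_at u (a, b) = 0")
    case True
    obtain q p where "ev2 \<xi> \<eta> u = (\<eta> - scalar b) * ev2 \<xi> \<eta> q + (\<xi> - scalar a) * ev2 \<xi> \<eta> [:p:]"
      using eval_at_zero_decompose[OF True] .
    then have "h = (\<xi> - scalar a) * (ev2 \<xi> \<eta> [:p:] / ev2 \<xi> \<eta> w) + (\<eta> - scalar b) * (ev2 \<xi> \<eta> q / ev2 \<xi> \<eta> w)"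
      by (simp add: h add_divide_distrib)
    then show ?thesis using that(2) R_I[OF h(2)] by blast
  next
    case False
    then have "inverse h \<in> R" using R_I[of u w] by (simp add: h)
    moreover have "h \<noteq> 0" "v h = 0" using ev2_unit[OF False] h ev2_in_L by (auto simp: v_divide)
    ultimately show ?thesis using that(1) by blast
  qed
qed

lemma R_inverse:
  assumes "h \<in> R" "h \<noteq> 0" "v h = 0"
  shows "inverse h \<in> R"
  using assms(1)
proof (cases rule: R_nonunit)
  case (2 h1 h2)
  then have "vge 1 h"
    using vge_add[OF vge_mult[OF center(1) R_vge[OF 2(1)]] vge_mult[OF center(2) R_vge[OF 2(2)]]] by simp
  then show ?thesis using assms by (simp add: vge_def)
qed

lemma root_quotient_in_R:
  assumes "b \<noteq> 0" "of_nat n \<noteq> (0 :: 'k)" "p \<noteq> 0" "h \<in> R" "\<eta> ^ n - scalar b ^ n = p * h"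
  shows "(\<eta> - scalar b) / p \<in> R"
proof -
  let ?S = "\<Sum>i<n. scalar b ^ (n - Suc i) * \<eta> ^ i"
  define s where "s = (\<Sum>i<n. [:[:b:]:] ^ (n - Suc i) * [:0, 1:] ^ i)"
  have S: "?S = ev2 \<xi> \<eta> s"
    by (simp only: s_def ev2.hom_sum ev2.hom_mult ev2.hom_power ev2_scalar ev2_snd)
  have "eval_at s (a, b) = (\<Sum>i<n. b ^ (n - Suc i) * b ^ i)"
    by (simp only: s_def eval_at.hom_sum eval_at.hom_mult eval_at.hom_power eval_at_scalar eval_at_snd snd_conv)
  also have "\<dots> = (\<Sum>i<n. b ^ (n - 1))" by (intro sum.cong) (auto simp flip: power_add)
  also have "\<dots> = of_nat n * b ^ (n - 1)" by simp
  finally have "eval_at s (a, b) \<noteq> 0" using assms by simp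
  then have unit: "?S \<noteq> 0" "v ?S = 0" "?S \<in> R" unfolding S using ev2_unit ev2_in_R by auto
  have "(\<eta> - scalar b) * ?S = p * h" using power_diff_sumr2[of \<eta> n "scalar b"] assms(5) by simp
  then have "(\<eta> - scalar b) / p = h * inverse ?S"
    using unit(1) assms(3) by (simp add: divide_simps mult_ac)
  then show ?thesis using R_mult[OF assms(4) R_inverse[OF unit(3,1,2)]] by simp
qed

theorem place_eq:
  assumes frac: "\<And>f. f \<in> L \<Longrightarrow> \<exists>u w. ev2 \<xi> \<eta> w \<noteq> 0 \<and> f = ev2 \<xi> \<eta> u / ev2 \<xi> \<eta> w"
    and p: "p \<in> R" "p \<noteq> 0" "vge 1 p" "(\<xi> - scalar a) / p \<in> R" "(\<eta> - scalar b) / p \<in> R"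
  shows "v p = 1" "valuation_ring L v = R"
proof -
  have "v p = 1 \<and> valuation_ring L v = R"
  proof (rule dominated_ring_eq)
    fix h assume "h \<in> R" "h \<noteq> 0"
    from this(1) show "inverse h \<in> R \<or> h / p \<in> R"
    proof (cases rule: R_nonunit)
      case (2 h1 h2)
      then have "h / p = (\<xi> - scalar a) / p * h1 + (\<eta> - scalar b) / p * h2"
        by (simp add: add_divide_distrib)
      also have "\<dots> \<in> R" by (intro R_add R_mult p 2)
      finally show ?thesis by simp
    qed simp
  next
    fix f assume "f \<in> L"
    then show "\<exists>a\<in>R. \<exists>b\<in>R. b \<noteq> 0 \<and> f = a / b" using frac ev2_in_R by blast
  next
    show "0 < v p" using p by (simp add: vge_def)
  qed (fact R_vge R_one p | erule (1) R_mult)+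
  then show "v p = 1" "valuation_ring L v = R" by auto
qed

end

context superelliptic
begin

lemma regular_fun_eq_ev2: "regular_fun m F u = ev2 coord_x y u"
proof -
  have "embed_poly = ev scalar (coord_x :: 'k ratfun_closure)" by (rule ext) (rule embed_poly_eq_ev)
  then show ?thesis by (simp only: regular_fun_eq_ev ev2_def)
qed

lemma local_ring_eq: "local_ring m F P = coord_ring_at coord_x y P"
  by (simp add: local_ring_def coord_ring_at_def regular_fun_eq_ev2)

lemma centered_placeI:
  assumes "v \<in> places" "\<xi> \<in> L" "\<eta> \<in> L" "dval.vge L v 1 (\<xi> - scalar a)" "dval.vge L v 1 (\<eta> - scalar b)"
  shows "centered_place L v \<xi> \<eta> a b"
  using assms by (simp add: centered_place_def centered_place_axioms_def places_dval embed_in_L)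

lemma vge_ev_scalar:
  assumes v: "v \<in> places" and f: "dval.vge L v 0 f"
  shows "dval.vge L v 0 (ev scalar f p)"
proof -
  interpret dval L "range scalar" v using v by (simp add: places_dval)
  have "vge 0 (scalar c)" for c by (simp add: vge_def embed_in_L v_const)
  then show ?thesis
    unfolding scalar.ev_eq_sum by (intro vge_sum vge_mult0 vge_power f) auto
qed

lemma root_center:
  assumes v: "v \<in> places" and f: "f \<in> L" and p: "p \<noteq> 0" "dval.vge L v 1 (ev scalar f p)"
  shows "\<exists>b. poly p b = 0 \<and> dval.vge L v 1 (f - scalar b)"
proof -
  interpret dval L "range scalar" v using v by (simp add: places_dval)
  obtain A where A: "p = Polynomial.smult (lead_coeff p) (\<Prod>z\<in>#A. [:- z, 1:])"
    using alg_closed_imp_factorization[OF p(1)] by blast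
  have "\<exists>b\<in>#B. vge 1 (f - scalar b)" if "vge 1 (scalar c * ev scalar f (\<Prod>z\<in>#B. [:- z, 1:]))" "c \<noteq> 0" for B c
    using that
  proof (induction B)
    case empty
    then show ?case
      using v_const[of "scalar c"] v_zero by (simp add: vge_def ev1.hom_one scalar.hom_eq_0_iff)
  next
    case (add b B)
    show ?case
    proof (cases "vge 1 (f - scalar b)")
      case False
      let ?g = "scalar c * ev scalar f (\<Prod>z\<in>#B. [:- z, 1:])"
      have fb: "f - scalar b \<in> L" "f - scalar b \<noteq> 0" "v (f - scalar b) \<le> 0"
        using False f by (auto simp: vge_def embed_in_L L.L_diff)
      have gL: "?g \<in> L"
        unfolding scalar.ev_eq_sum by (intro L.L_sum L.L_mult L.L_power embed_in_L f)
      have e: "scalar c * ev scalar f (\<Prod>z\<in>#add_mset b B. [:- z, 1:]) = (f - scalar b) * ?g"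
        by (simp add: scalar.ev_mult scalar.ev_pCons scalar.hom_uminus scalar.hom_one ev1.hom_zero ev1.hom_one
            del: mult_pCons_left mult_pCons_right)
      have "vge 1 ((f - scalar b) * ?g)" using add.prems(1) unfolding e .
      then have "vge 1 ?g"
        using fb gL v_mult[of "f - scalar b" ?g] by (cases "?g = 0") (auto simp: vge_def)
      then show ?thesis using add.IH add.prems by auto
    qed auto
  qed
  moreover have "ev scalar f p = scalar (lead_coeff p) * ev scalar f (\<Prod>z\<in>#A. [:- z, 1:])"
    by (subst A) (simp only: scalar.ev_smult)
  ultimately obtain b where b: "b \<in># A" "vge 1 (f - scalar b)" using p by fastforce
  have "poly p b = 0"
    by (subst A) (use b(1) in \<open>auto simp: poly_prod_mset prod_mset_zero_iff image_iff\<close>)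
  then show ?thesis using b by blast
qed

lemma F_diff:
  obtains G where "embed_poly F - scalar (poly F a) = (coord_x - scalar a) * ev scalar coord_x G"
    "poly F a = 0 \<longrightarrow> poly G a \<noteq> 0"
proof -
  have "poly (F - [:poly F a:]) a = 0" by simp
  then obtain G where G: "F - [:poly F a:] = [:- a, 1:] * G" unfolding poly_eq_0_iff_dvd by blast
  have "poly G a \<noteq> 0" if F0: "poly F a = 0"
  proof -
    obtain i where i: "i \<in> {1..r}" "a = \<alpha> i" using F0 by (auto simp: poly_F_eq_0_iff)
    obtain H where H: "F = [:- \<alpha> i, 1:] * H" "poly H (\<alpha> i) \<noteq> 0" using F_split[OF i(1)] .
    then have "[:- a, 1:] * G = [:- a, 1:] * H" using G F0 i by simp
    then have "G = H" by (subst (asm) mult_left_cancel) auto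
    then show ?thesis using H i by simp
  qed
  moreover have "embed_poly F - scalar (poly F a) = (coord_x - scalar a) * ev scalar coord_x G"
  proof -
    have "embed_poly F - scalar (poly F a) = embed_poly (F - [:poly F a:])" by (simp only: embed.hom_diff)
    also have "\<dots> = embed_poly [:- a, 1:] * embed_poly G" by (simp only: G embed.hom_mult)
    finally show ?thesis by (simp only: x_minus_scalar flip: embed_poly_eq_ev)
  qed
  ultimately show ?thesis using that by blast
qed

lemma affine_center:
  assumes v: "v \<in> places" and x: "dval.vge L v 0 coord_x"
  obtains a b where "(a, b) \<in> affine_points m F" "dval.vge L v 1 (coord_x - scalar a)" "dval.vge L v 1 (y - scalar b)"
proof -
  interpret dval L "range scalar" v using v by (simp add: places_dval)
  have "\<exists>a. vge 1 (coord_x - scalar a)"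
  proof (rule ccontr)
    assume none: "\<not> ?thesis"
    have emb: "v (embed_poly p) = 0" if "p \<noteq> 0" for p
    proof -
      have "\<not> vge 1 (embed_poly p)" "vge 0 (embed_poly p)"
        using root_center[OF v embed_in_L that, of "[:0, 1:]"] none vge_ev_scalar[OF v x, of p]
        by (auto simp flip: embed_poly_eq_ev)
      then show ?thesis by (auto simp: vge_def)
    qed
    have ac: "vge 0 (to_ac g)" for g
    proof -
      obtain p q where g: "g = Fraction_Field.Fract p q" "q \<noteq> 0" by (cases g)
      then show ?thesis
        by (cases "p = 0")
          (auto simp: to_ac_Fract vge_def L.L_divide embed_in_L v_divide embed_poly_eq_0_iff emb embed.hom_zero L.L_zero)
    qed
    have "int m * v y = 0" using emb[OF F_nonzero] v_power[OF y_in_L, of m] by (simp add: y_power)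
    then have "vge 0 y" using m_pos y_in_L by (simp add: vge_def)
    then have "vge 0 (y ^ j)" for j by (rule vge_power)
    obtain f where f: "f \<in> L" "f \<noteq> 0" "v f = - 1" using v_surj by blast
    obtain g where "f = (\<Sum>j<m. to_ac (g j) * y ^ j)" using L_representation[OF f(1)] .
    then have "vge 0 f" by (auto intro!: vge_sum vge_mult0 ac \<open>\<And>j. vge 0 (y ^ j)\<close>)
    then show False using f by (simp add: vge_def)
  qed
  then obtain a where a: "vge 1 (coord_x - scalar a)" by blast
  let ?q = "Polynomial.monom 1 m - [:poly F a:]"
  obtain G where G: "embed_poly F - scalar (poly F a) = (coord_x - scalar a) * ev scalar coord_x G"
    "poly F a = 0 \<longrightarrow> poly G a \<noteq> 0" by (rule F_diff)
  have "ev scalar y ?q = y ^ m - scalar (poly F a)"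
    by (simp only: ev1.hom_diff ev_monom[OF scalar.comm_ring_1_hom_axioms] scalar.ev_const scalar.hom_one) simp
  also have "\<dots> = (coord_x - scalar a) * ev scalar coord_x G" by (simp only: y_power G(1))
  finally have "ev scalar y ?q = (coord_x - scalar a) * ev scalar coord_x G" .
  moreover have "vge 0 (ev scalar coord_x G)" by (rule vge_ev_scalar[OF v x])
  ultimately have "vge 1 (ev scalar y ?q)" using vge_mult[OF a, of 0 "ev scalar coord_x G"] by simp
  moreover have "coeff ?q m = 1" using m_pos by (simp add: coeff_pCons split: nat.splits)
  then have "?q \<noteq> 0" by (metis coeff_0 zero_neq_one)
  ultimately obtain b where "poly ?q b = 0" "vge 1 (y - scalar b)" using root_center[OF v y_in_L] by blast
  then show ?thesis using that[of a b] a by (simp add: affine_points_def poly_monom)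
qed

lemma L_frac: "f \<in> L \<Longrightarrow> \<exists>u w. ev2 coord_x y w \<noteq> 0 \<and> f = ev2 coord_x y u / ev2 coord_x y w"
  unfolding function_field_def regular_fun_eq_ev2 by blast

lemma x_minus_scalar_nonzero: "coord_x - scalar a \<noteq> (0 :: 'k ratfun_closure)"
  by (simp add: x_minus_scalar embed_poly_eq_0_iff)

lemma affine_place:
  assumes v: "v \<in> places" and P: "b ^ m = poly F a"
    and center: "dval.vge L v 1 (coord_x - scalar a)" "dval.vge L v 1 (y - scalar b)"
  shows "valuation_ring L v = local_ring m F (a, b)"
    and "b \<noteq> 0 \<Longrightarrow> v (coord_x - scalar a) = 1"
    and "b = 0 \<Longrightarrow> v y = 1 \<and> v (coord_x - scalar a) = int m"
proof -
  interpret centered_place L v coord_x y a b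
    by (rule centered_placeI) (use assms embed_in_L y_in_L in auto)
  obtain G where G: "embed_poly F - scalar (poly F a) = (coord_x - scalar a) * ev scalar coord_x G"
    "poly F a = 0 \<longrightarrow> poly G a \<noteq> 0" by (rule F_diff[of a])
  note xa = x_minus_scalar_nonzero[of a]
  have xaL: "coord_x - scalar a \<in> L" by (simp add: x_minus_scalar embed_in_L)
  have xaR: "coord_x - scalar a \<in> R"
    using ev2_in_R[of "[:[:0, 1:]:] - [:[:a:]:]"] by (simp only: ev2.hom_diff ev2_fst ev2_scalar)
  have GR: "ev scalar coord_x G \<in> R" by (intro R_ev R_coords)
  have nz: "valuation_ring L v = local_ring m F (a, b) \<and> v (coord_x - scalar a) = 1" if "b \<noteq> 0"
  proof -
    have "y ^ m - scalar b ^ m = (coord_x - scalar a) * ev scalar coord_x G"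
      using G(1) P by (simp add: y_power flip: scalar.hom_power)
    then have div: "(y - scalar b) / (coord_x - scalar a) \<in> R"
      using that m_nonzero xa GR by (intro root_quotient_in_R)
    show ?thesis
      unfolding local_ring_eq
      using place_eq[OF L_frac xaR xa center(1) _ div] xa R_one by auto
  qed
  have z: "valuation_ring L v = local_ring m F (a, b) \<and> v y = 1 \<and> v (coord_x - scalar a) = int m" if b: "b = 0"
  proof -
    have Fa: "poly F a = 0" using P b m_pos by (simp add: zero_power)
    let ?g = "ev scalar coord_x G"
    have "?g = ev2 coord_x y [:G:]" by (simp add: ev2_pCons ev2.hom_zero)
    moreover have "eval_at [:G:] (a, b) \<noteq> 0" using G(2) Fa by (simp add: eval_at_def)
    ultimately have unit: "?g \<noteq> 0" "v ?g = 0" using ev2_unit by metis+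
    have ym: "y ^ m = (coord_x - scalar a) * ?g" using G(1) Fa by (simp add: y_power embed.hom_zero)
    have "y ^ m = y * y ^ (m - 1)" using m_pos by (cases m) auto
    then have "(coord_x - scalar a) / y = y ^ (m - 1) * inverse ?g"
      using ym unit(1) y_nonzero by (simp add: field_simps)
    then have div: "(coord_x - scalar a) / y \<in> R"
      using R_mult[OF R_power[OF R_coords(2)] R_inverse[OF GR unit]] by simp
    have "(y - scalar b) / y = 1" using b y_nonzero by (simp add: embed.hom_zero)
    moreover have "vge 1 y" using center(2) b by (simp add: embed.hom_zero)
    ultimately have *: "v y = 1" "valuation_ring L v = R"
      using place_eq[OF L_frac R_coords(2) y_nonzero _ div] R_one by auto
    have "v (y ^ m) = v (coord_x - scalar a)"
      unfolding ym using unit xa xaL R_vge[OF GR] by (subst v_mult) (auto simp: vge_def)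
    then show ?thesis using * v_power[OF y_in_L, of m] by (simp add: local_ring_eq)
  qed
  show "valuation_ring L v = local_ring m F (a, b)" using nz z by blast
  show "b \<noteq> 0 \<Longrightarrow> v (coord_x - scalar a) = 1" using nz by blast
  show "b = 0 \<Longrightarrow> v y = 1 \<and> v (coord_x - scalar a) = int m" using z by blast
qed

end

section \<open>The places over the line\<close>

lemma fls_subdegree_prod_field:
  fixes f :: "'a \<Rightarrow> 'b :: field fls"
  assumes "\<And>i. i \<in> I \<Longrightarrow> f i \<noteq> 0"
  shows "fls_subdegree (prod f I) = (\<Sum>i\<in>I. fls_subdegree (f i))"
  using assms by (induction I rule: infinite_finite_induct) auto

lemma fls_subdegree_const_plus_X_power:
  fixes a b :: "'a :: field"
  assumes "n > 0"
  shows "fls_subdegree (fls_const a + fls_X ^ n - fls_const b) = (if a = b then int n else 0)"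
proof -
  have eq: "fls_const a + fls_X ^ n - fls_const b = fls_const (a - b) + fls_X ^ n"
    by (simp flip: fls_minus_const)
  have "fls_subdegree (fls_const (a - b) + fls_X ^ n) = 0" if "a \<noteq> b"
    using that assms by (subst fls_subdegree_add_eq1) auto
  then show ?thesis unfolding eq by auto
qed

lemma fls_subdegree_X_power_minus_const:
  fixes a :: "'a :: field"
  assumes "n > 0"
  shows "fls_subdegree (fls_X_inv ^ n - fls_const a) = - int n"
  using assms by (subst fls_subdegree_diff_eq1) auto

definition frac_ring ::
  "'k :: alg_closed_field ratfun_closure \<Rightarrow> 'k ratfun_closure \<Rightarrow> 'k ratfun_closure set" where
  "frac_ring \<xi> \<eta> = {ev2 \<xi> \<eta> u / ev2 \<xi> \<eta> w | u w. ev2 \<xi> \<eta> w \<noteq> 0}"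

lemma frac_ring_I: "ev2 \<xi> \<eta> w \<noteq> 0 \<Longrightarrow> ev2 \<xi> \<eta> u / ev2 \<xi> \<eta> w \<in> frac_ring \<xi> \<eta>"
  by (auto simp: frac_ring_def)

lemma subfield_frac_ring: "subfield_set (frac_ring \<xi> \<eta>)"
proof
  let ?e = "ev2 \<xi> \<eta>"
  show "1 \<in> frac_ring \<xi> \<eta>" using frac_ring_I[of \<xi> \<eta> 1 1] by (simp add: ev2.hom_one)
  fix a b assume "a \<in> frac_ring \<xi> \<eta>"
  then obtain u w where a: "a = ?e u / ?e w" "?e w \<noteq> 0" by (auto simp: frac_ring_def)
  show "- a \<in> frac_ring \<xi> \<eta>" using frac_ring_I[of \<xi> \<eta> w "- u"] a by (simp add: ev2.hom_uminus)
  show "inverse a \<in> frac_ring \<xi> \<eta>"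
    using frac_ring_I[of \<xi> \<eta> u w] frac_ring_I[of \<xi> \<eta> w 0] a by (cases "?e u = 0") (auto simp: ev2.hom_zero)
  assume "b \<in> frac_ring \<xi> \<eta>"
  then obtain u' w' where b: "b = ?e u' / ?e w'" "?e w' \<noteq> 0" by (auto simp: frac_ring_def)
  show "a + b \<in> frac_ring \<xi> \<eta>" using frac_ring_I[of \<xi> \<eta> "w * w'" "u * w' + u' * w"] a b
    by (simp add: ev2.hom_mult ev2.hom_add add_frac_eq)
  show "a * b \<in> frac_ring \<xi> \<eta>" using frac_ring_I[of \<xi> \<eta> "w * w'" "u * u'"] a b by (simp add: ev2.hom_mult)
qed

lemma ev2_in_frac_ring: "ev2 \<xi> \<eta> u \<in> frac_ring \<xi> \<eta>"
  using frac_ring_I[of \<xi> \<eta> 1 u] by (simp add: ev2.hom_one)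

lemma coords_in_frac_ring: "scalar c \<in> frac_ring \<xi> \<eta>" "\<xi> \<in> frac_ring \<xi> \<eta>" "\<eta> \<in> frac_ring \<xi> \<eta>"
  using ev2_in_frac_ring[of \<xi> \<eta> "[:[:c:]:]"] ev2_in_frac_ring[of \<xi> \<eta> "[:[:0, 1:]:]"] ev2_in_frac_ring[of \<xi> \<eta> "[:0, 1:]"]
  by (simp_all only: ev2_scalar ev2_fst ev2_snd)

context superelliptic
begin

lemma L_subset_frac_ring:
  assumes "coord_x \<in> frac_ring \<xi> \<eta>" "y \<in> frac_ring \<xi> \<eta>"
  shows "L \<subseteq> frac_ring \<xi> \<eta>"
proof -
  interpret Q: subfield_set "frac_ring \<xi> \<eta>" by (rule subfield_frac_ring)
  have "ev scalar coord_x p \<in> frac_ring \<xi> \<eta>" for p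
    unfolding scalar.ev_eq_sum by (intro Q.L_sum Q.L_mult Q.L_power coords_in_frac_ring assms)
  then have "ev2 coord_x y u \<in> frac_ring \<xi> \<eta>" for u
    unfolding ev2_def ev1.ev_eq_sum by (intro Q.L_sum Q.L_mult Q.L_power assms)
  then show ?thesis
    unfolding function_field_def regular_fun_eq_ev2 by (auto intro: Q.L_divide)
qed

lemma embed_F: "embed_poly F = (\<Prod>i=1..r. coord_x - scalar (\<alpha> i))"
  by (simp only: F_eq embed.hom_prod x_minus_scalar)

lemma v_y:
  assumes "v \<in> places"
  shows "int m * v y = (\<Sum>i=1..r. v (coord_x - scalar (\<alpha> i)))"
proof -
  interpret dval L "range scalar" v using assms by (simp add: places_dval)
  have "v (embed_poly F) = (\<Sum>i=1..r. v (coord_x - scalar (\<alpha> i)))"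
    unfolding embed_F by (intro v_prod) (use x_minus_scalar_nonzero in \<open>auto simp: x_minus_scalar embed_in_L\<close>)
  then show ?thesis using v_power[OF y_in_L, of m] by (simp add: y_power)
qed

lemma laurent_place:
  fixes \<xi> :: "'k fls"
  assumes deg: "(\<Sum>i=1..r. fls_subdegree (\<xi> - fls_const (\<alpha> i))) = int m * s"
    and nonconst: "fls_subdegree (\<xi> - fls_const a) \<noteq> 0"
    and coprime: "i * fls_subdegree (\<xi> - fls_const a) + j * s = 1"
  obtains v where "v \<in> places" "\<And>b. v (coord_x - scalar b) = fls_subdegree (\<xi> - fls_const b)" "v y = s"
proof -
  interpret c: field_hom "fls_const :: 'k \<Rightarrow> 'k fls" by unfold_locales (auto simp: fls_plus_const)
  interpret e: comm_ring_1_hom "ev fls_const \<xi>" by (rule c.comm_ring_1_hom_ev)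
  have \<xi>: "\<xi> \<noteq> fls_const c" for c
    using nonconst by (auto simp: fls_minus_const)
  then have nz: "\<xi> - fls_const c \<noteq> 0" for c by simp
  have F: "ev fls_const \<xi> F = (\<Prod>i=1..r. \<xi> - fls_const (\<alpha> i))"
    by (simp add: F_eq e.hom_prod c.ev_pCons c.hom_uminus e.hom_zero e.hom_one)
  then have "ev fls_const \<xi> F \<noteq> 0" using nz by simp
  moreover have sub: "fls_subdegree (ev fls_const \<xi> F) = int m * s"
    unfolding F deg[symmetric] using nz by (subst fls_subdegree_prod_field) auto
  ultimately obtain \<eta> where \<eta>: "\<eta> ^ m = ev fls_const \<xi> F"
    using fls_root_exists[of _ m] m_nonzero by (metis dvd_triv_left)
  have "int m * fls_subdegree \<eta> = int m * s"
    using sub by (simp add: fls_subdegree_pow flip: \<eta>)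
  then have "fls_subdegree \<eta> = s" using m_pos by simp
  then show ?thesis
    using place_from_laurent[OF \<xi> \<eta>, of i a j] coprime that by metis
qed

lemma exists_place_over:
  assumes "a \<notin> \<alpha> ` {1..r}"
  obtains v where "v \<in> places" "\<And>b. v (coord_x - scalar b) = (if b = a then 1 else 0)" "v y = 0"
proof -
  define \<xi> :: "'k fls" where "\<xi> = fls_const a + fls_X ^ 1"
  have sub: "fls_subdegree (\<xi> - fls_const b) = (if b = a then 1 else 0)" for b
    unfolding \<xi>_def by (subst fls_subdegree_const_plus_X_power) auto
  show ?thesis
  proof (rule laurent_place[of \<xi> 0 a 1 0])
    show "(\<Sum>i=1..r. fls_subdegree (\<xi> - fls_const (\<alpha> i))) = int m * 0"
      using assms by (auto simp: sub intro!: sum.neutral)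
  qed (use that in \<open>auto simp: sub\<close>)
qed

lemma exists_place_over_root:
  assumes "i \<in> {1..r}"
  obtains v where "v \<in> places" "\<And>b. v (coord_x - scalar b) = (if b = \<alpha> i then int m else 0)" "v y = 1"
proof -
  define \<xi> :: "'k fls" where "\<xi> = fls_const (\<alpha> i) + fls_X ^ m"
  have sub: "fls_subdegree (\<xi> - fls_const b) = (if b = \<alpha> i then int m else 0)" for b
    unfolding \<xi>_def by (subst fls_subdegree_const_plus_X_power) (use m_pos in auto)
  show ?thesis
  proof (rule laurent_place[of \<xi> 1 "\<alpha> i" 0 1])
    have "(\<Sum>j=1..r. fls_subdegree (\<xi> - fls_const (\<alpha> j))) = (\<Sum>j=1..r. if j = i then int m else 0)"
      unfolding sub using assms inj_onD[OF inj_\<alpha>, of _ i] by (intro sum.cong refl) auto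
    then show "(\<Sum>j=1..r. fls_subdegree (\<xi> - fls_const (\<alpha> j))) = int m * 1" using assms by simp
  qed (use that m_pos in \<open>auto simp: sub\<close>)
qed

definition root_place :: "nat \<Rightarrow> 'k place" where "root_place i = point_at m F (\<alpha> i, 0)"

lemma place_over_root:
  assumes i: "i \<in> {1..r}" and v: "v \<in> places" "dval.vge L v 1 (coord_x - scalar (\<alpha> i))"
  shows "valuation_ring L v = local_ring m F (\<alpha> i, 0)" "v y = 1" "v (coord_x - scalar (\<alpha> i)) = int m"
proof -
  interpret dval L "range scalar" v using v by (simp add: places_dval)
  have F0: "poly F (\<alpha> i) = 0" using i by (auto simp: poly_F_eq_0_iff)
  obtain G where G: "embed_poly F - scalar (poly F (\<alpha> i)) = (coord_x - scalar (\<alpha> i)) * ev scalar coord_x G"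
    "poly F (\<alpha> i) = 0 \<longrightarrow> poly G (\<alpha> i) \<noteq> 0" by (rule F_diff)
  have "vge 0 (scalar (\<alpha> i))" by (simp add: vge_def embed_in_L v_const)
  then have "vge 0 coord_x" using vge_add[OF vge_mono[OF v(2), of 0]] by fastforce
  then have "vge 1 (y ^ m)"
    using vge_mult[OF v(2) vge_ev_scalar[OF v(1), of coord_x G]] G(1) F0 by (simp add: y_power embed.hom_zero)
  then have "0 < int m * v y" using y_nonzero by (auto simp: vge_def v_power y_in_L)
  then have "vge 1 y" using y_in_L by (auto simp: vge_def zero_less_mult_iff)
  then have *: "vge 1 (y - scalar 0)" by (simp add: embed.hom_zero)
  have "0 ^ m = poly F (\<alpha> i)" using F0 m_pos by (simp add: zero_power)
  from affine_place[OF v(1) this v(2) *]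
  show "valuation_ring L v = local_ring m F (\<alpha> i, 0)" "v y = 1" "v (coord_x - scalar (\<alpha> i)) = int m" by auto
qed

lemma root_place:
  assumes i: "i \<in> {1..r}"
  shows "root_place i \<in> places" "v \<in> places \<Longrightarrow> dval.vge L v 1 (coord_x - scalar (\<alpha> i)) \<Longrightarrow> v = root_place i"
    "root_place i y = 1" "root_place i (coord_x - scalar b) = (if b = \<alpha> i then int m else 0)"
proof -
  have unique: "v = w" if "v \<in> places" "w \<in> places" "valuation_ring L v = valuation_ring L w" for v w
    using that subfield_L by (intro discrete_valuation_eqI) (auto simp: curve_points_def)
  obtain v where v: "v \<in> places" "\<And>b. v (coord_x - scalar b) = (if b = \<alpha> i then int m else 0)" "v y = 1"
    by (rule exists_place_over_root[OF i]) blast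
  then interpret dval L "range scalar" v by (simp add: places_dval)
  have "vge 1 (coord_x - scalar (\<alpha> i))"
    using v m_pos by (simp add: vge_def x_minus_scalar embed_in_L)
  note ring = place_over_root(1)[OF i v(1) this]
  have R: "root_place i = v"
    unfolding root_place_def point_at_def
  proof (rule the_equality)
    show "v \<in> places \<and> valuation_ring L v = local_ring m F (\<alpha> i, 0)" using v ring by simp
  next
    fix w assume "w \<in> places \<and> valuation_ring L w = local_ring m F (\<alpha> i, 0)"
    then show "w = v" using unique v ring by auto
  qed
  show "root_place i \<in> places" "root_place i y = 1" "root_place i (coord_x - scalar b) = (if b = \<alpha> i then int m else 0)"
    using v by (simp_all add: R)
  show "w = root_place i" if "w \<in> places" "dval.vge L w 1 (coord_x - scalar (\<alpha> i))" for w
    using unique[OF that(1) v(1)] place_over_root(1)[OF i that] ring by (simp add: R)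
qed

lemma points_at_infinity_iff: "v \<in> points_at_infinity m F \<longleftrightarrow> v \<in> places \<and> v coord_x < 0"
proof (cases "v \<in> places")
  case True
  then interpret dval L "range scalar" v by (simp add: places_dval)
  have "coord_x \<in> local_ring m F P" for P
    unfolding local_ring_def
    by (intro CollectI exI[of _ "[:[:0, 1:]:]"] exI[of _ 1])
       (simp only: eval_at.hom_one rf.hom_one regular_fun_eq_ev2[of "[:[:0, 1:]:]"] ev2_fst, simp)
  then have "vge 0 coord_x" if "valuation_ring L v = local_ring m F P" for P
    using that by (simp add: vge_0_iff)
  moreover have "\<exists>P\<in>affine_points m F. valuation_ring L v = local_ring m F P" if x: "vge 0 coord_x"
  proof -
    obtain a b where ab: "(a, b) \<in> affine_points m F" "vge 1 (coord_x - scalar a)" "vge 1 (y - scalar b)"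
      by (rule affine_center[OF True x])
    then have "valuation_ring L v = local_ring m F (a, b)"
      by (intro affine_place(1)[OF True]) (auto simp: affine_points_def)
    then show ?thesis using ab by blast
  qed
  moreover have "vge 0 coord_x \<longleftrightarrow> \<not> v coord_x < 0"
    by (auto simp: vge_def embed_in_L embed_poly_eq_0_iff)
  ultimately show ?thesis using True by (auto simp: points_at_infinity_def)
qed (simp add: points_at_infinity_def)

section \<open>The points at infinity\<close>

definition d :: nat where "d = gcd m r"
definition m' :: nat where "m' = m div d"
definition r' :: nat where "r' = r div d"

lemma d_pos: "d > 0" using m_pos by (simp add: d_def)
lemma m_eq: "m = m' * d" by (simp add: m'_def d_def)
lemma r_eq: "r = r' * d" by (simp add: r'_def d_def)
lemma int_m_eq: "int m = int m' * int d" and int_r_eq: "int r = int r' * int d"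
  by (simp_all only: m_eq[symmetric] r_eq[symmetric] flip: of_nat_mult)
lemma power_m_eq: "z ^ m = (z ^ m') ^ d" for z :: "'a :: monoid_mult"
  by (simp only: m_eq[symmetric] flip: power_mult)
lemma m'_pos: "m' > 0" using int_m_eq m_pos by (cases "m' = 0") auto

lemma d_nonzero: "of_nat d \<noteq> (0 :: 'k)"
proof
  assume "of_nat d = (0 :: 'k)"
  then have "of_nat (m' * d) = (0 :: 'k)" by simp
  then show False using m_nonzero by (simp only: m_eq[symmetric] not_True_eq_False)
qed

lemma coprime_m'_r': "coprime m' r'"
  using m_pos by (simp add: m'_def r'_def d_def div_gcd_coprime)

lemma ex_bezout: "\<exists>(p :: int) (q :: nat). p * int m' + int q * int r' = 1"
proof -
  obtain p q where pq: "p * int m' + q * int r' = 1"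
    using bezout_int[of "int m'" "int r'"] coprime_m'_r' by auto
  have "(p + q div int m' * int r') * int m' + (q mod int m') * int r' = 1"
    using pq by (simp add: algebra_simps flip: minus_div_mult_eq_mod)
  then show ?thesis
    using m'_pos by (intro exI[of _ "p + q div int m' * int r'"] exI[of _ "nat (q mod int m')"]) simp
qed

definition pq :: "int \<times> nat" where "pq = (SOME (p, q). p * int m' + int q * int r' = 1)"

lemma pq: "fst pq * int m' + int (snd pq) * int r' = 1"
proof -
  have "case pq of (p, q) \<Rightarrow> p * int m' + int q * int r' = 1"
    unfolding pq_def using ex_bezout by (intro someI_ex[of "\<lambda>(p, q). p * int m' + int q * int r' = 1"]) auto
  then show ?thesis by (simp add: case_prod_beta)
qed

text \<open>
  The monomials \<open>t\<close> and \<open>u\<close> are a unimodular change of coordinates of the torus in which the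
  points at infinity become the smooth points \<open>(0, \<zeta>)\<close> with \<open>\<zeta>^d = 1\<close>.
\<close>

definition t :: "'k ratfun_closure" where "t = coord_x powi (- fst pq) * y powi (- int (snd pq))"
definition u :: "'k ratfun_closure" where "u = y ^ m' * coord_x powi (- int r')"

lemma x_nonzero: "coord_x \<noteq> (0 :: 'k ratfun_closure)"
  by (simp add: embed_poly_eq_0_iff)

lemma t_in_L: "t \<in> L" and u_in_L: "u \<in> L"
  by (simp_all add: t_def u_def L.L_closed embed_in_L y_in_L)

lemma t_nonzero: "t \<noteq> 0" and u_nonzero: "u \<noteq> 0"
  using x_nonzero y_nonzero by (simp_all add: t_def u_def)

lemma monomial_tu:
  "t powi i * u powi j =
    coord_x powi (- fst pq * i + - int r' * j) * y powi (int m' * j + - int (snd pq) * i)"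
proof -
  have "t powi i = coord_x powi (- fst pq * i) * y powi (- int (snd pq) * i)"
    by (simp only: t_def power_int_mult_distrib power_int_mult)
  moreover have "u powi j = y powi (int m' * j) * coord_x powi (- int r' * j)"
    by (simp only: u_def power_int_mult_distrib power_int_mult power_int_of_nat)
  ultimately show ?thesis
    by (simp only: power_int_add[OF disjI1[OF x_nonzero]] power_int_add[OF disjI1[OF y_nonzero]] mult_ac)
qed

lemma x_eq: "coord_x = t powi (- int m') * u powi (- int (snd pq))"
  and y_eq: "y = t powi (- int r') * u powi (fst pq)"
proof -
  have "- fst pq * - int m' + - int r' * - int (snd pq) = 1" using pq by (simp add: algebra_simps)
  moreover have "int m' * - int (snd pq) + - int (snd pq) * - int m' = 0" by (simp add: algebra_simps)
  ultimately show "coord_x = t powi (- int m') * u powi (- int (snd pq))"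
    unfolding monomial_tu by simp
  have "- fst pq * - int r' + - int r' * fst pq = 0" by (simp add: algebra_simps)
  moreover have "int m' * fst pq + - int (snd pq) * - int r' = 1" using pq by (simp add: algebra_simps)
  ultimately show "y = t powi (- int r') * u powi (fst pq)"
    unfolding monomial_tu by simp
qed

lemma inverse_x: "inverse coord_x = t ^ m' * u ^ snd pq"
  using arg_cong[OF x_eq, of inverse] by (simp add: power_int_minus)

lemma u_power_d:
  obtains G where "u ^ d - 1 = inverse coord_x * ev scalar (inverse coord_x) G"
proof -
  let ?s = "inverse coord_x :: 'k ratfun_closure"
  define H where "H = (\<Prod>i=1..r. [:1, - \<alpha> i:])"
  have "u ^ d = y ^ m * coord_x powi (- int r)"
    unfolding power_m_eq[of y] int_r_eq
    by (simp add: u_def power_mult_distrib power_int_mult power_int_minus flip: mult_minus_left)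
  also have "\<dots> = (\<Prod>i=1..r. coord_x - scalar (\<alpha> i)) * ?s ^ r"
    by (simp add: y_power embed_F power_int_minus power_inverse)
  also have "\<dots> = (\<Prod>i=1..r. (coord_x - scalar (\<alpha> i)) * ?s)"
    by (simp add: prod.distrib)
  also have "\<dots> = (\<Prod>i=1..r. ev scalar ?s [:1, - \<alpha> i:])"
    using x_nonzero
    by (intro prod.cong refl)
       (simp add: scalar.ev_pCons scalar.hom_uminus scalar.hom_one ev1.hom_zero algebra_simps)
  also have "\<dots> = ev scalar ?s H" by (simp only: H_def ev1.hom_prod)
  finally have u: "u ^ d = ev scalar ?s H" .
  have "poly (H - 1) 0 = 0" by (simp add: H_def poly_prod)
  then obtain G where G: "H - 1 = [:- 0, 1:] * G" unfolding poly_eq_0_iff_dvd by blast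
  have "ev scalar ?s H - 1 = ev scalar ?s (H - 1)" by (simp only: ev1.hom_diff ev1.hom_one)
  also have "\<dots> = ?s * ev scalar ?s G" by (simp only: G ev1.hom_mult scalar.ev_X minus_zero)
  finally show ?thesis using that[of G] by (simp only: u)
qed

lemma place_at_infinity:
  assumes v: "v \<in> places" "v coord_x < 0"
  shows "v coord_x = - int m'" "v y = - int r'" "v (coord_x - scalar a) = - int m'"
    and "\<exists>\<zeta>. \<zeta> ^ d = 1 \<and> dval.vge L v 1 (u - scalar \<zeta>) \<and> valuation_ring L v = coord_ring_at t u (0, \<zeta>)"
proof -
  interpret dval L "range scalar" v using v by (simp add: places_dval)
  have xa: "v (coord_x - scalar a) = v coord_x" for a
    using v_add_less[of coord_x "- scalar a"] v x_nonzero by (simp add: embed_in_L L.L_uminus v_uminus v_const)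
  have "int m * v y = int r * v coord_x" using v_y[OF v(1)] by (simp add: xa)
  then have "int d * (int m' * v y) = int d * (int r' * v coord_x)" by (simp add: int_m_eq int_r_eq mult_ac)
  then have eq: "int m' * v y = int r' * v coord_x" using d_pos by simp
  then have "int m' dvd v coord_x"
    using coprime_m'_r' by (metis coprime_dvd_mult_right_iff coprime_int_iff dvd_triv_left)
  then obtain n' where "v coord_x = int m' * n'" by blast
  then obtain n where n: "v coord_x = - int m' * n" by (metis minus_mult_minus)
  then have "int m' * v y = int m' * (- int r' * n)" using eq by (simp add: mult_ac)
  then have vy: "v y = - int r' * n" using m'_pos by (simp only: mult_cancel_left) simp
  have "n > 0" using n v(2) by (simp add: zero_less_mult_iff)
  have "v t = (fst pq * int m' + int (snd pq) * int r') * n"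
    using x_nonzero y_nonzero
    by (simp add: t_def v_mult v_power_int L.L_closed embed_in_L y_in_L n vy algebra_simps)
  then have vt: "v t = n" by (simp add: pq)
  have vu: "v u = 0"
    using x_nonzero y_nonzero
    by (simp add: u_def v_mult v_power_int v_power L.L_closed embed_in_L y_in_L n vy)
  have t1: "vge 1 t" using vt \<open>n > 0\<close> t_in_L by (simp add: vge_def)
  have u0: "vge 0 u" using vu u_in_L by (simp add: vge_def)
  let ?s = "inverse coord_x :: 'k ratfun_closure"
  have s1: "vge 1 ?s"
    using v(2) by (simp add: vge_def v_inverse embed_in_L L.L_inverse)
  then have s0: "vge 0 ?s" by (rule vge_mono) simp
  obtain G where G: "u ^ d - 1 = ?s * ev scalar ?s G" by (rule u_power_d)
  have "vge 1 (u ^ d - 1)"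
    unfolding G using vge_mult[OF s1 vge_ev_scalar[OF v(1) s0, of G]] by simp
  moreover have "ev scalar u (Polynomial.monom 1 d - 1) = u ^ d - 1"
    by (simp only: ev1.hom_diff ev1.hom_one ev_monom[OF scalar.comm_ring_1_hom_axioms] scalar.hom_one) simp
  moreover have "coeff (Polynomial.monom 1 d - 1 :: 'k poly) d = 1" using d_pos by (simp add: coeff_1)
  then have "Polynomial.monom 1 d - 1 \<noteq> (0 :: 'k poly)" by (metis coeff_0 zero_neq_one)
  ultimately obtain \<zeta> where "poly (Polynomial.monom 1 d - 1) \<zeta> = 0" and u\<zeta>: "vge 1 (u - scalar \<zeta>)"
    using root_center[OF v(1) u_in_L] by metis
  then have \<zeta>: "\<zeta> ^ d = 1" by (simp add: poly_monom)
  then have "\<zeta> \<noteq> 0" using d_pos by (auto simp: zero_power)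
  interpret centered_place L v t u 0 \<zeta>
    by (rule centered_placeI) (use v t_in_L u_in_L t1 u\<zeta> in \<open>auto simp: embed.hom_zero\<close>)
  have "coord_x \<in> frac_ring t u" "y \<in> frac_ring t u"
    unfolding x_eq y_eq
    by (intro subfield_set.L_mult subfield_set.L_power_int subfield_frac_ring coords_in_frac_ring)+
  then have frac: "\<exists>h w. ev2 t u w \<noteq> 0 \<and> f = ev2 t u h / ev2 t u w" if "f \<in> L" for f
    using L_subset_frac_ring[of t u] that unfolding frac_ring_def by blast
  have "(u - scalar \<zeta>) / t \<in> coord_ring_at t u (0, \<zeta>)"
  proof (rule root_quotient_in_R[OF \<open>\<zeta> \<noteq> 0\<close> d_nonzero t_nonzero])
    have "t ^ m' = t * t ^ (m' - 1)" using m'_pos by (cases m') auto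
    then have s: "?s = t * (t ^ (m' - 1) * u ^ snd pq)" by (simp only: inverse_x mult.assoc)
    have sR: "?s \<in> coord_ring_at t u (0, \<zeta>)"
      unfolding inverse_x by (intro R_mult R_power R_coords)
    show "t ^ (m' - 1) * u ^ snd pq * ev scalar ?s G \<in> coord_ring_at t u (0, \<zeta>)"
      by (intro R_mult R_power R_coords R_ev sR)
    have "scalar \<zeta> ^ d = (1 :: 'k ratfun_closure)" using \<zeta> by (simp add: scalar.hom_one flip: scalar.hom_power)
    then have "u ^ d - scalar \<zeta> ^ d = ?s * ev scalar ?s G" by (simp only: G)
    also have "\<dots> = (t * (t ^ (m' - 1) * u ^ snd pq)) * ev scalar ?s G" by (simp only: s[symmetric])
    finally show "u ^ d - scalar \<zeta> ^ d = t * (t ^ (m' - 1) * u ^ snd pq * ev scalar ?s G)"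
      by (simp only: mult.assoc)
  qed
  moreover have "(t - scalar 0) / t = 1" using t_nonzero by (simp add: embed.hom_zero)
  ultimately have "v t = 1" "valuation_ring L v = coord_ring_at t u (0, \<zeta>)"
    using place_eq[OF frac R_coords(1) t_nonzero t1] R_one by auto
  then have "n = 1" using vt by simp
  then show "v coord_x = - int m'" "v y = - int r'" "v (coord_x - scalar a) = - int m'"
    using n vy xa by auto
  show "\<exists>\<zeta>. \<zeta> ^ d = 1 \<and> vge 1 (u - scalar \<zeta>) \<and> valuation_ring L v = coord_ring_at t u (0, \<zeta>)"
    using \<zeta> u\<zeta> \<open>valuation_ring L v = _\<close> by blast
qed

lemma exists_place_at_infinity: "\<exists>v. v \<in> places \<and> v coord_x < 0"
proof -
  have sub: "fls_subdegree (fls_X_inv ^ m' - fls_const b) = - int m'" for b :: 'k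
    by (rule fls_subdegree_X_power_minus_const[OF m'_pos])
  have "(\<Sum>i=1..r. fls_subdegree (fls_X_inv ^ m' - fls_const (\<alpha> i))) = int m * (- int r')"
    unfolding sub by (simp add: int_m_eq int_r_eq)
  moreover have "- fst pq * - int m' + - int (snd pq) * - int r' = 1" using pq by simp
  ultimately obtain v where "v \<in> places" "\<And>b. v (coord_x - scalar b) = - int m'"
    using laurent_place[of "fls_X_inv ^ m'" "- int r'" 0 "- fst pq" "- int (snd pq)"] m'_pos
    unfolding sub by auto
  from this(1) this(2)[of 0] show ?thesis using m'_pos by (auto simp: embed.hom_zero)
qed

definition residue_at_infinity :: "'k place \<Rightarrow> 'k" where
  "residue_at_infinity v = (SOME \<zeta>. \<zeta> ^ d = 1 \<and> dval.vge L v 1 (u - scalar \<zeta>) \<and>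
     valuation_ring L v = coord_ring_at t u (0, \<zeta>))"

lemma residue_at_infinity:
  assumes "v \<in> points_at_infinity m F"
  shows "residue_at_infinity v ^ d = 1" "dval.vge L v 1 (u - scalar (residue_at_infinity v))"
    "valuation_ring L v = coord_ring_at t u (0, residue_at_infinity v)"
    "dval.vge L v 1 (u - scalar \<zeta>) \<Longrightarrow> \<zeta> = residue_at_infinity v"
proof -
  have v: "v \<in> places" "v coord_x < 0" using assms by (auto simp: points_at_infinity_iff)
  interpret dval L "range scalar" v using v by (simp add: places_dval)
  from someI_ex[OF place_at_infinity(4)[OF v], folded residue_at_infinity_def]
  show 1: "residue_at_infinity v ^ d = 1" "vge 1 (u - scalar (residue_at_infinity v))"
    "valuation_ring L v = coord_ring_at t u (0, residue_at_infinity v)" by blast+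
  show "\<zeta> = residue_at_infinity v" if "vge 1 (u - scalar \<zeta>)"
  proof (rule ccontr)
    assume "\<zeta> \<noteq> residue_at_infinity v"
    have "vge 1 (- (u - scalar \<zeta>))" using that v_uminus unfolding vge_def by (auto simp: L.L_uminus simp del: minus_diff_eq)
    from vge_add[OF this 1(2)] have "vge 1 (scalar (\<zeta> - residue_at_infinity v))"
      by (simp add: scalar.hom_diff)
    then show False using \<open>\<zeta> \<noteq> _\<close> v_const[of "scalar (\<zeta> - residue_at_infinity v)"]
      by (simp only: vge_def scalar.hom_eq_0_iff) simp
  qed
qed

lemma bij_betw_residue_at_infinity:
  "bij_betw residue_at_infinity (points_at_infinity m F) {\<zeta>. \<zeta> ^ d = 1}"
proof (rule bij_betw_imageI)
  show "inj_on residue_at_infinity (points_at_infinity m F)"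
  proof
    fix v w assume *: "v \<in> points_at_infinity m F" "w \<in> points_at_infinity m F"
      "residue_at_infinity v = residue_at_infinity w"
    then have "valuation_ring L v = valuation_ring L w" using residue_at_infinity(3) by metis
    then show "v = w"
      using * subfield_L by (intro discrete_valuation_eqI) (auto simp: points_at_infinity_def curve_points_def)
  qed
  have "\<zeta> \<in> residue_at_infinity ` points_at_infinity m F" if \<zeta>: "\<zeta> ^ d = 1" for \<zeta>
  proof -
    obtain v where v: "v \<in> places" "v coord_x < 0" using exists_place_at_infinity by blast
    then have "v \<in> points_at_infinity m F" by (simp add: points_at_infinity_iff)
    note res = residue_at_infinity[OF this]
    interpret dval L "range scalar" v using v by (simp add: places_dval)
    define \<zeta>0 where "\<zeta>0 = residue_at_infinity v"
    have "\<zeta>0 \<noteq> 0" using res(1) d_pos by (auto simp: \<zeta>0_def zero_power)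
    obtain \<omega> where \<omega>: "\<omega> ^ m' = \<zeta> / \<zeta>0" using nth_root_exists[OF m'_pos] by blast
    have \<omega>m: "\<omega> ^ m = 1"
      using \<zeta> res(1) by (simp add: power_m_eq \<omega> power_divide \<zeta>0_def)
    let ?w = "conj_place \<omega> v"
    have w: "?w \<in> places" by (rule conj_place[OF \<omega>m v(1)])
    have "?w \<in> points_at_infinity m F"
      using w v by (simp add: points_at_infinity_iff conj_place_embed[OF \<omega>m])
    have xr: "coord_x powi (- int r') = to_ac (Fraction_Field.Fract 1 ([:0, 1:] ^ r'))"
      by (simp add: to_ac_Fract embed.hom_one embed.hom_power power_int_minus divide_inverse)
    have "conj_aut \<omega> u = conj_aut \<omega> (y ^ m') * conj_aut \<omega> (coord_x powi (- int r'))"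
      unfolding u_def by (rule conj_aut_mult[OF \<omega>m]) (simp_all add: L.L_closed y_in_L embed_in_L)
    also have "\<dots> = scalar (\<omega> ^ m') * u"
      by (simp only: u_def xr conj_aut_to_ac[OF \<omega>m] conj_aut_power[OF \<omega>m y_in_L] conj_aut_y[OF \<omega>m]
          power_mult_distrib scalar.hom_power mult.assoc)
    finally have "conj_aut \<omega> u = scalar (\<omega> ^ m') * u" .
    then have cu: "conj_aut \<omega> (u - scalar \<zeta>) = scalar (\<omega> ^ m') * (u - scalar \<zeta>0)"
      using \<open>\<zeta>0 \<noteq> 0\<close> conj_aut_add[OF \<omega>m u_in_L, of "scalar (- \<zeta>)"] conj_aut_embed[OF \<omega>m, of "[:- \<zeta>:]"]
      by (simp add: embed_in_L L.L_uminus scalar.hom_uminus \<omega> algebra_simps flip: scalar.hom_mult)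
    have "vge 0 (scalar (\<omega> ^ m'))" by (simp add: vge_def embed_in_L v_const)
    from vge_mult[OF this res(2)] have "vge 1 (conj_aut \<omega> (u - scalar \<zeta>))"
      unfolding cu \<zeta>0_def by simp
    moreover have "u - scalar \<zeta> \<in> L" by (simp add: L.L_diff u_in_L embed_in_L)
    ultimately have "dval.vge L ?w 1 (u - scalar \<zeta>)"
      using conj_aut_nonzero[OF \<omega>m, of "u - scalar \<zeta>"] w
      by (auto simp: vge_def dval.vge_def[of L "range scalar" ?w] places_dval conj_place_def)
    then show ?thesis
      using residue_at_infinity(4)[OF \<open>?w \<in> points_at_infinity m F\<close>] \<open>?w \<in> points_at_infinity m F\<close> by blast
  qed
  then show "residue_at_infinity ` points_at_infinity m F = {\<zeta>. \<zeta> ^ d = 1}"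
    using residue_at_infinity(1) by blast
qed

lemma card_points_at_infinity: "finite (points_at_infinity m F)" "card (points_at_infinity m F) = d"
  using bij_betw_finite[OF bij_betw_residue_at_infinity] bij_betw_same_card[OF bij_betw_residue_at_infinity]
    card_roots_of_unity[OF d_nonzero] by auto

end

section \<open>Divisors supported on the branch points and at infinity\<close>

lemma size_eq_sum_count:
  assumes "finite S" "set_mset A \<subseteq> S"
  shows "size A = (\<Sum>a\<in>S. count A a)"
  unfolding size_multiset_overloaded_eq
  by (rule sum.mono_neutral_left) (use assms in \<open>auto simp: count_eq_zero_iff\<close>)

context superelliptic
begin

abbreviation \<Delta> :: "(nat \<Rightarrow> int) \<Rightarrow> 'k place \<Rightarrow>\<^sub>0 int" where
  "\<Delta> a \<equiv> Delta_divisor m F r \<alpha> a"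

lemma root_place_eq_iff: "i \<in> {1..r} \<Longrightarrow> j \<in> {1..r} \<Longrightarrow> root_place i = root_place j \<longleftrightarrow> i = j"
  using root_place(4)[of i "\<alpha> i"] root_place(4)[of j "\<alpha> i"] m_pos inj_onD[OF inj_\<alpha>, of i j]
  by (auto split: if_splits)

lemma root_place_finite: "i \<in> {1..r} \<Longrightarrow> root_place i \<notin> points_at_infinity m F"
  using root_place(4)[of i 0] by (auto simp: points_at_infinity_iff embed.hom_zero)

lemma lookup_Delta:
  "Poly_Mapping.lookup (\<Delta> a) v = (\<Sum>i=1..r. if v = root_place i then a i else 0)
     - (if v \<in> points_at_infinity m F then (\<Sum>i=1..r. a i) div int d else 0)"
proof -
  have "Poly_Mapping.lookup (divisor_at_infinity m F) v = (if v \<in> points_at_infinity m F then 1 else 0)"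
    using card_points_at_infinity(1)
    by (simp add: divisor_at_infinity_def lookup_sum lookup_single when_def sum.delta)
  then show ?thesis
    by (simp add: Delta_divisor_def lookup_minus lookup_sum lookup_single when_def root_place_def d_def
        if_distrib[of "(*) _"] eq_commute[of v] cong: if_cong)
qed

lemma lookup_Delta_root_place: "i \<in> {1..r} \<Longrightarrow> Poly_Mapping.lookup (\<Delta> a) (root_place i) = a i"
proof -
  assume i: "i \<in> {1..r}"
  then have "(\<Sum>j=1..r. if root_place i = root_place j then a j else 0) = (\<Sum>j=1..r. if i = j then a j else 0)"
    by (intro sum.cong) (auto simp: root_place_eq_iff)
  then show ?thesis using i by (simp add: lookup_Delta root_place_finite)
qed

lemma lookup_Delta_infinity:
  "v \<in> points_at_infinity m F \<Longrightarrow> Poly_Mapping.lookup (\<Delta> a) v = - ((\<Sum>i=1..r. a i) div int d)"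
  using root_place_finite by (auto simp: lookup_Delta intro!: sum.neutral)

lemma lookup_Delta_other:
  "v \<notin> root_place ` {1..r} \<Longrightarrow> v \<notin> points_at_infinity m F \<Longrightarrow> Poly_Mapping.lookup (\<Delta> a) v = 0"
  by (auto simp: lookup_Delta intro!: sum.neutral)

lemma keys_Delta: "Poly_Mapping.keys (\<Delta> a) \<subseteq> root_place ` {1..r} \<union> points_at_infinity m F"
  using lookup_Delta_other[of _ a] by (fastforce simp: in_keys_iff)

lemma keys_Delta_places: "Poly_Mapping.keys (\<Delta> a) \<subseteq> places"
  using keys_Delta[of a] root_place(1) by (auto simp: points_at_infinity_iff)

lemma v_embed_poly:
  assumes "p \<noteq> 0"
  obtains A where "size A = degree p"
    "\<And>v. v \<in> places \<Longrightarrow> v (embed_poly p) = (\<Sum>a\<in>#A. v (coord_x - scalar a))"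
proof -
  obtain A where A: "size A = degree p" "p = Polynomial.smult (lead_coeff p) (\<Prod>a\<in>#A. [:- a, 1:])"
    using alg_closed_imp_factorization[OF assms] by blast
  have "v (embed_poly p) = (\<Sum>a\<in>#A. v (coord_x - scalar a))" if "v \<in> places" for v
  proof -
    interpret dval L "range scalar" v using that by (simp add: places_dval)
    have nz: "(\<Prod>a\<in>#B. [:- a, 1:]) \<noteq> (0 :: 'k poly)" for B by (auto simp: prod_mset_zero_iff)
    have "v (embed_poly (\<Prod>a\<in>#B. [:- a, 1:])) = (\<Sum>a\<in>#B. v (coord_x - scalar a))" for B
    proof (induction B)
      case (add b B)
      have "embed_poly (\<Prod>a\<in>#add_mset b B. [:- a, 1:]) = (coord_x - scalar b) * embed_poly (\<Prod>a\<in>#B. [:- a, 1:])"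
        by (simp only: x_minus_scalar image_mset_add_mset prod_mset.add_mset embed.hom_mult)
      then show ?case
        using nz[of B] x_minus_scalar_nonzero[of b] add
        by (simp add: v_mult embed_in_L L.L_diff embed_poly_eq_0_iff)
    qed (simp add: embed.hom_one v_one)
    moreover have "embed_poly p = scalar (lead_coeff p) * embed_poly (\<Prod>a\<in>#A. [:- a, 1:])"
      by (subst A(2)) (simp add: flip: embed.hom_mult)
    moreover have "scalar (lead_coeff p) \<noteq> (0 :: 'k ratfun_closure)" using assms by (simp add: embed_poly_eq_0_iff)
    ultimately show ?thesis
      using nz[of A] by (simp add: v_mult embed_in_L embed_poly_eq_0_iff v_const)
  qed
  then show ?thesis using that A(1) by blast
qed

lemma other_place:
  assumes v: "v \<in> places" "v \<notin> root_place ` {1..r}" "v \<notin> points_at_infinity m F"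
  shows "i \<in> {1..r} \<Longrightarrow> v (coord_x - scalar (\<alpha> i)) = 0" "v y = 0"
proof -
  interpret dval L "range scalar" v using v by (simp add: places_dval)
  have x0: "vge 0 coord_x" using v by (auto simp: points_at_infinity_iff vge_def embed_in_L)
  show 1: "v (coord_x - scalar (\<alpha> i)) = 0" if i: "i \<in> {1..r}" for i
  proof -
    have "vge 0 (- scalar (\<alpha> i))" by (simp add: vge_def embed_in_L L.L_uminus v_uminus v_const)
    from vge_add[OF x0 this] have "vge 0 (coord_x - scalar (\<alpha> i))" by simp
    moreover have "\<not> vge 1 (coord_x - scalar (\<alpha> i))" using root_place(2)[OF i v(1)] v(2) i by auto
    ultimately show ?thesis by (auto simp: vge_def)
  qed
  show "v y = 0" using v_y[OF v(1)] 1 m_pos by simp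
qed

lemma principal_imp_congruent:
  assumes dvd: "int d dvd (\<Sum>i=1..r. a i)" and princ: "\<Delta> a \<in> principal_divisors m F"
  shows "\<exists>c. \<forall>i\<in>{1..r}. int m dvd a i - c"
proof -
  obtain f where f: "f \<in> L" "f \<noteq> 0" and div: "\<And>v. v \<in> places \<Longrightarrow> Poly_Mapping.lookup (\<Delta> a) v = v f"
    using princ by (auto simp: principal_divisors_def)
  obtain g where g: "f = (\<Sum>j<m. to_ac (g j) * y ^ j)" using L_representation[OF f(1)] .
  then have "\<exists>j<m. g j \<noteq> 0" using f(2) by (auto intro: ccontr)
  then obtain j where j: "j < m" "g j \<noteq> 0" by blast
  obtain p q where pq: "g j = Fraction_Field.Fract p q" "q \<noteq> 0" by (cases "g j")
  then have "p \<noteq> 0" using j by (auto simp: Zero_fract_def eq_fract)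
  obtain A where A: "\<And>v. v \<in> places \<Longrightarrow> v (embed_poly p) = (\<Sum>a\<in>#A. v (coord_x - scalar a))"
    using v_embed_poly[OF \<open>p \<noteq> 0\<close>] by metis
  obtain B where B: "\<And>v. v \<in> places \<Longrightarrow> v (embed_poly q) = (\<Sum>a\<in>#B. v (coord_x - scalar a))"
    using v_embed_poly[OF \<open>q \<noteq> 0\<close>] by metis
  have bound: "n \<le> (\<Sum>a\<in>#A. v (coord_x - scalar a)) - (\<Sum>a\<in>#B. v (coord_x - scalar a)) + int j * v y"
    if v: "v \<in> places" and n: "\<And>\<zeta>. \<zeta> ^ m = 1 \<Longrightarrow> n \<le> Poly_Mapping.lookup (\<Delta> a) (conj_place \<zeta> v)" for v n
  proof -
    interpret dval L "range scalar" v using v by (simp add: places_dval)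
    have "n \<le> v (to_ac (g j) * y ^ j)"
      using n div[OF conj_place[OF _ v]] by (intro component_bound[OF v g f(2) _ j]) simp
    also have "\<dots> = v (embed_poly p) - v (embed_poly q) + int j * v y"
      using y_nonzero \<open>p \<noteq> 0\<close> pq
      by (simp add: v_mult v_divide v_power to_ac_Fract L.L_closed embed_in_L y_in_L embed_poly_eq_0_iff)
    finally show ?thesis using A B v by simp
  qed
  have conj_x: "conj_place \<zeta> v (coord_x - scalar b) = v (coord_x - scalar b)" if "\<zeta> ^ m = 1" for \<zeta> v b
    by (simp only: x_minus_scalar conj_place_embed[OF that])
  have root_iff: "v = root_place i \<longleftrightarrow> v (coord_x - scalar (\<alpha> i)) > 0" if "v \<in> places" "i \<in> {1..r}" for v i
  proof
    assume "v (coord_x - scalar (\<alpha> i)) > 0"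
    then have "dval.vge L v 1 (coord_x - scalar (\<alpha> i))"
      using that by (subst dval.vge_def) (auto simp: places_dval L.L_diff embed_in_L)
    then show "v = root_place i" using root_place(2) that by blast
  qed (use that root_place(4)[of i "\<alpha> i"] m_pos in auto)
  let ?c = "\<lambda>b. int (count A b) - int (count B b)"
  have root: "a i \<le> int m * ?c (\<alpha> i) + int j" if i: "i \<in> {1..r}" for i
  proof -
    have v: "root_place i \<in> places" by (rule root_place(1)[OF i])
    have "conj_place \<zeta> (root_place i) = root_place i" if "\<zeta> ^ m = 1" for \<zeta>
      using root_iff[OF conj_place[OF that v] i] root_iff[OF v i] conj_x[OF that] by simp
    then have "a i \<le> (\<Sum>b\<in>#A. root_place i (coord_x - scalar b)) - (\<Sum>b\<in>#B. root_place i (coord_x - scalar b))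
        + int j * root_place i y"
      by (intro bound[OF v]) (simp add: lookup_Delta_root_place[OF i])
    then show ?thesis by (simp add: root_place(3,4)[OF i] sum_mset_delta right_diff_distrib)
  qed
  have other: "0 \<le> ?c b" if b: "b \<notin> \<alpha> ` {1..r}" for b
  proof -
    obtain v where v: "v \<in> places" "\<And>a. v (coord_x - scalar a) = (if a = b then 1 else 0)" "v y = 0"
      by (rule exists_place_over[OF b]) blast
    have "Poly_Mapping.lookup (\<Delta> a) (conj_place \<zeta> v) = 0" if \<zeta>: "\<zeta> ^ m = 1" for \<zeta>
    proof (rule lookup_Delta_other)
      show "conj_place \<zeta> v \<notin> root_place ` {1..r}"
      proof
        assume "conj_place \<zeta> v \<in> root_place ` {1..r}"
        then obtain i where i: "i \<in> {1..r}" "conj_place \<zeta> v = root_place i" by blast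
        then have "0 < v (coord_x - scalar (\<alpha> i))"
          using root_iff[OF conj_place[OF \<zeta> v(1)] i(1)] conj_x[OF \<zeta>] by simp
        then show False using v(2) b i(1) by (auto split: if_splits)
      qed
      show "conj_place \<zeta> v \<notin> points_at_infinity m F"
        using conj_x[OF \<zeta>, of v 0] v(2)[of 0] by (auto simp: points_at_infinity_iff embed.hom_zero)
    qed
    then have "0 \<le> (\<Sum>a\<in>#A. v (coord_x - scalar a)) - (\<Sum>a\<in>#B. v (coord_x - scalar a)) + int j * v y"
      by (intro bound[OF v(1)]) simp
    then show ?thesis by (simp add: v sum_mset_delta)
  qed
  have infinity: "int m * (int (size A) - int (size B)) + int r * int j \<le> (\<Sum>i=1..r. a i)"
  proof -
    obtain v where v: "v \<in> places" "v coord_x < 0" using exists_place_at_infinity by blast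
    have "conj_place \<zeta> v \<in> points_at_infinity m F" if "\<zeta> ^ m = 1" for \<zeta>
      using that v by (simp add: points_at_infinity_iff conj_place conj_place_embed)
    then have "- ((\<Sum>i=1..r. a i) div int d)
        \<le> (\<Sum>a\<in>#A. v (coord_x - scalar a)) - (\<Sum>a\<in>#B. v (coord_x - scalar a)) + int j * v y"
      by (intro bound[OF v(1)]) (simp add: lookup_Delta_infinity)
    then have "int m' * (int (size A) - int (size B)) + int r' * int j \<le> (\<Sum>i=1..r. a i) div int d"
      by (simp add: place_at_infinity(2,3)[OF v] algebra_simps)
    then have "int d * (int m' * (int (size A) - int (size B)) + int r' * int j) \<le> int d * ((\<Sum>i=1..r. a i) div int d)"
      by (intro mult_left_mono) auto
    then show ?thesis using dvd by (simp add: int_m_eq int_r_eq algebra_simps)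
  qed
  let ?S = "set_mset A \<union> set_mset B \<union> \<alpha> ` {1..r}"
  have size: "size A = (\<Sum>b\<in>?S. count A b)" "size B = (\<Sum>b\<in>?S. count B b)"
    by (rule size_eq_sum_count; auto)+
  have "(\<Sum>i=1..r. ?c (\<alpha> i)) = (\<Sum>b\<in>\<alpha> ` {1..r}. ?c b)"
    using inj_\<alpha> by (simp add: sum.reindex)
  also have "\<dots> \<le> (\<Sum>b\<in>?S. ?c b)"
    using other by (intro sum_mono2) auto
  also have "\<dots> = int (size A) - int (size B)"
    by (simp add: size sum_subtractf)
  finally have "(\<Sum>i=1..r. ?c (\<alpha> i)) \<le> int (size A) - int (size B)" .
  then have "int m * (\<Sum>i=1..r. ?c (\<alpha> i)) \<le> int m * (int (size A) - int (size B))"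
    by (intro mult_left_mono) auto
  moreover have "(\<Sum>i=1..r. int m * ?c (\<alpha> i) + int j - a i)
      = int m * (\<Sum>i=1..r. ?c (\<alpha> i)) + int r * int j - (\<Sum>i=1..r. a i)"
    by (simp add: sum.distrib sum_subtractf sum_distrib_left right_diff_distrib)
  ultimately have "(\<Sum>i=1..r. int m * ?c (\<alpha> i) + int j - a i) \<le> 0"
    using infinity by linarith
  moreover have nonneg: "0 \<le> int m * ?c (\<alpha> i) + int j - a i" if "i \<in> {1..r}" for i using root[OF that] by simp
  ultimately have "(\<Sum>i=1..r. int m * ?c (\<alpha> i) + int j - a i) = 0"
    by (intro antisym sum_nonneg) auto
  then have "\<forall>i\<in>{1..r}. int m * ?c (\<alpha> i) + int j - a i = 0"
    using nonneg by (subst (asm) sum_nonneg_eq_0_iff) auto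
  then have "\<forall>i\<in>{1..r}. a i - int j = int m * ?c (\<alpha> i)" by auto
  then show ?thesis by (metis dvd_triv_left)
qed

lemma congruent_imp_principal:
  assumes "\<forall>i\<in>{1..r}. int m dvd a i - c"
  shows "\<Delta> a \<in> principal_divisors m F"
proof -
  define b where "b i = (a i - c) div int m" for i
  have a: "a i = c + int m * b i" if "i \<in> {1..r}" for i using assms that by (simp add: b_def)
  define f where "f = y powi c * (\<Prod>i=1..r. (coord_x - scalar (\<alpha> i)) powi b i)"
  have xL: "coord_x - scalar c \<in> L" for c by (simp add: L.L_diff embed_in_L)
  have f: "f \<in> L" "f \<noteq> 0"
    using y_nonzero x_minus_scalar_nonzero by (auto simp: f_def L.L_closed y_in_L xL intro!: L.L_mult L.L_prod)
  have "Poly_Mapping.lookup (\<Delta> a) v = v f" if v: "v \<in> places" for v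
  proof -
    interpret dval L "range scalar" v using v by (simp add: places_dval)
    have "v (\<Prod>i=1..r. (coord_x - scalar (\<alpha> i)) powi b i) = (\<Sum>i=1..r. v ((coord_x - scalar (\<alpha> i)) powi b i))"
      by (rule v_prod) (use xL x_minus_scalar_nonzero in \<open>auto simp: L.L_power_int\<close>)
    moreover have "(\<Prod>i=1..r. (coord_x - scalar (\<alpha> i)) powi b i) \<in> L - {0}"
      using xL x_minus_scalar_nonzero by (auto intro!: L.L_prod L.L_power_int)
    ultimately have vf: "v f = c * v y + (\<Sum>i=1..r. b i * v (coord_x - scalar (\<alpha> i)))"
      using y_nonzero by (simp add: f_def v_mult v_power_int L.L_power_int y_in_L xL)
    consider (root) j where "j \<in> {1..r}" "v = root_place j" | (infinity) "v \<in> points_at_infinity m F"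
      | (other) "v \<notin> root_place ` {1..r}" "v \<notin> points_at_infinity m F" by blast
    then show ?thesis
    proof cases
      case root
      have "(\<Sum>i=1..r. b i * v (coord_x - scalar (\<alpha> i))) = (\<Sum>i=1..r. if i = j then b i * int m else 0)"
        using root inj_onD[OF inj_\<alpha>, of _ j] root_place(4)[of j] by (intro sum.cong) auto
      then show ?thesis
        unfolding vf using root root_place(3)[of j] a[of j] by (simp add: lookup_Delta_root_place)
    next
      case infinity
      then have "v coord_x < 0" by (simp add: points_at_infinity_iff)
      note inf = place_at_infinity(2,3)[OF v this]
      have "(\<Sum>i=1..r. a i) = (\<Sum>i=1..r. c + int m * b i)" using a by (intro sum.cong) auto
      also have "\<dots> = int d * (int r' * c + int m' * (\<Sum>i=1..r. b i))"
        by (simp add: sum.distrib int_m_eq int_r_eq sum_distrib_left algebra_simps)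
      finally have "(\<Sum>i=1..r. a i) div int d = int r' * c + int m' * (\<Sum>i=1..r. b i)"
        using d_pos by simp
      then show ?thesis
        using infinity by (simp add: vf inf lookup_Delta_infinity sum_negf sum_distrib_left mult_ac)
    next
      case other
      then show ?thesis using other_place[OF v] by (simp add: vf lookup_Delta_other)
    qed
  qed
  then show ?thesis using f keys_Delta_places by (auto simp: principal_divisors_def)
qed

lemma principal_iff:
  assumes "int d dvd (\<Sum>i=1..r. a i)"
  shows "\<Delta> a \<in> principal_divisors m F \<longleftrightarrow> (\<forall>i\<in>{1..r}. int m dvd a i - a r)"
proof
  assume "\<Delta> a \<in> principal_divisors m F"
  then obtain c where c: "\<And>i. i \<in> {1..r} \<Longrightarrow> int m dvd a i - c"
    using principal_imp_congruent[OF assms] by blast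
  show "\<forall>i\<in>{1..r}. int m dvd a i - a r"
    using dvd_diff[OF c c[of r]] r_ge_2 by auto
qed (rule congruent_imp_principal)

end

section \<open>The subgroup of the Jacobian\<close>

lemma divisor_degree_eq_sum:
  assumes "finite S" "Poly_Mapping.keys D \<subseteq> S"
  shows "divisor_degree D = (\<Sum>P\<in>S. Poly_Mapping.lookup D P)"
  unfolding divisor_degree_def
  by (rule sum.mono_neutral_left) (use assms in \<open>auto simp: in_keys_iff\<close>)

lemma divisor_degree_add: "divisor_degree (D + E) = divisor_degree D + divisor_degree E"
proof -
  let ?S = "Poly_Mapping.keys D \<union> Poly_Mapping.keys E"
  have "Poly_Mapping.keys (D + E) \<subseteq> ?S" by (rule keys_add)
  then show ?thesis
    by (simp add: divisor_degree_eq_sum[of ?S] lookup_add sum.distrib)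
qed

lemma divisor_degree_uminus: "divisor_degree (- D) = - divisor_degree D"
  using divisor_degree_add[of D "- D"] by (simp add: divisor_degree_def)

context superelliptic
begin

abbreviation Div :: "('k place \<Rightarrow>\<^sub>0 int) monoid" where "Div \<equiv> free_Abelian_group places"
abbreviation Princ :: "('k place \<Rightarrow>\<^sub>0 int) set" where "Princ \<equiv> principal_divisors m F"
abbreviation Q :: "('k place \<Rightarrow>\<^sub>0 int) set monoid" where "Q \<equiv> Div Mod Princ"

lemma subgroup_Princ: "subgroup Princ Div"
proof (rule group.subgroupI[OF group_free_Abelian_group])
  show "Princ \<subseteq> carrier Div" by (auto simp: principal_divisors_def)
  have "0 \<in> Princ"
    unfolding principal_divisors_def
    using L.L_one dval.v_one places_dval by (auto intro!: bexI[of _ 1])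
  then show "Princ \<noteq> {}" by blast
  fix D assume "D \<in> Princ"
  then obtain f where D: "Poly_Mapping.keys D \<subseteq> places" "f \<in> L" "f \<noteq> 0" "\<And>v. v \<in> places \<Longrightarrow> Poly_Mapping.lookup D v = v f"
    by (auto simp: principal_divisors_def)
  have "v (inverse f) = - v f" if "v \<in> places" for v
    using dval.v_inverse that D(2) unfolding places_dval by blast
  then have "- D \<in> Princ"
    unfolding principal_divisors_def using D by (auto intro!: bexI[of _ "inverse f"] simp: L.L_inverse)
  then show "inv\<^bsub>Div\<^esub> D \<in> Princ" using D by simp
  fix E assume "E \<in> Princ"
  then obtain g where E: "Poly_Mapping.keys E \<subseteq> places" "g \<in> L" "g \<noteq> 0" "\<And>v. v \<in> places \<Longrightarrow> Poly_Mapping.lookup E v = v g"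
    by (auto simp: principal_divisors_def)
  have "Poly_Mapping.keys (D + E) \<subseteq> places" using D E keys_add[of D E] by blast
  moreover have "v (f * g) = v f + v g" if "v \<in> places" for v
    using dval.v_mult that D(2,3) E(2,3) unfolding places_dval by blast
  ultimately show "D \<otimes>\<^bsub>Div\<^esub> E \<in> Princ"
    unfolding principal_divisors_def using D E by (auto intro!: bexI[of _ "f * g"] simp: L.L_mult lookup_add)
qed

lemma normal_Princ: "Princ \<lhd> Div"
  by (rule comm_group.subgroup_imp_normal[OF abelian_free_Abelian_group subgroup_Princ])

sublocale Q: group Q
  by (rule normal.factorgroup_is_group[OF normal_Princ])

abbreviation cls :: "('k place \<Rightarrow>\<^sub>0 int) \<Rightarrow> ('k place \<Rightarrow>\<^sub>0 int) set" where
  "cls D \<equiv> Princ #>\<^bsub>Div\<^esub> D"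

lemma group_hom_cls: "group_hom Div Q cls"
  using normal.r_coset_hom_Mod[OF normal_Princ]
  by (simp add: group_hom_def group_hom_axioms_def Q.group_axioms)

lemma divisor_class_eq: "divisor_class m F D = cls D"
  by (simp add: divisor_class_def divisors_deg0_def r_coset_def)

definition deg0 :: "('k place \<Rightarrow>\<^sub>0 int) set" where
  "deg0 = {D. Poly_Mapping.keys D \<subseteq> places \<and> divisor_degree D = 0}"

lemma subgroup_deg0: "subgroup deg0 Div"
proof (rule group.subgroupI[OF group_free_Abelian_group])
  have "0 \<in> deg0" by (simp add: deg0_def divisor_degree_def)
  then show "deg0 \<noteq> {}" by blast
qed (use keys_add in \<open>fastforce simp: deg0_def divisor_degree_add divisor_degree_uminus\<close>)+

text \<open>
  The Jacobian is the image of the divisors of degree zero in the quotient of all divisors by the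
  principal ones. This reading does not presuppose that principal divisors have degree zero.
\<close>

lemma jacobian_eq: "jacobian m F = Q\<lparr>carrier := cls ` deg0\<rparr>"
  by (auto simp: jacobian_def divisors_deg0_def FactGroup_def RCOSETS_def r_coset_def set_mult_def deg0_def fun_eq_iff)

definition Deltas :: "(nat \<Rightarrow> int) monoid" where
  "Deltas = \<lparr>carrier = {a. int d dvd (\<Sum>i=1..r. a i)}, monoid.mult = (\<lambda>a b i. a i + b i), one = (\<lambda>_. 0)\<rparr>"

lemma group_Deltas: "group Deltas"
proof (rule groupI)
  fix a assume "a \<in> carrier Deltas"
  then show "\<exists>b\<in>carrier Deltas. b \<otimes>\<^bsub>Deltas\<^esub> a = \<one>\<^bsub>Deltas\<^esub>"
    by (intro bexI[of _ "\<lambda>i. - a i"]) (auto simp: Deltas_def sum_negf)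
qed (auto simp: Deltas_def sum.distrib fun_eq_iff)

lemma Delta_add:
  assumes "int d dvd (\<Sum>i=1..r. a i)"
  shows "\<Delta> (\<lambda>i. a i + b i) = \<Delta> a + \<Delta> b"
proof -
  have "(\<Sum>i=1..r. a i + b i) div int d = (\<Sum>i=1..r. a i) div int d + (\<Sum>i=1..r. b i) div int d"
    unfolding sum.distrib by (rule div_plus_div_distrib_dvd_left[OF assms])
  then show ?thesis
    unfolding Delta_divisor_def d_def[symmetric] by (simp add: sum.distrib frag_cmul_distrib)
qed

lemma divisor_degree_Delta:
  assumes "int d dvd (\<Sum>i=1..r. a i)"
  shows "divisor_degree (\<Delta> a) = 0"
proof -
  let ?R = "root_place ` {1..r}" and ?I = "points_at_infinity m F"
  have "divisor_degree (\<Delta> a) = (\<Sum>v\<in>?R \<union> ?I. Poly_Mapping.lookup (\<Delta> a) v)"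
    by (rule divisor_degree_eq_sum) (use card_points_at_infinity(1) keys_Delta in auto)
  also have "\<dots> = (\<Sum>v\<in>?R. Poly_Mapping.lookup (\<Delta> a) v) + (\<Sum>v\<in>?I. Poly_Mapping.lookup (\<Delta> a) v)"
    by (rule sum.union_disjoint) (use card_points_at_infinity(1) root_place_finite in auto)
  also have "(\<Sum>v\<in>?R. Poly_Mapping.lookup (\<Delta> a) v) = (\<Sum>i=1..r. Poly_Mapping.lookup (\<Delta> a) (root_place i))"
    by (subst sum.reindex) (auto simp: inj_on_def root_place_eq_iff)
  also have "\<dots> = (\<Sum>i=1..r. a i)" by (intro sum.cong refl lookup_Delta_root_place)
  also have "(\<Sum>v\<in>?I. Poly_Mapping.lookup (\<Delta> a) v) = - (int d * ((\<Sum>i=1..r. a i) div int d))"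
    by (simp add: lookup_Delta_infinity card_points_at_infinity(2))
  finally show ?thesis using assms by simp
qed

lemma group_hom_Delta: "group_hom Deltas Q (\<lambda>a. cls (\<Delta> a))"
proof -
  interpret cls: group_hom Div Q cls by (rule group_hom_cls)
  have "(\<lambda>a. cls (\<Delta> a)) \<in> hom Deltas Q"
  proof (rule homI)
    fix a b assume "a \<in> carrier Deltas" "b \<in> carrier Deltas"
    then have "\<Delta> (a \<otimes>\<^bsub>Deltas\<^esub> b) = \<Delta> a \<otimes>\<^bsub>Div\<^esub> \<Delta> b"
      by (simp add: Deltas_def Delta_add)
    then show "cls (\<Delta> (a \<otimes>\<^bsub>Deltas\<^esub> b)) = cls (\<Delta> a) \<otimes>\<^bsub>Q\<^esub> cls (\<Delta> b)"
      using cls.hom_mult[of "\<Delta> a" "\<Delta> b"] keys_Delta_places by (simp only: carrier_free_Abelian_group_iff)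
  qed (use cls.hom_closed keys_Delta_places in simp)
  then show ?thesis by (simp add: group_hom_def group_hom_axioms_def group_Deltas Q.group_axioms)
qed

lemma Delta_classes_eq: "Delta_classes m F r \<alpha> = (\<lambda>a. cls (\<Delta> a)) ` carrier Deltas"
  by (auto simp: Delta_classes_def divisor_class_eq Deltas_def d_def)

lemma subgroup_Delta_Q: "subgroup (Delta_classes m F r \<alpha>) Q"
  unfolding Delta_classes_eq
  by (rule group_hom.subgroup_img_is_subgroup[OF group_hom_Delta group.subgroup_self[OF group_Deltas]])

lemma subgroup_Delta: "subgroup (Delta_classes m F r \<alpha>) (jacobian m F)"
  unfolding jacobian_eq
proof (rule Q.subgroup_incl[OF subgroup_Delta_Q])
  show "subgroup (cls ` deg0) Q"
    by (rule group_hom.subgroup_img_is_subgroup[OF group_hom_cls subgroup_deg0])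
  show "Delta_classes m F r \<alpha> \<subseteq> cls ` deg0"
    unfolding Delta_classes_eq
    by (auto simp: Deltas_def deg0_def divisor_degree_Delta subsetD[OF keys_Delta_places] intro!: imageI)
qed

abbreviation T :: "((nat \<Rightarrow> int) \<times> int) monoid" where
  "T \<equiv> product_group {..<r - 2} (\<lambda>_. integer_mod_group m) \<times>\<times> integer_mod_group m'"

text \<open>
  Modulo the relations one may normalize \<open>a r = 0\<close>; the coordinates are then the first \<open>r - 2\<close>
  coefficients modulo \<open>m\<close> and the sum of all coefficients, which lies in \<open>d\<int>\<close> modulo \<open>m\<close>.
\<close>

definition \<kappa> :: "(nat \<Rightarrow> int) \<Rightarrow> (nat \<Rightarrow> int) \<times> int" where
  "\<kappa> a = ((\<lambda>i\<in>{..<r - 2}. (a (Suc i) - a r) mod int m),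
     (((\<Sum>i=1..r. a i) - int r * a r) div int d) mod int m')"

lemma group_T: "group T"
  by (intro DirProd_group product_group) auto

lemma d_dvd_r: "int d dvd int r"
  by (simp add: int_r_eq)

lemma group_hom_\<kappa>: "group_hom Deltas T \<kappa>"
proof -
  have "\<kappa> \<in> hom Deltas T"
  proof (rule homI)
    fix a assume "a \<in> carrier Deltas"
    then show "\<kappa> a \<in> carrier T"
      using m_pos m'_pos by (auto simp: \<kappa>_def carrier_integer_mod_group)
  next
    fix a b assume ab: "a \<in> carrier Deltas" "b \<in> carrier Deltas"
    let ?s = "\<lambda>a. (\<Sum>i=1..r. a i) - int r * a r"
    have dvd: "int d dvd ?s a" using ab d_dvd_r by (auto simp: Deltas_def)
    have s: "?s (\<lambda>i. a i + b i) = ?s a + ?s b" by (simp add: sum.distrib algebra_simps)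
    have "?s (\<lambda>i. a i + b i) div int d = ?s a div int d + ?s b div int d"
      unfolding s by (rule div_plus_div_distrib_dvd_left[OF dvd])
    moreover have "(a i + b i - (a r + b r)) mod int m = ((a i - a r) mod int m + (b i - b r) mod int m) mod int m" for i
      by (simp add: mod_add_eq algebra_simps)
    ultimately show "\<kappa> (a \<otimes>\<^bsub>Deltas\<^esub> b) = \<kappa> a \<otimes>\<^bsub>T\<^esub> \<kappa> b"
      by (auto simp: \<kappa>_def Deltas_def DirProd_def mod_add_eq)
  qed
  then show ?thesis by (simp add: group_hom_def group_hom_axioms_def group_Deltas group_T)
qed

lemma sum_split_last_two:
  fixes a :: "nat \<Rightarrow> int"
  shows "(\<Sum>i=1..r. a i) = (\<Sum>i<r - 2. a (Suc i)) + a (r - 1) + a r"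
proof -
  obtain k where r: "r = Suc (Suc k)" using r_ge_2 by (metis add_2_eq_Suc le_Suc_ex)
  have "(\<Sum>i=1..k. a i) = (\<Sum>i<k. a (Suc i))"
    by (simp add: sum.atLeast1_atMost_eq)
  then show ?thesis by (simp add: r)
qed

lemma \<kappa>_image: "\<kappa> ` carrier Deltas = carrier T"
proof
  show "\<kappa> ` carrier Deltas \<subseteq> carrier T"
    using group_hom.hom_closed[OF group_hom_\<kappa>] by blast
  show "carrier T \<subseteq> \<kappa> ` carrier Deltas"
  proof
    fix z assume "z \<in> carrier T"
    then obtain c e where z: "z = (c, e)" "c \<in> (\<Pi>\<^sub>E i\<in>{..<r - 2}. {0..<int m})" "e \<in> {0..<int m'}"
      using m_pos m'_pos by (auto simp: carrier_integer_mod_group)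
    define a where "a i = (if i \<le> r - 2 then c (i - 1) else if i = r - 1 then int d * e - (\<Sum>i<r - 2. c i) else 0)" for i
    have a: "a r = 0" "a (r - 1) = int d * e - (\<Sum>i<r - 2. c i)" "i < r - 2 \<Longrightarrow> a (Suc i) = c i" for i
      using r_ge_2 by (auto simp: a_def)
    have sum: "(\<Sum>i=1..r. a i) = int d * e"
      unfolding sum_split_last_two using a(2) by (simp add: a(1,3))
    have "(\<lambda>i\<in>{..<r - 2}. (a (Suc i) - a r) mod int m) = c"
    proof
      fix i show "(\<lambda>i\<in>{..<r - 2}. (a (Suc i) - a r) mod int m) i = c i"
        using z(2) a by (cases "i < r - 2") (auto simp: PiE_def Pi_def extensional_def)
    qed
    then have "\<kappa> a = z" unfolding \<kappa>_def sum using z(1,3) d_pos by (simp add: a(1))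
    moreover have "a \<in> carrier Deltas" by (simp add: Deltas_def sum del: One_nat_def)
    ultimately show "z \<in> \<kappa> ` carrier Deltas" by blast
  qed
qed

lemma \<kappa>_eq_one_iff:
  assumes "a \<in> carrier Deltas"
  shows "\<kappa> a = \<one>\<^bsub>T\<^esub> \<longleftrightarrow> (\<forall>i\<in>{1..r}. int m dvd a i - a r)"
proof -
  let ?s = "(\<Sum>i=1..r. a i) - int r * a r"
  have dvd: "int d dvd ?s" using assms d_dvd_r by (auto simp: Deltas_def)
  have s: "?s = (\<Sum>i<r - 2. a (Suc i) - a r) + (a (r - 1) - a r)"
    using sum_split_last_two[of "\<lambda>i. a i - a r"] by (simp add: sum_subtractf)
  have "\<kappa> a = \<one>\<^bsub>T\<^esub> \<longleftrightarrow> (\<forall>i<r - 2. int m dvd a (Suc i) - a r) \<and> int m' dvd ?s div int d"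
    by (auto simp: \<kappa>_def DirProd_def restrict_def fun_eq_iff mod_eq_0_iff_dvd)
  also have "int m' dvd ?s div int d \<longleftrightarrow> int m dvd ?s"
    using dvd d_pos by (auto simp: int_m_eq dvd_div_iff_mult)
  also have "(\<forall>i<r - 2. int m dvd a (Suc i) - a r) \<and> int m dvd ?s \<longleftrightarrow>
      (\<forall>i<r - 2. int m dvd a (Suc i) - a r) \<and> int m dvd a (r - 1) - a r"
  proof -
    have "int m dvd ?s \<longleftrightarrow> int m dvd a (r - 1) - a r" if "\<forall>i<r - 2. int m dvd a (Suc i) - a r"
      unfolding s by (rule dvd_add_right_iff) (use that in \<open>auto intro: dvd_sum\<close>)
    then show ?thesis by blast
  qed
  also have "\<dots> \<longleftrightarrow> (\<forall>i\<in>{1..r}. int m dvd a i - a r)"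
  proof safe
    fix i assume *: "\<forall>i<r - 2. int m dvd a (Suc i) - a r" "int m dvd a (r - 1) - a r" and i: "i \<in> {1..r}"
    consider "i - 1 < r - 2" | "i = r - 1" | "i = r" using i by fastforce
    then show "int m dvd a i - a r"
    proof cases
      case 1
      then show ?thesis using *(1) i by (metis Suc_pred' atLeastAtMost_iff less_eq_Suc_le One_nat_def)
    qed (use * in auto)
  qed (use r_ge_2 in auto)
  finally show ?thesis .
qed

lemma Delta_iso: "(jacobian m F)\<lparr>carrier := Delta_classes m F r \<alpha>\<rparr> \<cong> T"
proof -
  let ?D = "Q\<lparr>carrier := Delta_classes m F r \<alpha>\<rparr>"
  have "group ?D" using Q.subgroup_imp_group[OF subgroup_Delta_Q] .
  moreover have "(\<lambda>a. cls (\<Delta> a)) \<in> hom Deltas ?D"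
    using group_hom.homh[OF group_hom_Delta] by (auto simp: hom_def Delta_classes_eq)
  ultimately interpret D: group_hom Deltas ?D "\<lambda>a. cls (\<Delta> a)"
    by (simp add: group_hom_def group_hom_axioms_def group_Deltas)
  interpret \<kappa>: group_hom Deltas T \<kappa> by (rule group_hom_\<kappa>)
  have "cls (\<Delta> a) = Princ \<longleftrightarrow> \<kappa> a = \<one>\<^bsub>T\<^esub>" if a: "a \<in> carrier Deltas" for a
  proof -
    have "cls (\<Delta> a) = Princ \<longleftrightarrow> \<Delta> a \<in> Princ"
      using group.coset_join1[OF group_free_Abelian_group _ _ subgroup_Princ]
        group.coset_join2[OF group_free_Abelian_group _ subgroup_Princ] keys_Delta_places[of a]
      by (metis carrier_free_Abelian_group_iff)
    then show ?thesis using a principal_iff[of a] \<kappa>_eq_one_iff[OF a] by (simp add: Deltas_def)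
  qed
  then have "kernel Deltas ?D (\<lambda>a. cls (\<Delta> a)) = kernel Deltas T \<kappa>"
    unfolding kernel_def by auto
  then have D: "Deltas Mod kernel Deltas T \<kappa> \<cong> ?D"
    using D.FactGroup_iso by (simp add: Delta_classes_eq)
  have "?D \<cong> Deltas Mod kernel Deltas T \<kappa>"
    by (rule group.iso_sym[OF normal.factorgroup_is_group[OF \<kappa>.normal_kernel] D])
  also have "Deltas Mod kernel Deltas T \<kappa> \<cong> T"
    by (rule \<kappa>.FactGroup_iso[OF \<kappa>_image])
  finally (iso_trans) have "?D \<cong> T" .
  then show ?thesis by (simp add: jacobian_eq)
qed

end

theorem proposition1:
  fixes m r :: nat and \<alpha> :: "nat \<Rightarrow> 'a :: field" and F :: "'a poly"
  assumes "perfect_field TYPE('a)"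
    and "m \<ge> 2" and "\<not> CHAR('a) dvd m"
    and "r \<ge> 2" and "inj_on \<alpha> {1..r}"
    and "F = (\<Prod>i=1..r. [:- \<alpha> i, 1:])"
  shows "subgroup (Delta_classes m (map_poly to_ac F) r (\<lambda>i. to_ac (\<alpha> i)))
           (jacobian m (map_poly to_ac F))
       \<and> (jacobian m (map_poly to_ac F))
           \<lparr>carrier := Delta_classes m (map_poly to_ac F) r (\<lambda>i. to_ac (\<alpha> i))\<rparr>
         \<cong> product_group {..<r - 2} (\<lambda>_. integer_mod_group m)
             \<times>\<times> integer_mod_group (m div gcd m r)"
proof -
  have map_mult: "map_poly to_ac (p * q) = map_poly to_ac p * map_poly to_ac q" for p q :: "'a poly"
    by (rule poly_eqI) (simp add: coeff_map_poly coeff_mult to_ac_sum)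
  have "map_poly to_ac (\<Prod>i\<in>A. [:- \<alpha> i, 1:]) = (\<Prod>i\<in>A. [:- to_ac (\<alpha> i), 1:])" for A
    by (induction A rule: infinite_finite_induct)
       (auto simp: map_mult map_poly_pCons simp del: mult_pCons_left)
  then have F: "map_poly to_ac F = (\<Prod>i=1..r. [:- to_ac (\<alpha> i), 1:])"
    by (simp only: assms(6))
  have "of_nat m \<noteq> (0 :: 'a alg_closure)"
  proof
    assume "of_nat m = (0 :: 'a alg_closure)"
    then have "to_ac (of_nat m :: 'a) = 0" by simp
    then show False using assms(3) by (simp only: to_ac.hom_eq_0_iff of_nat_eq_0_iff_char_dvd)
  qed
  moreover have "inj_on (\<lambda>i. to_ac (\<alpha> i)) {1..r}"
    using assms(5) by (simp only: inj_on_def to_ac.hom_eq_iff)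
  ultimately interpret superelliptic m r "\<lambda>i. to_ac (\<alpha> i)" "map_poly to_ac F"
    by (intro superelliptic.intro assms(2) assms(4) F)
  show ?thesis
    using subgroup_Delta Delta_iso by (simp add: m'_def d_def)
qed

end
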